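(* Let $V$ be a finite abelian group and let $d\ge3$ be an integer. Then $$\lim_{n\to\infty}\sum_{q\in V^n}d_\infty(A_nq,U_{q,d})=0.$$
   Context: $A_n=P_1+\dots+P_d$, where $P_1,\dots,P_d$ are independent uniform random $n\times n$ permutation matrices; it acts on $V^n$ by $(A_nq)_i=\sum_j (A_n)_{ij}q_j$. For $q=(q_1,\dots,q_n)\in V^n$, $\mathrm{MinC}_q$ is the minimal coset (of a subgroup) in $V$ containing $q_1,\dots,q_n$, i.e. $\mathrm{MinC}_q=q_n+V_0$ where $V_0$ is the subgroup generated by $q_1-q_n,\dots,q_{n-1}-q_n$. Put $s(q)=\sum_{i=1}^nq_i$, $d\cdot\mathrm{MinC}_q=\{g_1+\dots+g_d: g_1,\dots,g_d\in\mathrm{MinC}_q\}$, and $R(q,d)=\{r\in(d\cdot\mathrm{MinC}_q)^n: s(r)=d\,s(q)\}$. $U_{q,d}$ is a uniform random element of $R(q,d)$. For random variables $X,Y$ with values in a finite set $\mathcal{R}$ (here $\mathcal R=V^n$), $d_\infty(X,Y)=\max_{r\in\mathcal{R}}|\mathbb{P}(X=r)-\mathbb{P}(Y=r)|$. *)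

theory Defs
  imports
    "HOL-Probability.Probability"
    "HOL-Computational_Algebra.Group_Closure"
begin

text \<open>Vectors and matrices of size \<open>n\<close> are indexed by \<open>{1..n}\<close>.  Vectors are extensional
  functions, so that \<open>vectors n\<close> is a finite set with exactly \<open>CARD('a) ^ n\<close> elements;
  matrices vanish outside \<open>{1..n} \<times> {1..n}\<close>.\<close>

definition vectors :: "nat \<Rightarrow> (nat \<Rightarrow> 'a) set" where
  "vectors n = {1..n} \<rightarrow>\<^sub>E UNIV"

definition nat_scale :: "nat \<Rightarrow> 'a::comm_monoid_add \<Rightarrow> 'a" where
  "nat_scale k v = (\<Sum>_<k. v)"

definition mat_act :: "nat \<Rightarrow> (nat \<Rightarrow> nat \<Rightarrow> nat) \<Rightarrow> (nat \<Rightarrow> 'a::comm_monoid_add) \<Rightarrow> nat \<Rightarrow> 'a" where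
  "mat_act n M q = (\<lambda>i\<in>{1..n}. \<Sum>j=1..n. nat_scale (M i j) (q j))"

definition perm_matrix :: "nat \<Rightarrow> (nat \<Rightarrow> nat) \<Rightarrow> nat \<Rightarrow> nat \<Rightarrow> nat" where
  "perm_matrix n \<sigma> i j = (if i \<in> {1..n} \<and> j \<in> {1..n} \<and> \<sigma> i = j then 1 else 0)"

definition perm_matrices :: "nat \<Rightarrow> (nat \<Rightarrow> nat \<Rightarrow> nat) set" where
  "perm_matrices n = perm_matrix n ` {\<sigma>. \<sigma> permutes {1..n}}"

text \<open>The law of \<open>A\<^sub>n = P\<^sub>1 + \<dots> + P\<^sub>d\<close>.  The product distribution \<open>Pi_pmf\<close> makes
  \<open>P\<^sub>1, \<dots>, P\<^sub>d\<close> independent; its second argument is only the value of \<open>P\<close> outside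
  \<open>{1..d}\<close>, which is never used.\<close>

definition A_pmf :: "nat \<Rightarrow> nat \<Rightarrow> (nat \<Rightarrow> nat \<Rightarrow> nat) pmf" where
  "A_pmf n d =
     map_pmf (\<lambda>P i j. \<Sum>k=1..d. P k i j)
       (Pi_pmf {1..d} (\<lambda>_ _. 0) (\<lambda>_. pmf_of_set (perm_matrices n)))"

definition MinC :: "nat \<Rightarrow> (nat \<Rightarrow> 'a::ab_group_add) \<Rightarrow> 'a set" where
  "MinC n q = (\<lambda>v. q n + v) ` group_closure ((\<lambda>i. q i - q n) ` {1..<n})"

definition vec_sum :: "nat \<Rightarrow> (nat \<Rightarrow> 'a::comm_monoid_add) \<Rightarrow> 'a" where
  "vec_sum n q = (\<Sum>i=1..n. q i)"

definition set_multiple :: "nat \<Rightarrow> 'a::comm_monoid_add set \<Rightarrow> 'a set" where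
  "set_multiple d C = {\<Sum>k=1..d. g k | g. \<forall>k\<in>{1..d}. g k \<in> C}"

definition R_set :: "nat \<Rightarrow> (nat \<Rightarrow> 'a::ab_group_add) \<Rightarrow> nat \<Rightarrow> (nat \<Rightarrow> 'a) set" where
  "R_set n q d = {r \<in> {1..n} \<rightarrow>\<^sub>E set_multiple d (MinC n q). vec_sum n r = nat_scale d (vec_sum n q)}"

definition U_pmf :: "nat \<Rightarrow> (nat \<Rightarrow> 'a::ab_group_add) \<Rightarrow> nat \<Rightarrow> (nat \<Rightarrow> 'a) pmf" where
  "U_pmf n q d = pmf_of_set (R_set n q d)"

text \<open>This distance depends only on the laws of the two random variables, so it is
  defined on laws.\<close>

definition d_inf :: "'b set \<Rightarrow> 'b pmf \<Rightarrow> 'b pmf \<Rightarrow> real" where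
  "d_inf S X Y = Max ((\<lambda>r. \<bar>pmf X r - pmf Y r\<bar>) ` S)"

text \<open>\<open>pmf_of_set\<close> is the uniform distribution only on finite nonempty sets.\<close>

lemma finite_perm_matrices: "finite (perm_matrices n)"
  unfolding perm_matrices_def by (intro finite_imageI finite_permutations) simp

lemma perm_matrices_nonempty: "perm_matrices n \<noteq> {}"
  unfolding perm_matrices_def using permutes_id by blast

lemma finite_R: "finite (R_set n (q :: nat \<Rightarrow> 'a::{ab_group_add, finite}) d)"
  unfolding R_set_def by (intro finite_Collect_conjI disjI1) (simp add: finite_PiE)

lemma R_nonempty: "R_set n (q :: nat \<Rightarrow> 'a::ab_group_add) d \<noteq> {}"
proof -
  define r where "r = (\<lambda>i\<in>{1..n}. \<Sum>k=1..d. q i)"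
  have mem: "q i \<in> MinC n q" if "i \<in> {1..n}" for i
  proof (cases "i = n")
    case True
    then show ?thesis unfolding MinC_def by (auto intro: image_eqI[of _ _ 0] group_closure.base)
  next
    case False
    then have "q i - q n \<in> group_closure ((\<lambda>i. q i - q n) ` {1..<n})"
      using that by (intro group_closure.base) auto
    then show ?thesis unfolding MinC_def by (auto intro!: image_eqI[of _ _ "q i - q n"])
  qed
  have "r \<in> {1..n} \<rightarrow>\<^sub>E set_multiple d (MinC n q)"
    unfolding r_def set_multiple_def by (auto intro!: exI[of _ "\<lambda>_. q _"] mem)
  moreover have "vec_sum n r = nat_scale d (vec_sum n q)"
  proof -
    have "vec_sum n r = (\<Sum>i=1..n. \<Sum>k=1..d. q i)" unfolding vec_sum_def r_def by simp
    also have "\<dots> = (\<Sum>k=1..d. \<Sum>i=1..n. q i)" by (rule sum.swap)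
    also have "\<dots> = (\<Sum>k<d. \<Sum>i=1..n. q i)"
      by (rule sum.reindex_bij_witness[of _ Suc "\<lambda>k. k - 1"]) auto
    finally show ?thesis unfolding nat_scale_def vec_sum_def .
  qed
  ultimately show ?thesis unfolding R_set_def by blast
qed

end

theory Submission
  imports Defs "HOL-Real_Asymp.Real_Asymp"
begin

text \<open>
  Let \<open>m\<close> be the order of the group \<open>V\<close>. For a vector \<open>q\<close> of group elements and a vector \<open>\<xi>\<close>
  of characters let \<open>F q \<xi>\<close> be the mean of \<open>\<Prod>i. \<xi> i (q (\<sigma> i))\<close> over all permutations \<open>\<sigma>\<close>. It is
  the characteristic function, at \<open>\<xi>\<close>, of a uniformly random rearrangement of \<open>q\<close>, and also a
  permanent divided by \<open>n!\<close>. The matrix \<open>A\<^sub>n\<close> is a sum of \<open>d\<close> independent permutation matrices, so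
  \<open>A\<^sub>n q\<close> has characteristic function \<open>F ^ d\<close>. The uniform law on \<open>R(q, d)\<close> has the
  same characteristic function at every \<open>\<xi>\<close> whose entries agree on all differences of entries
  of \<open>q\<close>, and characteristic function \<open>0\<close> at every other \<open>\<xi>\<close>; call the pair \<open>(q, \<xi>)\<close> trivial in
  the first case. Since \<open>\<bar>F\<bar> \<le> 1\<close> and \<open>d \<ge> 3\<close>, Fourier inversion bounds the sum over \<open>q\<close> of
  the distances by \<open>m\<^sup>-\<^sup>n\<close> times the sum of \<open>\<bar>F\<bar>\<^sup>3\<close> over all nontrivial pairs
  (\<open>d_inf_le_cubes\<close>). This expression is symmetric in \<open>q\<close> and \<open>\<xi>\<close>, and three estimates for \<open>F\<close>
  show that it tends to \<open>0\<close>.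

  Parseval's identity, together with the fact that \<open>q\<close> has at most \<open>(n + 1) ^ m\<close> possible types,
  gives a second moment of at most \<open>m ^ n * (n + 1) ^ m\<close> (\<open>second_moment\<close>). Hence the pairs
  with \<open>\<bar>F\<bar> \<le> \<kappa>\<close> contribute at most \<open>\<kappa> * (n + 1) ^ m\<close>, which is negligible as soon as \<open>\<kappa>\<close>
  decays faster than every power of \<open>n\<close>.

  Averaging over the exchange of two columns in two rows gains a constant factor whenever
  the four entries involved are not multiplicatively aligned (\<open>swap_bound\<close>). With \<open>s\<close> about \<open>n\<^sup>1\<^sup>/\<^sup>1\<^sup>0\<close>
  exchanges this makes \<open>\<bar>F\<bar>\<close> smaller than every power of \<open>n\<close>, unless the values that are taken
  often lie in a coset of a subgroup \<open>H\<close> (for \<open>q\<close>) and in a coset of its annihilator (for \<open>\<xi>\<close>). Now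
  either these frequent values are so few that such pairs form an exponentially small proportion
  of all pairs, or they exhaust both cosets. In the second case, exchanges again show that at most
  \<open>s\<close> entries of \<open>q\<close> and at most \<open>s\<close> entries of \<open>\<xi>\<close> lie outside these cosets (\<open>pair_structure\<close>).

  It remains to consider \<open>k\<close> exceptional entries in \<open>q\<close> and \<open>l\<close> in \<open>\<xi>\<close>, where \<open>0 < k + l\<close> and
  \<open>k, l \<le> s\<close>. Up to unimodular factors on rows and columns, the matrix equals \<open>1\<close> outside \<open>l\<close> rows
  and \<open>k\<close> columns, and except for a negligible
  proportion of pairs its exceptional rows and columns have sums of size at most \<open>D = n\<^sup>3\<^sup>/\<^sup>5\<close>. Expanding
  along these rows and columns gives \<open>\<bar>F\<bar> \<le> B\<^sup>k\<^sup>+\<^sup>l\<close> with \<open>B = n\<^sup>-\<^sup>7\<^sup>/\<^sup>2\<^sup>0\<close> (\<open>sparse_bound\<close>).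
  As \<open>n B\<^sup>3\<close> tends to \<open>0\<close>, the cubes win against the number of ways to choose the exceptional entries.
\<close>

(* Keeps index sets in the form {1..n}. *)
declare One_nat_def [simp del]

section \<open>Characters of a finite abelian group\<close>

lemma nat_scale_0 [simp]: "nat_scale 0 v = 0"
  by (simp add: nat_scale_def)

lemma nat_scale_Suc: "nat_scale (Suc k) v = nat_scale k v + v"
  by (simp add: nat_scale_def)

lemma nat_scale_1 [simp]: "nat_scale 1 v = v"
  by (simp add: nat_scale_def One_nat_def)

text \<open>Translation by \<open>b\<close> permutes the group, so the sum of all elements does not change when \<open>b\<close> is
  added to each of them.\<close>

lemma nat_scale_card: "nat_scale CARD('a) b = (0 :: 'a::{ab_group_add,finite})"
proof -
  have "(\<Sum>x\<in>UNIV. x + b) = (\<Sum>x\<in>(UNIV :: 'a set). x)"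
    by (rule sum.reindex_bij_witness[of _ "\<lambda>x. x - b" "\<lambda>x. x + b"]) auto
  moreover have "(\<Sum>x\<in>(UNIV::'a set). b) = nat_scale CARD('a) b"
  proof -
    obtain h where h: "bij_betw h {..<CARD('a)} (UNIV::'a set)"
      using ex_bij_betw_nat_finite[of "UNIV::'a set"] by (auto simp: atLeast0LessThan)
    show ?thesis
      unfolding nat_scale_def by (rule sum.reindex_bij_betw[OF h, of "\<lambda>_. b", symmetric])
  qed
  ultimately show ?thesis by (simp add: sum.distrib)
qed

definition dual :: "('a::ab_group_add \<Rightarrow> complex) set" where
  "dual = {\<xi>. \<xi> 0 = 1 \<and> (\<forall>a b. \<xi> (a + b) = \<xi> a * \<xi> b)}"

definition is_subgroup :: "'a::ab_group_add set \<Rightarrow> bool" where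
  "is_subgroup H \<longleftrightarrow> 0 \<in> H \<and> (\<forall>a\<in>H. \<forall>b\<in>H. a - b \<in> H)"

definition ann :: "'a::ab_group_add set \<Rightarrow> ('a \<Rightarrow> complex) set" where
  "ann H = {\<xi>\<in>dual. \<forall>h\<in>H. \<xi> h = 1}"

lemma dual_add: "\<xi> \<in> dual \<Longrightarrow> \<xi> (a + b) = \<xi> a * \<xi> b"
  and dual_0: "\<xi> \<in> dual \<Longrightarrow> \<xi> 0 = 1"
  by (auto simp: dual_def)

lemma dual_nat_scale: "\<xi> \<in> dual \<Longrightarrow> \<xi> (nat_scale k a) = \<xi> a ^ k"
  by (induction k) (auto simp: nat_scale_Suc dual_add dual_0)

lemma dual_root: "\<xi> \<in> dual \<Longrightarrow> \<xi> (a :: 'a::{ab_group_add,finite}) ^ CARD('a) = 1"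
  using dual_nat_scale[of \<xi> "CARD('a)" a] by (simp add: nat_scale_card dual_0)

lemma norm_dual: "\<xi> \<in> dual \<Longrightarrow> norm (\<xi> (a :: 'a::{ab_group_add,finite})) = 1"
  using dual_root[of \<xi> a]
  by (metis finite_UNIV_card_ge_0 finite norm_ge_zero norm_one norm_power power_eq_1_iff
        power_eq_imp_eq_base power_one)

lemma dual_nz: "\<xi> \<in> dual \<Longrightarrow> \<xi> (a :: 'a::{ab_group_add,finite}) \<noteq> 0"
  using norm_dual[of \<xi> a] by auto

lemma dual_diff: "\<xi> \<in> dual \<Longrightarrow> \<xi> (a - b :: 'a::{ab_group_add,finite}) = \<xi> a * cnj (\<xi> b)"
proof -
  assume c: "\<xi> \<in> dual"
  have "\<xi> (a - b) * \<xi> b = \<xi> a" using dual_add[OF c, of "a - b" b] by simp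
  moreover have "\<xi> b * cnj (\<xi> b) = 1"
    using norm_dual[OF c, of b] by (simp add: complex_norm_square[symmetric])
  ultimately show ?thesis by (metis mult.assoc mult.right_neutral)
qed

lemma dual_cnj_mult: "\<xi> \<in> dual \<Longrightarrow> \<xi> (a :: 'a::{ab_group_add,finite}) * cnj (\<xi> a) = 1"
  using norm_dual[of \<xi> a] by (simp add: complex_norm_square[symmetric])

lemma finite_dual: "finite (dual :: ('a::{ab_group_add,finite} \<Rightarrow> complex) set)"
proof -
  have "finite {z :: complex. z ^ CARD('a) = 1}"
    by (intro finite_roots_unity) (simp add: Suc_le_eq One_nat_def)
  then have "finite (UNIV \<rightarrow>\<^sub>E {z :: complex. z ^ CARD('a) = 1} :: ('a \<Rightarrow> complex) set)"
    by (intro finite_PiE) auto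
  then show ?thesis
    by (rule finite_subset[rotated]) (auto simp: dual_root)
qed

lemma dual_mult: "\<xi> \<in> dual \<Longrightarrow> \<psi> \<in> dual \<Longrightarrow> (\<lambda>a. \<xi> a * \<psi> a) \<in> dual"
  by (auto simp: dual_def)

lemma dual_cnj: "\<xi> \<in> dual \<Longrightarrow> (\<lambda>a. cnj (\<xi> a)) \<in> dual"
  by (auto simp: dual_def)

lemma one_dual: "(\<lambda>_. 1) \<in> dual"
  by (auto simp: dual_def)

lemma is_subgroup_minus: "is_subgroup H \<Longrightarrow> a \<in> H \<Longrightarrow> - a \<in> H"
  unfolding is_subgroup_def by (metis diff_0)

lemma is_subgroup_add: "is_subgroup H \<Longrightarrow> a \<in> H \<Longrightarrow> b \<in> H \<Longrightarrow> a + b \<in> H"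
  using is_subgroup_minus[of H b] unfolding is_subgroup_def by (metis diff_minus_eq_add)

text \<open>This is the existence proof for characters. The function \<open>x \<mapsto> 1\<^sub>H(x + a) - 1\<^sub>H(x)\<close> is nonzero,
  is invariant under \<open>H\<close>, and has zero sum along every orbit of translation by \<open>a\<close>. All three properties
  survive a projection to a suitable eigenspace of one more translation, since these projections are
  linear combinations of translations and sum up to a multiple of the identity. A function that is
  an eigenvector of all translations is a multiple of a character.\<close>

lemma common_eigenvector:
  fixes a :: "'a::{ab_group_add,finite}" and B :: "'a set"
  assumes H: "is_subgroup H" and a: "a \<notin> H"
  shows "\<exists>f :: 'a \<Rightarrow> complex. (\<exists>x. f x \<noteq> 0) \<and> (\<forall>h\<in>H. \<forall>x. f (x + h) = f x)
           \<and> (\<forall>x. (\<Sum>j<CARD('a). f (x + nat_scale j a)) = 0)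
           \<and> (\<forall>b\<in>B. \<exists>c. \<forall>x. f (x + b) = c * f x)"
  using finite[of B]
proof (induction B rule: finite_induct)
  case empty
  define g where "g x = (if x \<in> H then 1 else 0 :: complex)" for x
  have gH: "g (x + h) = g x" if "h \<in> H" for x h
  proof -
    have "x + h \<in> H \<longleftrightarrow> x \<in> H"
      using that is_subgroup_add[OF H, of x h] H
      unfolding is_subgroup_def by (metis add_diff_cancel_right')
    then show ?thesis by (simp add: g_def)
  qed
  define f where "f x = g (x + a) - g x" for x
  have "f 0 \<noteq> 0" using a H by (auto simp: f_def g_def is_subgroup_def)
  moreover have "f (x + h) = f x" if "h \<in> H" for x h
    using gH[OF that, of x] gH[OF that, of "x + a"] by (simp add: f_def add.assoc add.commute[of a])
  moreover have "(\<Sum>j<CARD('a). f (x + nat_scale j a)) = 0" for x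
  proof -
    have "(\<Sum>j<k. f (x + nat_scale j a)) = g (x + nat_scale k a) - g x" for k
      by (induction k) (auto simp: f_def nat_scale_Suc add.assoc)
    then show ?thesis by (simp add: nat_scale_card)
  qed
  ultimately show ?case by blast
next
  case (insert b B)
  then obtain f where f0: "\<exists>x. f x \<noteq> (0::complex)" and fH: "\<And>h x. h \<in> H \<Longrightarrow> f (x + h) = f x"
    and fa: "\<And>x. (\<Sum>j<CARD('a). f (x + nat_scale j a)) = 0"
    and fB: "\<And>b. b \<in> B \<Longrightarrow> \<exists>c. \<forall>x. f (x + b) = c * f x" by blast
  define m where "m = CARD('a)"
  have m0: "m > 0" by (simp add: m_def)
  define \<omega> where "\<omega> = cis (2 * pi / m)"
  have w_m: "\<omega> ^ m = 1" using m0 unfolding \<omega>_def Complex.DeMoivre by simp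
  have w_n: "\<omega> \<noteq> 0" by (simp add: \<omega>_def)
  have w_sum: "(\<Sum>j<m. \<omega> ^ (i * j)) = 0" if "0 < i" "i < m" for i
  proof -
    have "\<omega> ^ i \<noteq> 1"
    proof
      assume "\<omega> ^ i = 1"
      define r where "r = real i / m"
      have c: "cis (2 * pi * r) = 1"
        using \<open>\<omega> ^ i = 1\<close> by (simp add: \<omega>_def r_def Complex.DeMoivre mult.commute)
      then have "cos (2 * pi * r) = 1" by (metis cis.sel(1) one_complex.sel(1))
      then obtain k :: int where k: "2 * pi * r = of_int k * 2 * pi"
        unfolding cos_one_2pi_int by blast
      then have "r = k" by simp
      moreover have "0 < r" "r < 1" using that by (auto simp: r_def)
      ultimately show False by (metis of_int_0_less_iff of_int_less_1_iff not_le zless_imp_add1_zle add_0)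
    qed
    moreover have "(\<omega> ^ i) ^ m = 1" by (metis power_mult mult.commute w_m power_one)
    ultimately have "(\<Sum>j<m. (\<omega> ^ i) ^ j) = 0" by (simp add: geometric_sum)
    then show ?thesis by (simp add: power_mult)
  qed
  \<comment> \<open>\<open>g j\<close> is \<open>m\<close> times the component of \<open>f\<close> on which translation by \<open>b\<close> acts as \<open>\<omega> powi (- j)\<close>.\<close>
  define g where "g j x = (\<Sum>i<m. \<omega> ^ (i * j) * f (x + nat_scale i b))" for j x
  have "(\<Sum>j<m. g j x) = of_nat m * f x" for x
  proof -
    have "(\<Sum>j<m. g j x) = (\<Sum>i<m. (\<Sum>j<m. \<omega> ^ (i * j)) * f (x + nat_scale i b))"
      unfolding g_def by (subst sum.swap) (simp add: sum_distrib_right)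
    also have "\<dots> = (\<Sum>i<m. if i = 0 then of_nat m * f x else 0)"
      by (intro sum.cong) (auto simp: w_sum)
    finally show ?thesis using m0 by simp
  qed
  then obtain x0 j where gj: "g j x0 \<noteq> 0"
    using f0 m0 by (metis mult_eq_0_iff of_nat_eq_0_iff sum.neutral not_gr0)
  have gH: "g j (x + h) = g j x" if "h \<in> H" for x h
    unfolding g_def by (intro sum.cong refl) (metis fH[OF that] add.assoc add.commute)
  moreover have ga: "(\<Sum>k<CARD('a). g j (x + nat_scale k a)) = 0" for x
  proof -
    have "(\<Sum>k<CARD('a). g j (x + nat_scale k a)) =
        (\<Sum>i<m. \<omega> ^ (i * j) * (\<Sum>k<CARD('a). f ((x + nat_scale i b) + nat_scale k a)))"
      unfolding g_def sum_distrib_left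
      by (subst sum.swap) (simp add: algebra_simps)
    then show ?thesis by (simp only: fa) simp
  qed
  moreover have gB: "\<exists>c. \<forall>x. g j (x + b') = c * g j x" if b': "b' \<in> B" for b'
  proof -
    obtain c where c: "\<And>x. f (x + b') = c * f x" using fB[OF b'] by blast
    have "g j (x + b') = c * g j x" for x
    proof -
      have "f (x + b' + nat_scale i b) = c * f (x + nat_scale i b)" for i
        using c[of "x + nat_scale i b"] by (simp add: algebra_simps)
      then show ?thesis by (simp add: g_def sum_distrib_left algebra_simps)
    qed
    then show ?thesis by blast
  qed
  moreover have gb: "g j (x + b) * \<omega> ^ j = g j x" for x
  proof -
    let ?h = "\<lambda>i. \<omega> ^ (i * j) * f (x + nat_scale i b)"
    have "g j (x + b) * \<omega> ^ j = (\<Sum>i<m. ?h (Suc i))"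
      unfolding g_def sum_distrib_right
      by (intro sum.cong refl) (simp add: nat_scale_Suc power_add algebra_simps)
    also have "\<dots> = (\<Sum>i<Suc m. ?h i) - ?h 0" by (subst sum.lessThan_Suc_shift) simp
    also have "\<dots> = (\<Sum>i<m. ?h i) + (?h m - ?h 0)" by simp
    also have "?h m = ?h 0"
      using nat_scale_card[of b] w_m by (simp add: m_def power_mult)
    finally show ?thesis by (simp add: g_def)
  qed
  have "g j (x + b) = inverse (\<omega> ^ j) * g j x" for x
    using gb[of x] w_n by (simp add: field_simps)
  ultimately have "\<forall>b'\<in>insert b B. \<exists>c. \<forall>x. g j (x + b') = c * g j x" by blast
  then show ?case using gj gH ga by blast
qed

text \<open>Translation by \<open>a\<close> cannot act trivially on the common eigenvector, because its sums along the
  orbits of \<open>a\<close> vanish; so the character of its eigenvalues separates \<open>a\<close> from \<open>H\<close>.\<close>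

theorem ann_separates:
  fixes a :: "'a::{ab_group_add,finite}"
  assumes H: "is_subgroup H" and a: "a \<notin> H"
  obtains \<xi> where "\<xi> \<in> ann H" "\<xi> a \<noteq> 1"
proof -
  obtain f x0 where f0: "f x0 \<noteq> (0::complex)" and fH: "\<And>h x. h \<in> H \<Longrightarrow> f (x + h) = f x"
    and fa: "\<And>x. (\<Sum>j<CARD('a). f (x + nat_scale j a)) = 0"
    and fB: "\<And>b. \<exists>c. \<forall>x. f (x + b) = c * f x"
    using common_eigenvector[OF H a, of UNIV] by blast
  then obtain \<xi> where \<xi>: "\<And>b x. f (x + b) = \<xi> b * f x" by metis
  have "\<xi> \<in> dual" unfolding dual_def
  proof safe
    show "\<xi> 0 = 1" using \<xi>[of x0 0] f0 by simp
  next
    fix b c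
    have "\<xi> (b + c) * f x0 = \<xi> b * \<xi> c * f x0"
      using \<xi>[of x0 "b + c"] \<xi>[of "x0 + c" b] \<xi>[of x0 c] by (simp add: algebra_simps)
    then show "\<xi> (b + c) = \<xi> b * \<xi> c" using f0 by simp
  qed
  moreover have "\<xi> h = 1" if "h \<in> H" for h
    using \<xi>[of x0 h] fH[OF that, of x0] f0 by simp
  moreover have "\<xi> a \<noteq> 1"
  proof
    assume "\<xi> a = 1"
    then have "f (x0 + nat_scale j a) = f x0" for j
      using dual_nat_scale[OF \<open>\<xi> \<in> dual\<close>, of j a] \<xi>[of x0 "nat_scale j a"] by simp
    then have "of_nat CARD('a) * f x0 = 0" using fa[of x0] by simp
    then show False using f0 by simp
  qed
  ultimately show ?thesis using that by (auto simp: ann_def)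
qed

lemma sum_ann:
  fixes a :: "'a::{ab_group_add,finite}"
  assumes H: "is_subgroup H"
  shows "(\<Sum>\<xi>\<in>ann H. \<xi> a) = (if a \<in> H then of_nat (card (ann H)) else 0)"
proof (cases "a \<in> H")
  case True
  then show ?thesis by (simp add: ann_def)
next
  case False
  obtain \<psi> where \<psi>: "\<psi> \<in> ann H" "\<psi> a \<noteq> 1" using ann_separates[OF H False] .
  have d: "\<psi> \<in> dual" using \<psi>(1) by (simp add: ann_def)
  have "(\<Sum>\<xi>\<in>ann H. \<xi> a) = (\<Sum>\<xi>\<in>ann H. \<psi> a * \<xi> a)"
    by (rule sum.reindex_bij_witness[of _ "\<lambda>\<xi> a. \<psi> a * \<xi> a" "\<lambda>\<xi> a. cnj (\<psi> a) * \<xi> a"])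
       (use \<psi>(1) dual_cnj_mult[OF d] in
        \<open>auto simp: ann_def dual_mult dual_cnj mult.assoc[symmetric] mult.commute[of "cnj _"]\<close>)
  then have "(\<psi> a - 1) * (\<Sum>\<xi>\<in>ann H. \<xi> a) = 0"
    by (simp add: sum_distrib_left[symmetric] left_diff_distrib)
  then show ?thesis using \<psi>(2) False by simp
qed

lemma sum_dual_subgroup:
  fixes H :: "'a::{ab_group_add,finite} set"
  assumes H: "is_subgroup H" and \<xi>: "\<xi> \<in> dual" and h: "h \<in> H" "\<xi> h \<noteq> 1"
  shows "(\<Sum>a\<in>H. \<xi> a) = 0"
proof -
  have "(\<Sum>a\<in>H. \<xi> a) = (\<Sum>a\<in>H. \<xi> h * \<xi> a)"
    by (rule sum.reindex_bij_witness[of _ "\<lambda>a. h + a" "\<lambda>a. a - h"])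
       (use H h in \<open>auto simp: is_subgroup_add is_subgroup_def dual_add[OF \<xi>, symmetric]\<close>)
  then have "(\<xi> h - 1) * (\<Sum>a\<in>H. \<xi> a) = 0"
    by (simp add: sum_distrib_left[symmetric] left_diff_distrib)
  then show ?thesis using h(2) by simp
qed

lemma finite_ann: "finite (ann (H :: 'a::{ab_group_add,finite} set))"
  by (rule finite_subset[OF _ finite_dual]) (auto simp: ann_def)

text \<open>Sum \<open>\<xi> a\<close> over all \<open>a\<close> and all \<open>\<xi>\<close> in the annihilator, in both orders.\<close>

theorem card_ann:
  fixes H :: "'a::{ab_group_add,finite} set"
  assumes H: "is_subgroup H"
  shows "card H * card (ann H) = CARD('a)"
proof -
  have 1: "(\<Sum>a\<in>UNIV. \<xi> a) = (if \<xi> = (\<lambda>_. 1) then of_nat CARD('a) else 0)" if "\<xi> \<in> ann H" for \<xi> :: "'a \<Rightarrow> complex"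
  proof (cases "\<xi> = (\<lambda>_. 1)")
    case False
    then obtain h where "\<xi> h \<noteq> 1" by auto
    then show ?thesis
      using sum_dual_subgroup[of UNIV \<xi> h] that False by (auto simp: is_subgroup_def ann_def)
  qed simp
  have "(\<Sum>a\<in>UNIV. \<Sum>\<xi>\<in>ann H. \<xi> a) = (\<Sum>a\<in>UNIV. if a \<in> H then of_nat (card (ann H)) else (0::complex))"
    by (simp add: sum_ann[OF H])
  also have "\<dots> = of_nat (card H * card (ann H))" by (simp add: sum.If_cases)
  finally have "of_nat (card H * card (ann H)) = (\<Sum>\<xi>\<in>ann H. \<Sum>a\<in>UNIV. \<xi> a :: complex)"
    by (subst (asm) sum.swap) simp
  also have "\<dots> = (\<Sum>\<xi>\<in>ann H. if \<xi> = (\<lambda>_. 1) then of_nat CARD('a) else (0::complex))"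
    by (intro sum.cong refl 1)
  also have "\<dots> = of_nat CARD('a)"
    using finite_ann[of H] by (simp add: sum.delta ann_def one_dual)
  finally show ?thesis by (metis of_nat_eq_iff)
qed

lemma ann_zero: "ann {0} = dual"
  by (auto simp: ann_def dual_0)

lemma is_subgroup_zero: "is_subgroup {0}"
  by (simp add: is_subgroup_def)

lemma card_dual: "card (dual :: ('a::{ab_group_add,finite} \<Rightarrow> complex) set) = CARD('a)"
  using card_ann[of "{0::'a}"] by (simp add: ann_zero is_subgroup_zero)

lemma sum_dual:
  fixes a :: "'a::{ab_group_add,finite}"
  shows "(\<Sum>\<xi>\<in>dual. \<xi> a) = (if a = 0 then of_nat CARD('a) else 0)"
  using sum_ann[of "{0::'a}" a] by (simp add: ann_zero is_subgroup_zero card_dual)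

section \<open>Averaged permanents and the swap bound\<close>

definition bijs :: "nat set \<Rightarrow> nat set \<Rightarrow> (nat \<Rightarrow> nat) set" where
  "bijs I J = {\<sigma> \<in> I \<rightarrow>\<^sub>E J. bij_betw \<sigma> I J}"

text \<open>Rows and columns are indexed by arbitrary sets because Laplace expansion removes indices. The
  division by the number of bijections turns the permanent into a mean value.\<close>

definition permanent_avg :: "(nat \<Rightarrow> nat \<Rightarrow> complex) \<Rightarrow> nat set \<Rightarrow> nat set \<Rightarrow> complex" where
  "permanent_avg b I J = (\<Sum>\<sigma>\<in>bijs I J. \<Prod>i\<in>I. b i (\<sigma> i)) / fact (card I)"

lemma finite_bijs: "finite I \<Longrightarrow> finite J \<Longrightarrow> finite (bijs I J)"
  unfolding bijs_def by (rule finite_subset[OF _ finite_PiE[of I "\<lambda>_. J"]]) auto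

lemma permanent_avg_empty [simp]: "permanent_avg b {} {} = 1"
proof -
  have "bijs {} {} = {\<lambda>_. undefined}" by (auto simp: bijs_def bij_betw_def)
  then show ?thesis by (simp add: permanent_avg_def)
qed

lemma permanent_avg_cong:
  assumes "\<And>i j. i \<in> I \<Longrightarrow> j \<in> J \<Longrightarrow> b i j = b' i j"
  shows "permanent_avg b I J = permanent_avg b' I J"
  unfolding permanent_avg_def bijs_def
  by (intro arg_cong2[of _ _ _ _ "(/)"] sum.cong prod.cong refl assms) (auto simp: bij_betw_def)

lemma permanent_avg_row:
  assumes "finite I" "i0 \<in> I"
  shows "permanent_avg b I J =
    (\<Sum>j\<in>J. b i0 j * permanent_avg b (I - {i0}) (J - {j})) / of_nat (card I)"
proof -
  let ?S = "SIGMA j:J. bijs (I - {i0}) (J - {j})"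
  have inj: "\<sigma>(i0 := j) \<in> bijs I J"
    if "j \<in> J" "\<sigma> \<in> bijs (I - {i0}) (J - {j})" for j \<sigma>
  proof -
    have b: "bij_betw \<sigma> (I - {i0}) (J - {j})" and e: "\<sigma> \<in> extensional (I - {i0})"
      using that(2) by (auto simp: bijs_def PiE_def)
    have "bij_betw (\<sigma>(i0 := j)) (I - {i0}) (J - {j})"
      using b by (subst bij_betw_cong[of _ _ \<sigma>]) auto
    then have "bij_betw (\<sigma>(i0 := j)) (insert i0 (I - {i0})) (insert j (J - {j}))"
      by (subst (asm) notIn_Un_bij_betw3[of i0 "I - {i0}" "\<sigma>(i0 := j)" "J - {j}"]) auto
    then have "bij_betw (\<sigma>(i0 := j)) I J" using assms(2) that(1) by (simp add: insert_absorb)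
    moreover have "\<sigma>(i0 := j) \<in> extensional I" using e assms(2) by (auto simp: extensional_def)
    ultimately show ?thesis by (auto simp: bijs_def PiE_def dest: bij_betwE)
  qed
  have del: "\<sigma>(i0 := undefined) \<in> bijs (I - {i0}) (J - {\<sigma> i0})" "\<sigma> i0 \<in> J"
    if "\<sigma> \<in> bijs I J" for \<sigma>
  proof -
    have b: "bij_betw \<sigma> I J" and e: "\<sigma> \<in> extensional I"
      using that by (auto simp: bijs_def PiE_def)
    show "\<sigma> i0 \<in> J" using b assms(2) by (auto dest: bij_betwE)
    have "bij_betw \<sigma> (I - {i0}) (J - {\<sigma> i0})"
      using b assms(2) by (auto simp: bij_betw_def inj_on_def)
    then have "bij_betw (\<sigma>(i0 := undefined)) (I - {i0}) (J - {\<sigma> i0})"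
      by (subst bij_betw_cong[of _ _ \<sigma>]) auto
    moreover have "\<sigma>(i0 := undefined) \<in> extensional (I - {i0})"
      using e by (auto simp: extensional_def)
    ultimately show "\<sigma>(i0 := undefined) \<in> bijs (I - {i0}) (J - {\<sigma> i0})"
      by (auto simp: bijs_def PiE_def dest: bij_betwE)
  qed
  have und: "\<sigma> i0 = undefined" if "\<sigma> \<in> bijs (I - {i0}) A" for \<sigma> A
    using that by (auto simp: bijs_def PiE_def extensional_def)
  have "(\<Sum>\<sigma>\<in>bijs I J. \<Prod>i\<in>I. b i (\<sigma> i)) =
      (\<Sum>(j,\<sigma>)\<in>?S. b i0 j * (\<Prod>i\<in>I - {i0}. b i (\<sigma> i)))"
  proof (rule sum.reindex_bij_witness[of _ "\<lambda>(j,\<sigma>). \<sigma>(i0 := j)" "\<lambda>\<sigma>. (\<sigma> i0, \<sigma>(i0 := undefined))"])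
    fix \<sigma> assume s: "\<sigma> \<in> bijs I J"
    show "(case (\<sigma> i0, \<sigma>(i0 := undefined)) of (j, \<sigma>) \<Rightarrow> \<sigma>(i0 := j)) = \<sigma>" by simp
    show "(\<sigma> i0, \<sigma>(i0 := undefined)) \<in> ?S" using del[OF s] by simp
    show "(case (\<sigma> i0, \<sigma>(i0 := undefined)) of
        (j, \<sigma>) \<Rightarrow> b i0 j * (\<Prod>i\<in>I - {i0}. b i (\<sigma> i))) = (\<Prod>i\<in>I. b i (\<sigma> i))"
      using assms by (simp add: prod.remove)
  next
    fix p assume "p \<in> ?S"
    then show "((case p of (j, \<sigma>) \<Rightarrow> \<sigma>(i0 := j)) i0, (case p of (j, \<sigma>) \<Rightarrow> \<sigma>(i0 := j))(i0 := undefined)) = p"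
      and "(case p of (j, \<sigma>) \<Rightarrow> \<sigma>(i0 := j)) \<in> bijs I J"
      using inj by (auto simp: fun_upd_idem_iff und)
  qed
  also have "\<dots> = (\<Sum>j\<in>J. \<Sum>\<sigma>\<in>bijs (I - {i0}) (J - {j}). b i0 j * (\<Prod>i\<in>I - {i0}. b i (\<sigma> i)))"
  proof (cases "finite J")
    case True
    then have "\<forall>j\<in>J. finite (bijs (I - {i0}) (J - {j}))"
      using assms(1) by (simp add: finite_bijs)
    then show ?thesis by (rule sum.Sigma[OF True, symmetric])
  next
    case False
    have "bijs (I - {i0}) (J - {j}) = {}" for j
    proof (rule equals0I)
      fix \<sigma> assume "\<sigma> \<in> bijs (I - {i0}) (J - {j})"
      then have "bij_betw \<sigma> (I - {i0}) (J - {j})" by (simp add: bijs_def)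
      then have "finite (J - {j})" using bij_betw_finite assms(1) by (metis finite_Diff)
      then show False using False by simp
    qed
    then show ?thesis by simp
  qed
  finally have *: "(\<Sum>\<sigma>\<in>bijs I J. \<Prod>i\<in>I. b i (\<sigma> i)) =
      (\<Sum>j\<in>J. b i0 j * (\<Sum>\<sigma>\<in>bijs (I - {i0}) (J - {j}). \<Prod>i\<in>I - {i0}. b i (\<sigma> i)))"
    by (simp only: sum_distrib_left)
  have c: "fact (card I) = (of_nat (card I) * fact (card (I - {i0})) :: complex)"
  proof -
    have "card I = Suc (card (I - {i0}))" using card.remove[OF assms] .
    then show ?thesis by (metis fact_Suc of_nat_fact of_nat_mult)
  qed
  have "(\<Sum>j\<in>J. b i0 j * h j) / (of_nat (card I) * fact k) = (\<Sum>j\<in>J. b i0 j * (h j / fact k)) / of_nat (card I)"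
    for h :: "nat \<Rightarrow> complex" and k
    by (simp add: sum_divide_distrib mult.commute[of "fact k"])
  then show ?thesis unfolding permanent_avg_def * c .
qed

lemma permanent_avg_transpose:
  assumes "finite I" "finite J" "card I = card J"
  shows "permanent_avg b I J = permanent_avg (\<lambda>j i. b i j) J I"
proof -
  let ?inv = "\<lambda>I J \<sigma>. restrict (inv_into I \<sigma>) J"
  have i: "?inv I J \<sigma> \<in> bijs J I" "?inv J I (?inv I J \<sigma>) = \<sigma>"
    if "\<sigma> \<in> bijs I J" for I J :: "nat set" and \<sigma>
  proof -
    have b: "bij_betw \<sigma> I J" and e: "\<sigma> \<in> extensional I"
      using that by (auto simp: bijs_def PiE_def)
    have bi: "bij_betw (?inv I J \<sigma>) J I"
      using bij_betw_inv_into[OF b] by (subst bij_betw_cong[of _ _ "inv_into I \<sigma>"]) auto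
    then show "?inv I J \<sigma> \<in> bijs J I" by (auto simp: bijs_def dest: bij_betwE)
    show "?inv J I (?inv I J \<sigma>) = \<sigma>"
    proof
      fix x
      show "?inv J I (?inv I J \<sigma>) x = \<sigma> x"
      proof (cases "x \<in> I")
        case True
        have "?inv I J \<sigma> (\<sigma> x) = x" using b True by (auto simp: bij_betw_def)
        moreover have "\<sigma> x \<in> J" using b True by (auto dest: bij_betwE)
        ultimately show ?thesis using True bi
          by (metis bij_betw_inv_into_left restrict_apply')
      next
        case False
        then show ?thesis using e by (simp add: extensional_def)
      qed
    qed
  qed
  have "(\<Sum>\<sigma>\<in>bijs I J. \<Prod>i\<in>I. b i (\<sigma> i)) = (\<Sum>\<tau>\<in>bijs J I. \<Prod>j\<in>J. b (\<tau> j) j)"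
  proof (rule sum.reindex_bij_witness[of _ "?inv J I" "?inv I J"])
    fix \<sigma> assume s: "\<sigma> \<in> bijs I J"
    then have b: "bij_betw \<sigma> I J" by (auto simp: bijs_def)
    show "(\<Prod>j\<in>J. b (?inv I J \<sigma> j) j) = (\<Prod>i\<in>I. b i (\<sigma> i))"
      by (rule prod.reindex_bij_betw[OF b, symmetric, THEN trans])
         (use b in \<open>auto intro!: prod.cong simp: bij_betw_def\<close>)
  qed (use i in auto)
  then show ?thesis using assms by (simp add: permanent_avg_def)
qed

lemma permanent_avg_col:
  assumes "finite I" "finite J" "card I = card J" "j0 \<in> J"
  shows "permanent_avg b I J =
    (\<Sum>i\<in>I. b i j0 * permanent_avg b (I - {i}) (J - {j0})) / of_nat (card I)"
proof -
  have "permanent_avg b I J = permanent_avg (\<lambda>j i. b i j) J I"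
    by (rule permanent_avg_transpose[OF assms(1-3)])
  also have "\<dots> = (\<Sum>i\<in>I. b i j0 * permanent_avg (\<lambda>j i. b i j) (J - {j0}) (I - {i})) / of_nat (card I)"
    using permanent_avg_row[OF assms(2,4), of "\<lambda>j i. b i j" I] assms(3) by simp
  also have "\<dots> = (\<Sum>i\<in>I. b i j0 * permanent_avg b (I - {i}) (J - {j0})) / of_nat (card I)"
    using assms
    by (intro arg_cong2[of _ _ _ _ "(/)"] sum.cong refl arg_cong2[of _ _ _ _ "(*)"]
          permanent_avg_transpose[of "J - {j0}" _ "\<lambda>j i. b i j"])
       (auto simp: card_Diff_singleton_if)
  finally show ?thesis .
qed

lemma norm_permanent_avg_le_1:
  assumes "finite I" "finite J" "card I = card J"
    and "\<And>i j. i \<in> I \<Longrightarrow> j \<in> J \<Longrightarrow> norm (b i j) \<le> 1"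
  shows "norm (permanent_avg b I J) \<le> 1"
  using assms
proof (induction "card I" arbitrary: I J)
  case 0
  then show ?case by simp
next
  case (Suc n)
  then obtain i0 where i0: "i0 \<in> I" by fastforce
  have "norm (permanent_avg b (I - {i0}) (J - {j})) \<le> 1" if "j \<in> J" for j
    using Suc.prems Suc.hyps(2) i0 that by (intro Suc.hyps(1)) auto
  then have "norm (\<Sum>j\<in>J. b i0 j * permanent_avg b (I - {i0}) (J - {j})) \<le> (\<Sum>j\<in>J. 1)"
    using Suc.prems i0 by (intro sum_norm_le) (auto simp: norm_mult intro!: mult_le_one)
  then show ?case
    using Suc.prems Suc.hyps(2) by (simp add: permanent_avg_row[OF _ i0] norm_divide divide_le_eq)
qed

lemma norm_permanent_avg_scale:
  assumes "finite I" "finite J" "card I = card J"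
    and "\<And>i. i \<in> I \<Longrightarrow> norm (u i) = 1" "\<And>j. j \<in> J \<Longrightarrow> norm (v j) = 1"
  shows "norm (permanent_avg (\<lambda>i j. u i * v j * b i j) I J) = norm (permanent_avg b I J)"
proof -
  have "(\<Sum>\<sigma>\<in>bijs I J. \<Prod>i\<in>I. u i * v (\<sigma> i) * b i (\<sigma> i)) =
      (\<Sum>\<sigma>\<in>bijs I J. (\<Prod>i\<in>I. u i) * (\<Prod>j\<in>J. v j) * (\<Prod>i\<in>I. b i (\<sigma> i)))"
  proof (intro sum.cong refl)
    fix \<sigma> assume "\<sigma> \<in> bijs I J"
    then have "(\<Prod>i\<in>I. v (\<sigma> i)) = (\<Prod>j\<in>J. v j)"
      by (intro prod.reindex_bij_betw) (auto simp: bijs_def)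
    then show "(\<Prod>i\<in>I. u i * v (\<sigma> i) * b i (\<sigma> i)) =
        (\<Prod>i\<in>I. u i) * (\<Prod>j\<in>J. v j) * (\<Prod>i\<in>I. b i (\<sigma> i))"
      by (simp add: prod.distrib)
  qed
  moreover have "norm (\<Prod>i\<in>I. u i) = 1" "norm (\<Prod>j\<in>J. v j) = 1"
    using assms by (simp_all add: prod_norm[symmetric])
  ultimately show ?thesis
    by (simp add: permanent_avg_def sum_distrib_left[symmetric] norm_mult norm_divide)
qed

text \<open>Exchanging the two columns that are assigned to rows \<open>i\<close> and \<open>i'\<close> is an involution on the
  bijections, so the coefficient of the remaining minor may be symmetrised.\<close>

lemma permanent_avg_two_rows:
  assumes fin: "finite I" "finite J" and i: "i \<in> I" "i' \<in> I" "i \<noteq> i'"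
  shows "permanent_avg b I J =
    (\<Sum>j\<in>J. \<Sum>j'\<in>J - {j}. (b i j * b i' j' + b i j' * b i' j) / 2 *
        permanent_avg b (I - {i, i'}) (J - {j, j'})) / (of_nat (card I) * of_nat (card I - 1))"
proof -
  let ?P = "\<lambda>j j'. permanent_avg b (I - {i, i'}) (J - {j, j'})"
  let ?N = "of_nat (card I) * of_nat (card I - 1) :: complex"
  have "permanent_avg b I J =
      (\<Sum>j\<in>J. b i j * ((\<Sum>j'\<in>J - {j}. b i' j' * permanent_avg b (I - {i} - {i'}) (J - {j} - {j'})) /
         of_nat (card (I - {i})))) / of_nat (card I)"
    unfolding permanent_avg_row[OF fin(1) i(1), of b]
    by (subst permanent_avg_row[of "I - {i}" i']) (use fin i in auto)
  also have "\<dots> = (\<Sum>j\<in>J. \<Sum>j'\<in>J - {j}. b i j * b i' j' * ?P j j') / ?N"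
    using i fin by (simp add: sum_divide_distrib sum_distrib_left mult.assoc Diff_insert2[symmetric]
        divide_divide_eq_left mult.commute[of "of_nat (card I)"] card_Diff_singleton)
  finally have 1: "permanent_avg b I J = (\<Sum>j\<in>J. \<Sum>j'\<in>J - {j}. b i j * b i' j' * ?P j j') / ?N" .
  have sw: "(\<Sum>j\<in>J. \<Sum>j'\<in>J - {j}. b i j * b i' j' * ?P j j') =
      (\<Sum>j\<in>J. \<Sum>j'\<in>J - {j}. b i j' * b i' j * ?P j j')"
  proof -
    have e: "(\<Sum>j\<in>J. \<Sum>j'\<in>J - {j}. h j j') = (\<Sum>j\<in>J. \<Sum>j'\<in>J. if j = j' then 0 else h j j')"
      for h :: "nat \<Rightarrow> nat \<Rightarrow> complex"
      using fin by (intro sum.cong refl sum.mono_neutral_cong_left) auto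
    show ?thesis unfolding e
      by (subst sum.swap) (auto intro!: sum.cong simp: insert_commute)
  qed
  have "(\<Sum>j\<in>J. \<Sum>j'\<in>J - {j}. (b i j * b i' j' + b i j' * b i' j) / 2 * ?P j j') =
    ((\<Sum>j\<in>J. \<Sum>j'\<in>J - {j}. b i j * b i' j' * ?P j j') +
     (\<Sum>j\<in>J. \<Sum>j'\<in>J - {j}. b i j' * b i' j * ?P j j')) / 2"
    by (simp add: sum.distrib[symmetric] sum_divide_distrib add_divide_distrib algebra_simps)
  then show ?thesis unfolding 1 sw[symmetric] by simp
qed

lemma contraction_factor_nonneg:
  fixes \<delta> :: real and r n :: nat
  assumes "0 < \<delta>" "\<delta> \<le> 1" "r \<le> n"
  shows "0 \<le> 1 - \<delta> * (r / n)\<^sup>2"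
proof -
  have "(r / n)\<^sup>2 \<le> 1" using assms(3) by (cases "n = 0") (auto simp: power_le_one_iff divide_le_eq_1)
  then have "\<delta> * (r / n)\<^sup>2 \<le> 1" using assms by (intro mult_le_one) auto
  then show ?thesis by simp
qed

text \<open>For unimodular entries, the symmetrised coefficient has modulus at most \<open>1\<close>; here it is at most \<open>1 - \<delta>\<close>
  for all columns in \<open>A \<times> A'\<close>.\<close>

definition swap_gain :: "real \<Rightarrow> (nat \<Rightarrow> nat \<Rightarrow> complex) \<Rightarrow> nat \<times> nat \<Rightarrow> nat set \<Rightarrow> nat set \<Rightarrow> bool" where
  "swap_gain \<delta> b p A A' \<longleftrightarrow> (\<forall>j\<in>A. \<forall>j'\<in>A'.
     norm (b (fst p) j * b (snd p) j' + b (fst p) j' * b (snd p) j) \<le> 2 * (1 - \<delta>))"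

text \<open>Expand along the row pairs one after the other. For each of them a proportion of at least
  \<open>(r / n)\<^sup>2\<close> of the column pairs gains the factor \<open>1 - \<delta>\<close>. Each step removes two columns, and this is why
  the column sets need the reserve \<open>2 * length ps\<close>.\<close>

lemma swap_bound:
  fixes b :: "nat \<Rightarrow> nat \<Rightarrow> complex"
  assumes \<delta>: "0 < \<delta>" "\<delta> \<le> 1"
    and fin: "finite I" "finite J" "card I = card J" "card I \<le> n"
    and b1: "\<And>i j. i \<in> I \<Longrightarrow> j \<in> J \<Longrightarrow> norm (b i j) = 1"
    and ps: "distinct (map fst ps @ map snd ps)" "set (map fst ps @ map snd ps) \<subseteq> I"
    and r: "r \<le> n"
    and A: "\<And>p. p \<in> set ps \<Longrightarrow> \<exists>A\<subseteq>J. \<exists>A'\<subseteq>J. r + 2 * length ps \<le> card A \<and>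
              r + 2 * length ps \<le> card A' \<and> swap_gain \<delta> b p A A'"
  shows "norm (permanent_avg b I J) \<le> (1 - \<delta> * (r / n)\<^sup>2) ^ length ps"
  using fin b1 ps A
proof (induction ps arbitrary: I J)
  case Nil
  then show ?case using norm_permanent_avg_le_1[of I J b] by simp
next
  case (Cons p ps)
  obtain i i' where p: "p = (i, i')" by (cases p)
  note finI = Cons.prems(1-3)
  have i: "i \<in> I" "i' \<in> I" "i \<noteq> i'" using Cons.prems(6,7) p by auto
  define q where "q = 1 - \<delta> * (r / n)\<^sup>2"
  have q0: "0 \<le> q" unfolding q_def by (rule contraction_factor_nonneg[OF \<delta> r])
  define G where "G = q ^ length ps"
  have G0: "0 \<le> G" using q0 by (simp add: G_def)
  have c2: "card I \<ge> 2" using i finI card_mono[of I "{i,i'}"] by simp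
  obtain A A' where AA: "A \<subseteq> J" "A' \<subseteq> J" "r + 2 * length (p # ps) \<le> card A"
    "r + 2 * length (p # ps) \<le> card A'" "swap_gain \<delta> b p A A'" using Cons.prems(8)[of p] by auto
  have rest: "norm (permanent_avg b (I - {i, i'}) (J - {j, j'})) \<le> G"
    if j: "j \<in> J" "j' \<in> J - {j}" for j j'
    unfolding G_def q_def
  proof (rule Cons.IH)
    show "card (I - {i, i'}) = card (J - {j, j'})" using i j finI by (simp add: card_Diff_insert card_Diff_subset)
    show "card (I - {i, i'}) \<le> n" using Cons.prems(4) finI
      by (meson Diff_subset card_mono le_trans)
    show "distinct (map fst ps @ map snd ps)" using Cons.prems(6) by simp
    show "set (map fst ps @ map snd ps) \<subseteq> I - {i, i'}" using Cons.prems(6,7) p by auto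
    show "norm (b k l) = 1" if "k \<in> I - {i, i'}" "l \<in> J - {j, j'}" for k l
      using Cons.prems(5) that by auto
    fix p' assume "p' \<in> set ps"
    then obtain C C' where C: "C \<subseteq> J" "C' \<subseteq> J" "r + 2 * length (p # ps) \<le> card C"
      "r + 2 * length (p # ps) \<le> card C'" "swap_gain \<delta> b p' C C'" using Cons.prems(8)[of p'] by auto
    have d: "card D - 2 \<le> card (D - {j, j'})" for D :: "nat set"
    proof -
      have "card {j, j'} \<le> 2" by (simp add: card_insert_if)
      then show ?thesis using diff_card_le_card_Diff[of "{j, j'}" D] by simp
    qed
    show "\<exists>A\<subseteq>J - {j, j'}. \<exists>A'\<subseteq>J - {j, j'}. r + 2 * length ps \<le> card A \<and>
        r + 2 * length ps \<le> card A' \<and> swap_gain \<delta> b p' A A'"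
      using C d[of C] d[of C']
      by (intro exI[of _ "C - {j, j'}"] conjI exI[of _ "C' - {j, j'}"]) (auto simp: swap_gain_def)
  qed (use finI in auto)
  \<comment> \<open>A column in both sets would have symmetrised coefficient of modulus \<open>1\<close>.\<close>
  have disj: "A \<inter> A' = {}"
  proof (rule ccontr)
    assume "A \<inter> A' \<noteq> {}"
    then obtain j where j: "j \<in> A" "j \<in> A'" by auto
    then have "norm (b i j * b i' j + b i j * b i' j) \<le> 2 * (1 - \<delta>)"
      using AA(5) p by (fastforce simp: swap_gain_def)
    moreover have "norm (b i j * b i' j + b i j * b i' j) = 2"
      using Cons.prems(5) i j AA(1) by (simp add: mult_2[symmetric] norm_mult subset_iff)
    ultimately show False using \<delta> by simp
  qed
  let ?ind = "\<lambda>j j'. of_bool (j \<in> A \<and> j' \<in> A') :: real"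
  have summand: "norm ((b i j * b i' j' + b i j' * b i' j) / 2 * permanent_avg b (I - {i, i'}) (J - {j, j'}))
      \<le> (1 - \<delta> * ?ind j j') * G" if j: "j \<in> J" "j' \<in> J - {j}" for j j'
  proof -
    have "norm (b i j * b i' j' + b i j' * b i' j) \<le> norm (b i j * b i' j') + norm (b i j' * b i' j)"
      by (rule norm_triangle_ineq)
    also have "\<dots> = 2" using Cons.prems(5) i j by (simp add: norm_mult)
    finally have "norm (b i j * b i' j' + b i j' * b i' j) / 2 \<le> 1 - \<delta> * ?ind j j'"
      using AA(5) p by (cases "j \<in> A \<and> j' \<in> A'") (fastforce simp: swap_gain_def, auto)
    moreover have "0 \<le> 1 - \<delta> * ?ind j j'" using \<delta> by simp
    ultimately show ?thesis using rest[OF j]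
      unfolding norm_mult norm_divide by (intro mult_mono) auto
  qed
  have "norm (\<Sum>j\<in>J. \<Sum>j'\<in>J - {j}. (b i j * b i' j' + b i j' * b i' j) / 2 *
        permanent_avg b (I - {i, i'}) (J - {j, j'})) \<le> (\<Sum>j\<in>J. \<Sum>j'\<in>J - {j}. (1 - \<delta> * ?ind j j') * G)"
    by (intro sum_norm_le summand)
  also have "\<dots> = (\<Sum>j\<in>J. (real (card I - 1) - \<delta> * (of_bool (j \<in> A) * card A')) * G)"
  proof (intro sum.cong refl)
    fix j assume j: "j \<in> J"
    have "(\<Sum>j'\<in>J - {j}. ?ind j j') = of_bool (j \<in> A) * card A'"
    proof (cases "j \<in> A")
      case True
      have "(\<Sum>j'\<in>J - {j}. ?ind j j') = (\<Sum>j'\<in>A'. 1)"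
        using True disj AA(1,2) finI by (intro sum.mono_neutral_cong_right) auto
      then show ?thesis using True by simp
    qed auto
    then show "(\<Sum>j'\<in>J - {j}. (1 - \<delta> * ?ind j j') * G) =
        (real (card I - 1) - \<delta> * (of_bool (j \<in> A) * card A')) * G"
      using j finI by (simp add: sum_distrib_right[symmetric] sum_subtractf sum_distrib_left[symmetric]
          card_Diff_singleton)
  qed
  also have "\<dots> = (real (card I) * real (card I - 1) - \<delta> * (card A * card A')) * G"
  proof -
    have "(\<Sum>j\<in>J. of_bool (j \<in> A) :: real) = card A"
      using AA(1) finI by (simp add: sum.inter_restrict[symmetric] of_bool_def Int_absorb1 inf.absorb2)
    then show ?thesis using finI
      by (simp add: sum_distrib_right[symmetric] sum_subtractf sum_distrib_left[symmetric])
  qed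
  finally have S: "norm (\<Sum>j\<in>J. \<Sum>j'\<in>J - {j}. (b i j * b i' j' + b i j' * b i' j) / 2 *
        permanent_avg b (I - {i, i'}) (J - {j, j'})) \<le>
        (real (card I) * real (card I - 1) - \<delta> * (card A * card A')) * G" .
  define M where "M = real (card I) * real (card I - 1)"
  have M0: "M > 0" using c2 by (simp add: M_def)
  have "norm (permanent_avg b I J) = norm (\<Sum>j\<in>J. \<Sum>j'\<in>J - {j}.
      (b i j * b i' j' + b i j' * b i' j) / 2 * permanent_avg b (I - {i, i'}) (J - {j, j'})) / M"
    unfolding permanent_avg_two_rows[OF finI(1,2) i, of b] norm_divide M_def norm_mult norm_of_nat ..
  also have "\<dots> \<le> (M - \<delta> * (card A * card A')) * G / M"
    by (rule divide_right_mono[OF S[folded M_def]]) (use M0 in simp)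
  also have "\<dots> = (1 - \<delta> * (card A * card A' / M)) * G"
    using M0 by (simp add: field_simps)
  also have "\<dots> \<le> q * G"
  proof -
    have "(r / n)\<^sup>2 \<le> card A * card A' / M"
    proof -
      have "r * r \<le> card A * card A'" using AA(3,4) by (intro mult_le_mono) auto
      then have "(real r)\<^sup>2 \<le> card A * card A'"
        unfolding power2_eq_square by (metis of_nat_le_iff of_nat_mult)
      moreover have "M \<le> (real n)\<^sup>2"
        using Cons.prems(4) unfolding power2_eq_square M_def by (intro mult_mono) auto
      ultimately show ?thesis using M0 unfolding power_divide by (intro frac_le) auto
    qed
    then have "\<delta> * (r / n)\<^sup>2 \<le> \<delta> * (card A * card A' / M)"
      using \<delta> by (intro mult_left_mono) auto
    then show ?thesis using G0 unfolding q_def by (intro mult_right_mono) auto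
  qed
  finally show ?case by (simp add: G_def q_def)
qed

section \<open>Matrices with few rows and columns different from one\<close>

text \<open>The two submatrices differ in a single column. Expanding each along the column that the other one lacks
  leaves the same minors, and only rows in which the two columns differ contribute.\<close>

lemma permanent_avg_change_column:
  fixes b :: "nat \<Rightarrow> nat \<Rightarrow> complex" and G :: real
  assumes fin: "finite I" "finite J" "card J = Suc (card I)"
    and j: "j \<in> J" "j' \<in> J" "j \<noteq> j'"
    and L: "L \<subseteq> I" "\<And>i. i \<in> I - L \<Longrightarrow> b i j = b i j'"
    and b1: "\<And>i j. i \<in> I \<Longrightarrow> j \<in> J \<Longrightarrow> norm (b i j) \<le> 1"
    and G: "\<And>i. i \<in> L \<Longrightarrow> norm (permanent_avg b (I - {i}) (J - {j, j'})) \<le> G"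
  shows "norm (permanent_avg b I (J - {j}) - permanent_avg b I (J - {j'})) \<le> 2 * real (card L) * G / card I"
proof -
  let ?P = "\<lambda>i. permanent_avg b (I - {i}) (J - {j, j'})"
  have c: "card I = card (J - {j})" "card I = card (J - {j'})" using fin j by auto
  have e: "J - {j} - {j'} = J - {j, j'}" "J - {j'} - {j} = J - {j, j'}" by auto
  have "permanent_avg b I (J - {j}) = (\<Sum>i\<in>I. b i j' * ?P i) / of_nat (card I)"
    using permanent_avg_col[OF fin(1) _ c(1), of j' b] fin(2) j by (simp add: e)
  moreover have "permanent_avg b I (J - {j'}) = (\<Sum>i\<in>I. b i j * ?P i) / of_nat (card I)"
    using permanent_avg_col[OF fin(1) _ c(2), of j b] fin(2) j by (simp add: e)
  ultimately have "permanent_avg b I (J - {j}) - permanent_avg b I (J - {j'}) =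
      (\<Sum>i\<in>I. (b i j' - b i j) * ?P i) / of_nat (card I)"
    by (simp add: diff_divide_distrib[symmetric] sum_subtractf left_diff_distrib)
  also have "(\<Sum>i\<in>I. (b i j' - b i j) * ?P i) = (\<Sum>i\<in>L. (b i j' - b i j) * ?P i)"
    using L fin by (intro sum.mono_neutral_right) auto
  finally have eq: "permanent_avg b I (J - {j}) - permanent_avg b I (J - {j'}) =
      (\<Sum>i\<in>L. (b i j' - b i j) * ?P i) / of_nat (card I)" .
  have "norm (\<Sum>i\<in>L. (b i j' - b i j) * ?P i) \<le> (\<Sum>i\<in>L. 2 * G)"
  proof (rule sum_norm_le)
    fix i assume i: "i \<in> L"
    have "norm (b i j' - b i j) \<le> norm (b i j') + norm (b i j)" by (rule norm_triangle_ineq4)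
    also have "\<dots> \<le> 2" using b1[of i j] b1[of i j'] i L(1) j by fastforce
    finally show "norm ((b i j' - b i j) * ?P i) \<le> 2 * G"
      unfolding norm_mult using G[OF i] by (intro mult_mono) auto
  qed
  then have "norm (\<Sum>i\<in>L. (b i j' - b i j) * ?P i) / card I \<le> 2 * real (card L) * G / card I"
    by (intro divide_right_mono) auto
  then show ?thesis unfolding eq norm_divide by simp
qed

text \<open>Induction on the number of exceptional rows and columns, by expansion along an exceptional
  row \<open>i0\<close>. The columns in \<open>K\<close> are at most \<open>s\<close> many and their minors have two exceptions less. For the
  other columns all minors are close to each other by the previous lemma; if they were equal,
  the row sum, which is at most \<open>D\<close>, would come out as a factor. Relative to \<open>B ^ (card L + card K)\<close> the
  three errors are at most \<open>s / (N0 * B\<^sup>2)\<close>, \<open>2 * s / (N0 * B\<^sup>2)\<close> and \<open>D / (N0 * B)\<close>, which is where the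
  condition on \<open>B\<close> comes from. The summands \<open>card L + card K\<close> in the hypotheses on row sums and on
  the size pay for the at most two rows and columns that are lost whenever this number drops by two.\<close>

lemma sparse_bound:
  fixes b :: "nat \<Rightarrow> nat \<Rightarrow> complex" and D B s N0 :: real
  assumes B: "0 < B" and N0: "0 < N0" and DB: "D * B + 3 * s \<le> N0 * B\<^sup>2"
    and fin: "finite I" "finite J" "card I = card J" and LK: "L \<subseteq> I" "K \<subseteq> J"
    and b1: "\<And>i j. i \<in> I \<Longrightarrow> j \<in> J \<Longrightarrow> norm (b i j) \<le> 1"
    and one: "\<And>i j. i \<in> I - L \<Longrightarrow> j \<in> J - K \<Longrightarrow> b i j = 1"
    and rows: "\<And>i. i \<in> L \<Longrightarrow> norm (\<Sum>j\<in>J - K. b i j) + card L + card K \<le> D"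
    and cols: "\<And>j. j \<in> K \<Longrightarrow> norm (\<Sum>i\<in>I - L. b i j) + card L + card K \<le> D"
    and n: "N0 + card L + card K \<le> card I" and s: "card L + card K \<le> s"
  shows "norm (permanent_avg b I J) \<le> B ^ (card L + card K)"
  using fin LK b1 one rows cols n s
proof (induction "card L + card K" arbitrary: b I J L K rule: less_induct)
  case less
  \<comment> \<open>The case of an exceptional row, stated for all matrices so that it also applies to the transpose.\<close>
  have main: "norm (permanent_avg b I J) \<le> B ^ (card L + card K)"
    if fin: "finite I" "finite J" "card I = card J" and LK: "L \<subseteq> I" "K \<subseteq> J"
      and b1: "\<And>i j. i \<in> I \<Longrightarrow> j \<in> J \<Longrightarrow> norm (b i j) \<le> 1"
      and one: "\<And>i j. i \<in> I - L \<Longrightarrow> j \<in> J - K \<Longrightarrow> b i j = 1"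
      and rows: "\<And>i. i \<in> L \<Longrightarrow> norm (\<Sum>j\<in>J - K. b i j) + card L + card K \<le> D"
      and cols: "\<And>j. j \<in> K \<Longrightarrow> norm (\<Sum>i\<in>I - L. b i j) + card L + card K \<le> D"
      and n: "N0 + card L + card K \<le> card I" and s: "card L + card K \<le> s"
      and L: "L \<noteq> {}"
      and IH: "\<And>L' K' b I J. \<lbrakk>card L' + card K' < card L + card K; finite I; finite J; card I = card J;
          L' \<subseteq> I; K' \<subseteq> J; \<And>i j. i \<in> I \<Longrightarrow> j \<in> J \<Longrightarrow> norm (b i j) \<le> 1;
          \<And>i j. i \<in> I - L' \<Longrightarrow> j \<in> J - K' \<Longrightarrow> b i j = 1;
          \<And>i. i \<in> L' \<Longrightarrow> norm (\<Sum>j\<in>J - K'. b i j) + card L' + card K' \<le> D;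
          \<And>j. j \<in> K' \<Longrightarrow> norm (\<Sum>i\<in>I - L'. b i j) + card L' + card K' \<le> D;
          N0 + card L' + card K' \<le> card I; card L' + card K' \<le> s\<rbrakk>
          \<Longrightarrow> norm (permanent_avg b I J) \<le> B ^ (card L' + card K')"
    for b I J L K
  proof -
    have finLK: "finite L" "finite K" using LK fin by (auto intro: finite_subset)
    define p where "p = card L + card K"
    obtain i0 where i0: "i0 \<in> L" using L by blast
    have i0I: "i0 \<in> I" using i0 LK by blast
    have cL: "card (L - {i0}) = card L - 1" "card L \<ge> 1"
      using i0 finLK by (auto simp: One_nat_def Suc_le_eq card_gt_0_iff)
    have cI: "N0 + 1 \<le> real (card I)" "card K < card I" using n N0 cL by linarith+
    have "card (J - K) > 0" using cI fin finLK LK by (simp add: card_Diff_subset)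
    \<comment> \<open>The minor without column \<open>jj\<close> serves as reference value for all ordinary columns.\<close>
    then obtain jj where jj: "jj \<in> J - K" by (metis card_gt_0_iff ex_in_conv)
    let ?I = "I - {i0}" and ?L = "L - {i0}"
    have B2: "B ^ (p - 2) = B ^ p / B\<^sup>2" if "2 \<le> p"
      using B that by (simp add: power_diff)
    have B1: "B ^ (p - 1) = B ^ p / B"
      using B cL by (cases p) (auto simp: p_def)
    have dropcol: "norm (\<Sum>j\<in>A - {j}. b i j) \<le> norm (\<Sum>j\<in>A. b i j) + 1"
      if "finite A" "j \<in> A" "A \<subseteq> J" "i \<in> I" for A i j
    proof -
      have "(\<Sum>j\<in>A - {j}. b i j) = (\<Sum>j\<in>A. b i j) - b i j" using that by (simp add: sum_diff1)
      then show ?thesis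
        using norm_triangle_ineq4[of "\<Sum>j\<in>A. b i j" "b i j"] b1[of i j] that by fastforce
    qed
    have droprow: "norm (\<Sum>i\<in>A - {i}. b i j) \<le> norm (\<Sum>i\<in>A. b i j) + 1"
      if "finite A" "i \<in> A" "A \<subseteq> I" "j \<in> J" for A i j
    proof -
      have "(\<Sum>i\<in>A - {i}. b i j) = (\<Sum>i\<in>A. b i j) - b i j" using that by (simp add: sum_diff1)
      then show ?thesis
        using norm_triangle_ineq4[of "\<Sum>i\<in>A. b i j" "b i j"] b1[of i j] that by fastforce
    qed
    have GK: "norm (permanent_avg b ?I (J - {j})) \<le> B ^ p / B\<^sup>2" if j: "j \<in> K" for j
    proof -
      have cK: "card (K - {j}) = card K - 1" "card K \<ge> 1"
        using j finLK by (auto simp: One_nat_def Suc_le_eq card_gt_0_iff)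
      have e: "J - {j} - (K - {j}) = J - K" "?I - ?L = I - L" using j i0 by auto
      have "norm (permanent_avg b ?I (J - {j})) \<le> B ^ (card ?L + card (K - {j}))"
      proof (rule IH, goal_cases)
        case (9 i) then show ?case using rows[of i] e cK cL by auto
      next
        case (10 i) then show ?case using cols[of i] e cK cL by auto
      qed (use fin LK i0 i0I j b1 one n s cK cL in auto)
      also have "card ?L + card (K - {j}) = p - 2" using cK cL by (simp add: p_def)
      finally show ?thesis using B2 cK cL by (simp add: p_def)
    qed
    have G1: "norm (permanent_avg b ?I (J - {jj})) \<le> B ^ p / B"
    proof -
      have e: "J - {jj} - K = J - K - {jj}" "?I - ?L = I - L" using jj i0 by auto
      have "norm (permanent_avg b ?I (J - {jj})) \<le> B ^ (card ?L + card K)"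
      proof (rule IH, goal_cases)
        case (9 i)
        have "norm (\<Sum>j\<in>J - K - {jj}. b i j) \<le> norm (\<Sum>j\<in>J - K. b i j) + 1"
          using 9 jj fin LK by (intro dropcol) auto
        then show ?case using 9 rows[of i] cL e by (simp add: of_nat_diff)
      next
        case (10 j) then show ?case using cols[of j] e cL by auto
      qed (use fin LK i0 i0I jj b1 one n s cL in auto)
      also have "card ?L + card K = p - 1" using cL by (simp add: p_def)
      finally show ?thesis using B1 by simp
    qed
    have G2: "norm (permanent_avg b (?I - {i}) (J - {j, jj})) \<le> B ^ p / B\<^sup>2"
      if i: "i \<in> ?L" and j: "j \<in> J - K" "j \<noteq> jj" for i j
    proof -
      have c2: "card (?L - {i}) = card L - 2" "card L \<ge> 2"
        using i i0 finLK cL card_mono[of L "{i0, i}"] by auto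
      have e: "J - {j, jj} - K = J - K - {jj} - {j}" "?I - {i} - (?L - {i}) = I - L"
        using jj i0 i by auto
      have cJ: "card (J - {j, jj}) = card J - 2"
        using j jj fin by (simp add: card_Diff_subset)
      have cI': "card (?I - {i}) = card I - 2"
        using i i0I LK fin by (auto simp: card_Diff_singleton_if)
      have cge: "card I \<ge> 2" using c2 card_mono[OF fin(1) LK(1)] by simp
      have "norm (permanent_avg b (?I - {i}) (J - {j, jj})) \<le> B ^ (card (?L - {i}) + card K)"
      proof (rule IH, goal_cases)
        case (9 i')
        have "norm (\<Sum>j\<in>J - K - {jj} - {j}. b i' j) \<le> norm (\<Sum>j\<in>J - K - {jj}. b i' j) + 1"
          using 9 j jj fin LK by (intro dropcol) auto
        moreover have "norm (\<Sum>j\<in>J - K - {jj}. b i' j) \<le> norm (\<Sum>j\<in>J - K. b i' j) + 1"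
          using 9 jj fin LK by (intro dropcol) auto
        ultimately show ?case using 9 rows[of i'] c2 e by (simp add: of_nat_diff)
      next
        case (10 j) then show ?case using cols[of j] e c2 by auto
      qed (use fin LK i0 i0I i j jj b1 one n s c2 cJ cI' cge in \<open>auto simp: of_nat_diff\<close>)
      also have "card (?L - {i}) + card K = p - 2" using c2 by (simp add: p_def)
      finally show ?thesis using B2 c2 by (simp add: p_def)
    qed
    define X where "X = B ^ p / B\<^sup>2"
    have X0: "0 \<le> X" and XB: "B ^ p / B = B * X" "B\<^sup>2 * X = B ^ p"
      using B by (simp_all add: X_def power2_eq_square)
    note GK = GK[folded X_def] and G1 = G1[unfolded XB(1)] and G2 = G2[folded X_def]
    let ?n = "real (card I)"
    have n1: "real (card ?I) = ?n - 1" using i0I fin cI by (simp add: of_nat_diff)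
    have s1: "card ?L \<le> s - 1" "card K \<le> s" "1 \<le> s" using s cL by (auto simp: of_nat_diff)
    have diff: "norm (permanent_avg b ?I (J - {j}) - permanent_avg b ?I (J - {jj}))
        \<le> 2 * (s - 1) * X / N0" if j: "j \<in> J - K" for j
    proof (cases "j = jj")
      case False
      have G2': "norm (permanent_avg b (?I - {i}) (J - {j, jj})) \<le> X" if "i \<in> ?L" for i
        by (rule G2[OF that j False])
      have "norm (permanent_avg b ?I (J - {j}) - permanent_avg b ?I (J - {jj}))
          \<le> 2 * real (card ?L) * X / card ?I"
        by (rule permanent_avg_change_column)
           (use fin i0I LK b1 j jj one False G2' cI in \<open>auto simp: insert_commute\<close>)
      also have "\<dots> \<le> 2 * (s - 1) * X / N0"
        using X0 N0 s1 n1 cI by (intro frac_le mult_right_mono mult_nonneg_nonneg) auto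
      finally show ?thesis .
    qed (use s1 X0 N0 in simp)
    let ?Q = "\<lambda>j. permanent_avg b ?I (J - {j})"
    have "(\<Sum>j\<in>J. b i0 j * ?Q j) = (\<Sum>j\<in>K. b i0 j * ?Q j) + (\<Sum>j\<in>J - K. b i0 j * ?Q j)"
      using sum.subset_diff[OF LK(2) fin(2)] by (simp add: add.commute)
    also have "(\<Sum>j\<in>J - K. b i0 j * ?Q j) =
        (\<Sum>j\<in>J - K. b i0 j * (?Q j - ?Q jj)) + (\<Sum>j\<in>J - K. b i0 j) * ?Q jj"
      by (simp add: sum_distrib_right sum.distrib[symmetric] algebra_simps)
    finally have split: "(\<Sum>j\<in>J. b i0 j * ?Q j) = (\<Sum>j\<in>K. b i0 j * ?Q j) +
        ((\<Sum>j\<in>J - K. b i0 j * (?Q j - ?Q jj)) + (\<Sum>j\<in>J - K. b i0 j) * ?Q jj)" .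
    have b1': "norm (b i0 j * x) \<le> y" if "j \<in> J" "norm x \<le> y" for j x y
    proof -
      have "norm (b i0 j) * norm x \<le> 1 * y" using b1[OF i0I that(1)] that(2) by (intro mult_mono) auto
      then show ?thesis by (simp add: norm_mult)
    qed
    have nN: "1 \<le> ?n / N0" using cI N0 by simp
    have t1: "norm (\<Sum>j\<in>K. b i0 j * ?Q j) \<le> s * X * (?n / N0)"
    proof -
      have "norm (\<Sum>j\<in>K. b i0 j * ?Q j) \<le> (\<Sum>j\<in>K. X)"
        using LK GK by (intro sum_norm_le b1') auto
      also have "\<dots> \<le> s * X" using s1 X0 by (simp add: mult_right_mono)
      also have "\<dots> \<le> s * X * (?n / N0)"
        using mult_left_mono[OF nN, of "s * X"] s1 X0 by simp
      finally show ?thesis .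
    qed
    have t2: "norm (\<Sum>j\<in>J - K. b i0 j * (?Q j - ?Q jj)) \<le> 2 * (s - 1) * X * (?n / N0)"
    proof -
      have "norm (\<Sum>j\<in>J - K. b i0 j * (?Q j - ?Q jj)) \<le> (\<Sum>j\<in>J - K. 2 * (s - 1) * X / N0)"
        using diff by (intro sum_norm_le b1') auto
      also have "\<dots> = card (J - K) * (2 * (s - 1) * X / N0)" by simp
      also have "\<dots> \<le> ?n * (2 * (s - 1) * X / N0)"
        using s1 X0 N0 fin card_mono[of J "J - K"] by (intro mult_right_mono) auto
      finally show ?thesis by (simp add: mult.commute)
    qed
    have t3: "norm ((\<Sum>j\<in>J - K. b i0 j) * ?Q jj) \<le> D * (B * X) * (?n / N0)"
    proof -
      have D0: "norm (\<Sum>j\<in>J - K. b i0 j) \<le> D" using rows[OF i0] by linarith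
      then have "D \<ge> 0" using norm_ge_zero order_trans by blast
      have "norm ((\<Sum>j\<in>J - K. b i0 j) * ?Q jj) \<le> D * (B * X)"
        unfolding norm_mult using D0 G1 \<open>D \<ge> 0\<close> by (intro mult_mono) auto
      also have "\<dots> \<le> D * (B * X) * (?n / N0)"
        using mult_left_mono[OF nN, of "D * (B * X)"] \<open>D \<ge> 0\<close> B X0 by simp
      finally show ?thesis .
    qed
    have "norm (\<Sum>j\<in>J. b i0 j * ?Q j) \<le> norm (\<Sum>j\<in>K. b i0 j * ?Q j) +
        (norm (\<Sum>j\<in>J - K. b i0 j * (?Q j - ?Q jj)) + norm ((\<Sum>j\<in>J - K. b i0 j) * ?Q jj))"
      unfolding split by (intro norm_triangle_le add_left_mono order_refl)
    also have "\<dots> \<le> s * X * (?n / N0) + (2 * (s - 1) * X * (?n / N0) + D * (B * X) * (?n / N0))"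
      by (intro add_mono t1 t2 t3)
    also have "\<dots> = (D * B + 3 * s - 2) * X * (?n / N0)"
      by (simp add: algebra_simps del: times_divide_eq_right times_divide_eq_left)
    also have "\<dots> \<le> (N0 * B\<^sup>2) * X * (?n / N0)"
      using X0 N0 DB by (intro mult_right_mono) auto
    also have "\<dots> = (B\<^sup>2 * X) * ?n" using N0 by simp
    also have "\<dots> = B ^ p * ?n" using XB by simp
    finally have "norm (\<Sum>j\<in>J. b i0 j * ?Q j) / ?n \<le> B ^ p"
      using cI N0 by (simp add: divide_le_eq)
    then show ?thesis
      unfolding permanent_avg_row[OF fin(1) i0I, of b J] norm_divide p_def by simp
  qed
  show ?case
  proof (cases "L = {}")
    case False
    show ?thesis by (rule main) (use less False in \<open>auto simp only:\<close>)
  next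
    case True
    show ?thesis
    proof (cases "K = {}")
      case K: True
      then show ?thesis using True norm_permanent_avg_le_1[of I J b] less.prems by simp
    next
      case False
      have "norm (permanent_avg (\<lambda>j i. b i j) J I) \<le> B ^ (card K + card L)"
      proof (rule main, goal_cases)
        case (13 L' K' b' I' J')
        show ?case by (rule less.hyps) (use 13 in \<open>auto simp: add.commute\<close>)
      qed (use less.prems False in \<open>auto simp: algebra_simps\<close>)
      then show ?thesis
        using less.prems(1-3) by (simp add: permanent_avg_transpose[of I J b] add.commute)
    qed
  qed
qed

section \<open>Counting vectors with few entries outside a set\<close>

definition off :: "nat \<Rightarrow> 'x set \<Rightarrow> (nat \<Rightarrow> 'x) \<Rightarrow> nat set" where
  "off n C x = {i\<in>{1..n}. x i \<notin> C}"

lemma sum_weight_off: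
  fixes g :: "'x \<Rightarrow> real" and u :: real
  assumes "finite X" "C \<subseteq> X"
  shows "(\<Sum>x\<in>{1..n} \<rightarrow>\<^sub>E X. u ^ card (off n C x) * (\<Prod>i\<in>{1..n} - off n C x. g (x i))) =
    ((\<Sum>a\<in>C. g a) + real (card X - card C) * u) ^ n"
proof -
  have "u ^ card (off n C x) * (\<Prod>i\<in>{1..n} - off n C x. g (x i)) =
      (\<Prod>i\<in>{1..n}. if x i \<in> C then g (x i) else u)" for x
  proof -
    have "(\<Prod>i\<in>{1..n}. if x i \<in> C then g (x i) else u) =
        (\<Prod>i\<in>{i\<in>{1..n}. x i \<in> C}. g (x i)) * (\<Prod>i\<in>off n C x. u)"
      by (simp add: prod.If_cases off_def Int_def)
    moreover have "{1..n} - off n C x = {i\<in>{1..n}. x i \<in> C}" by (auto simp: off_def)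
    ultimately show ?thesis by (simp add: mult.commute)
  qed
  then have "(\<Sum>x\<in>{1..n} \<rightarrow>\<^sub>E X. u ^ card (off n C x) * (\<Prod>i\<in>{1..n} - off n C x. g (x i))) =
      (\<Sum>x\<in>{1..n} \<rightarrow>\<^sub>E X. \<Prod>i\<in>{1..n}. if x i \<in> C then g (x i) else u)"
    by simp
  also have "\<dots> = (\<Prod>i\<in>{1..n}. \<Sum>a\<in>X. if a \<in> C then g a else u)"
    using assms by (intro prod_sum_PiE[symmetric]) auto
  also have "(\<Sum>a\<in>X. if a \<in> C then g a else u) = (\<Sum>a\<in>C. g a) + real (card X - card C) * u"
  proof -
    have "X \<inter> {x. x \<notin> C} = X - C" by auto
    then show ?thesis using assms finite_subset[OF assms(2,1)]
      by (simp add: sum.If_cases Int_absorb1 card_Diff_subset Diff_eq[symmetric])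
  qed
  finally show ?thesis by simp
qed

text \<open>Exponential Markov inequality in two parameters: both indicators are bounded by exponentials, and the
  resulting sum over all vectors factorises over the coordinates.\<close>

lemma exp_moment_count:
  fixes f :: "'x \<Rightarrow> real" and u \<theta> s T :: real
  assumes X: "finite X" "C \<subseteq> X" and u: "0 < u" "u \<le> 1" and \<theta>: "0 \<le> \<theta>"
  shows "card {x \<in> {1..n} \<rightarrow>\<^sub>E X. card (off n C x) \<le> s \<and> T \<le> (\<Sum>i\<in>{1..n} - off n C x. f (x i))}
    \<le> u powr (- s) * exp (- \<theta> * T) * ((\<Sum>a\<in>C. exp (\<theta> * f a)) + card X * u) ^ n"
proof -
  let ?\<Omega> = "{1..n} \<rightarrow>\<^sub>E X"
  let ?S = "{x \<in> ?\<Omega>. card (off n C x) \<le> s \<and> T \<le> (\<Sum>i\<in>{1..n} - off n C x. f (x i))}"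
  let ?w = "\<lambda>x. u ^ card (off n C x) * (\<Prod>i\<in>{1..n} - off n C x. exp (\<theta> * f (x i)))"
  have fin: "finite ?\<Omega>" using X by (intro finite_PiE) auto
  have cXC: "card C \<le> card X" using X by (intro card_mono)
  have "(\<Sum>x\<in>?S. 1) \<le> (\<Sum>x\<in>?S. u powr (- s) * exp (- \<theta> * T) * ?w x)"
  proof (rule sum_mono)
    fix x assume x: "x \<in> ?S"
    have "1 \<le> u powr (card (off n C x) - s)"
      using x u powr_mono'[of "card (off n C x) - s" 0 u] by simp
    moreover have "1 \<le> exp (\<theta> * ((\<Sum>i\<in>{1..n} - off n C x. f (x i)) - T))"
      using x \<theta> by simp
    ultimately have "1 * 1 \<le> u powr (card (off n C x) - s) *
        exp (\<theta> * ((\<Sum>i\<in>{1..n} - off n C x. f (x i)) - T))"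
      by (intro mult_mono) auto
    also have "\<dots> = u powr (- s) * exp (- \<theta> * T) * ?w x"
      using u by (simp add: powr_diff powr_minus powr_realpow exp_diff exp_minus right_diff_distrib
          sum_distrib_left exp_sum field_simps)
    finally show "1 \<le> u powr (- s) * exp (- \<theta> * T) * ?w x" by simp
  qed
  also have "\<dots> \<le> (\<Sum>x\<in>?\<Omega>. u powr (- s) * exp (- \<theta> * T) * ?w x)"
    using fin u by (intro sum_mono2) (auto intro!: mult_nonneg_nonneg prod_nonneg)
  also have "\<dots> = u powr (- s) * exp (- \<theta> * T) * (\<Sum>x\<in>?\<Omega>. ?w x)"
    by (simp add: sum_distrib_left)
  also have "(\<Sum>x\<in>?\<Omega>. ?w x) = ((\<Sum>a\<in>C. exp (\<theta> * f a)) + real (card X - card C) * u) ^ n"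
    by (rule sum_weight_off[OF X, where g = "\<lambda>a. exp (\<theta> * f a)"])
  also have "u powr (- s) * exp (- \<theta> * T) * \<dots> \<le>
      u powr (- s) * exp (- \<theta> * T) * ((\<Sum>a\<in>C. exp (\<theta> * f a)) + card X * u) ^ n"
    using u cXC
    by (intro mult_left_mono power_mono add_left_mono mult_right_mono add_nonneg_nonneg sum_nonneg) auto
  finally show ?thesis by simp
qed

lemma exp_le_quadratic:
  fixes t :: real
  assumes "\<bar>t\<bar> \<le> 1"
  shows "exp t \<le> 1 + t + t\<^sup>2"
proof (cases "t \<ge> 0")
  case True
  then show ?thesis using assms exp_bound[of t] by simp
next
  case False
  have "1 - t \<le> exp (- t)" using exp_ge_add_one_self[of "-t"] by simp
  then have "exp t \<le> 1 / (1 - t)"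
    using False by (simp add: exp_minus field_simps)
  also have "\<dots> \<le> 1 + t + t\<^sup>2"
  proof -
    have "(1 + t + t\<^sup>2) * (1 - t) = 1 - t ^ 3" by (simp add: algebra_simps power2_eq_square power3_eq_cube)
    moreover have "t ^ 3 \<le> 0" using False by (simp add: power3_eq_cube mult_le_0_iff zero_le_mult_iff)
    ultimately show ?thesis using False by (simp add: divide_le_eq)
  qed
  finally show ?thesis .
qed

text \<open>The choice \<open>\<theta> = D / (4 * n)\<close> optimises the exponent \<open>n * \<theta>\<^sup>2 - \<theta> * D / 2\<close>. Weighting each entry outside
  \<open>C\<close> by \<open>1 / n\<close> costs a factor \<open>n ^ s\<close>, but it keeps the total weight of these entries bounded.\<close>

lemma real_tail_count:
  fixes f :: "'x \<Rightarrow> real" and D :: real and s :: nat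
  assumes X: "finite X" "C \<subseteq> X" "C \<noteq> {}" and n: "0 < n" and D: "0 < D" "D \<le> 4 * n"
    and f: "\<And>a. a \<in> C \<Longrightarrow> \<bar>f a\<bar> \<le> 1" "(\<Sum>a\<in>C. f a) = 0"
  shows "card {x \<in> {1..n} \<rightarrow>\<^sub>E X. card (off n C x) \<le> s \<and> D / 2 \<le> (\<Sum>i\<in>{1..n} - off n C x. f (x i))}
    \<le> real (card C) ^ n * real n ^ s * exp (card X) * exp (- D\<^sup>2 / (16 * real n))"
proof -
  define \<theta> where "\<theta> = D / (4 * n)"
  define u where "u = 1 / real n"
  have \<theta>: "0 \<le> \<theta>" "\<theta> \<le> 1" using n D by (auto simp: \<theta>_def)
  have u: "0 < u" "u \<le> 1" using n by (auto simp: u_def)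
  have finC: "finite C" using X finite_subset by blast
  have cC: "1 \<le> real (card C)" using X(3) finC by (simp add: One_nat_def Suc_le_eq card_gt_0_iff)
  have "exp (\<theta> * f a) \<le> 1 + \<theta> * f a + \<theta>\<^sup>2" if "a \<in> C" for a
  proof -
    have fa: "\<bar>f a\<bar> \<le> 1" using f(1)[OF that] .
    have "\<bar>\<theta> * f a\<bar> \<le> 1" using \<theta> fa by (simp add: abs_mult mult_le_one)
    then have "exp (\<theta> * f a) \<le> 1 + \<theta> * f a + (\<theta> * f a)\<^sup>2" by (rule exp_le_quadratic)
    also have "(\<theta> * f a)\<^sup>2 \<le> \<theta>\<^sup>2 * 1"
      unfolding power_mult_distrib using fa by (intro mult_left_mono) (auto simp: abs_square_le_1)
    finally show ?thesis by simp
  qed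
  then have "(\<Sum>a\<in>C. exp (\<theta> * f a)) \<le> (\<Sum>a\<in>C. 1 + \<theta> * f a + \<theta>\<^sup>2)" by (rule sum_mono)
  also have "\<dots> = card C * (1 + \<theta>\<^sup>2)"
    using f(2) by (simp add: sum.distrib sum_distrib_left[symmetric] algebra_simps)
  finally have "(\<Sum>a\<in>C. exp (\<theta> * f a)) + card X * u \<le> card C * (1 + \<theta>\<^sup>2) + card X * u * card C"
    using mult_left_mono[OF cC, of "card X * u"] u by simp
  also have "\<dots> = card C * (1 + (\<theta>\<^sup>2 + card X * u))" by (simp add: algebra_simps)
  also have "\<dots> \<le> card C * exp (\<theta>\<^sup>2 + card X * u)"
    by (intro mult_left_mono exp_ge_add_one_self) auto
  finally have base: "((\<Sum>a\<in>C. exp (\<theta> * f a)) + card X * u) ^ n \<le> (card C * exp (\<theta>\<^sup>2 + card X * u)) ^ n"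
    using u by (intro power_mono add_nonneg_nonneg sum_nonneg) auto
  have "card {x \<in> {1..n} \<rightarrow>\<^sub>E X. card (off n C x) \<le> real s \<and> D / 2 \<le> (\<Sum>i\<in>{1..n} - off n C x. f (x i))}
      \<le> u powr (- real s) * exp (- \<theta> * (D / 2)) * ((\<Sum>a\<in>C. exp (\<theta> * f a)) + card X * u) ^ n"
    by (rule exp_moment_count[OF X(1,2) u \<theta>(1)])
  also have "\<dots> \<le> u powr (- real s) * exp (- \<theta> * (D / 2)) * (card C * exp (\<theta>\<^sup>2 + card X * u)) ^ n"
    by (intro mult_left_mono base) auto
  also have "u powr (- real s) = real n ^ s"
    using n by (simp add: u_def powr_minus powr_realpow field_simps)
  also have "(card C * exp (\<theta>\<^sup>2 + card X * u)) ^ n = real (card C) ^ n * exp (n * \<theta>\<^sup>2 + card X)"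
    using n by (simp add: power_mult_distrib exp_of_nat_mult[symmetric] u_def distrib_left)
  also have "real n ^ s * exp (- \<theta> * (D / 2)) * (real (card C) ^ n * exp (n * \<theta>\<^sup>2 + card X)) =
      real (card C) ^ n * real n ^ s * exp (card X) * exp (- \<theta> * (D / 2) + n * \<theta>\<^sup>2)"
  proof -
    have "exp (- \<theta> * (D / 2)) * exp (n * \<theta>\<^sup>2 + card X) = exp (card X) * exp (- \<theta> * (D / 2) + n * \<theta>\<^sup>2)"
      unfolding exp_add[symmetric] by (simp add: algebra_simps)
    then show ?thesis by (simp only: mult_ac)
  qed
  also have "- \<theta> * (D / 2) + n * \<theta>\<^sup>2 = - D\<^sup>2 / (16 * real n)"
    using n by (simp add: \<theta>_def power2_eq_square field_simps)
  finally show ?thesis by simp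
qed

lemma tail_count:
  fixes f :: "'x \<Rightarrow> complex" and D :: real and s :: nat
  assumes X: "finite X" "C \<subseteq> X" "C \<noteq> {}" and n: "0 < n" and D: "0 < D" "D \<le> 4 * n"
    and f: "\<And>a. a \<in> C \<Longrightarrow> norm (f a) \<le> 1" "(\<Sum>a\<in>C. f a) = 0"
  shows "card {x \<in> {1..n} \<rightarrow>\<^sub>E X. card (off n C x) \<le> s \<and> D < norm (\<Sum>i\<in>{1..n} - off n C x. f (x i))}
    \<le> 4 * (real (card C) ^ n * real n ^ s * exp (card X) * exp (- D\<^sup>2 / (16 * real n)))"
proof -
  let ?S = "\<lambda>g :: 'x \<Rightarrow> real. {x \<in> {1..n} \<rightarrow>\<^sub>E X. card (off n C x) \<le> s \<and>
      D / 2 \<le> (\<Sum>i\<in>{1..n} - off n C x. g (x i))}"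
  let ?T = "{x \<in> {1..n} \<rightarrow>\<^sub>E X. card (off n C x) \<le> s \<and> D < norm (\<Sum>i\<in>{1..n} - off n C x. f (x i))}"
  let ?b = "real (card C) ^ n * real n ^ s * exp (card X) * exp (- D\<^sup>2 / (16 * real n))"
  have fin: "finite ({1..n} \<rightarrow>\<^sub>E X)" using X by (intro finite_PiE) auto
  have sub: "?T \<subseteq> (?S (\<lambda>a. Re (f a)) \<union> ?S (\<lambda>a. - Re (f a))) \<union> (?S (\<lambda>a. Im (f a)) \<union> ?S (\<lambda>a. - Im (f a)))"
  proof
    fix x assume x: "x \<in> ?T"
    let ?z = "\<Sum>i\<in>{1..n} - off n C x. f (x i)"
    have "D < \<bar>Re ?z\<bar> + \<bar>Im ?z\<bar>" using x cmod_le[of ?z] by simp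
    then have "D / 2 \<le> Re ?z \<or> D / 2 \<le> - Re ?z \<or> D / 2 \<le> Im ?z \<or> D / 2 \<le> - Im ?z" by linarith
    then show "x \<in> (?S (\<lambda>a. Re (f a)) \<union> ?S (\<lambda>a. - Re (f a))) \<union> (?S (\<lambda>a. Im (f a)) \<union> ?S (\<lambda>a. - Im (f a)))"
      using x by (auto simp: sum_negf)
  qed
  have one: "card (?S g) \<le> ?b" if "\<And>a. a \<in> C \<Longrightarrow> \<bar>g a\<bar> \<le> 1" "(\<Sum>a\<in>C. g a) = 0" for g
    by (rule real_tail_count[OF X n D that])
  have "card ?T \<le> card ((?S (\<lambda>a. Re (f a)) \<union> ?S (\<lambda>a. - Re (f a))) \<union> (?S (\<lambda>a. Im (f a)) \<union> ?S (\<lambda>a. - Im (f a))))"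
    using fin by (intro card_mono sub) auto
  also have "\<dots> \<le> (card (?S (\<lambda>a. Re (f a))) + card (?S (\<lambda>a. - Re (f a)))) +
      (card (?S (\<lambda>a. Im (f a))) + card (?S (\<lambda>a. - Im (f a))))"
    by (intro order_trans[OF card_Un_le] add_mono card_Un_le)
  finally have "card ?T \<le> (card (?S (\<lambda>a. Re (f a))) + card (?S (\<lambda>a. - Re (f a)))) +
      (card (?S (\<lambda>a. Im (f a))) + card (?S (\<lambda>a. - Im (f a))))" .
  then have "real (card ?T) \<le> (real (card (?S (\<lambda>a. Re (f a)))) + card (?S (\<lambda>a. - Re (f a)))) +
      (real (card (?S (\<lambda>a. Im (f a)))) + card (?S (\<lambda>a. - Im (f a))))"
    by linarith
  moreover have "card (?S (\<lambda>a. Re (f a))) \<le> ?b" "card (?S (\<lambda>a. - Re (f a))) \<le> ?b"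
    using f abs_Re_le_cmod order_trans
    by (intro one; fastforce simp: sum_negf Re_sum[symmetric])+
  moreover have "card (?S (\<lambda>a. Im (f a))) \<le> ?b" "card (?S (\<lambda>a. - Im (f a))) \<le> ?b"
    using f abs_Im_le_cmod order_trans
    by (intro one; fastforce simp: sum_negf Im_sum[symmetric])+
  ultimately show ?thesis by linarith
qed

section \<open>Fourier analysis of the random vectors\<close>

abbreviation dual_vectors :: "nat \<Rightarrow> (nat \<Rightarrow> 'a::ab_group_add \<Rightarrow> complex) set" where
  "dual_vectors n \<equiv> {1..n} \<rightarrow>\<^sub>E dual"

lemma dual_vectorsD: "\<xi> \<in> dual_vectors n \<Longrightarrow> 1 \<le> i \<Longrightarrow> i \<le> n \<Longrightarrow> \<xi> i \<in> dual"
  using PiE_mem[of \<xi> "{1..n}" "\<lambda>_. dual" i] by simp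

definition pairing :: "nat \<Rightarrow> (nat \<Rightarrow> 'a \<Rightarrow> complex) \<Rightarrow> (nat \<Rightarrow> 'a) \<Rightarrow> complex" where
  "pairing n \<xi> x = (\<Prod>i\<in>{1..n}. \<xi> i (x i))"

definition char_fun :: "nat \<Rightarrow> (nat \<Rightarrow> 'a) pmf \<Rightarrow> (nat \<Rightarrow> 'a \<Rightarrow> complex) \<Rightarrow> complex" where
  "char_fun n X \<xi> = measure_pmf.expectation X (pairing n \<xi>)"

lemma finite_vectors: "finite (vectors n :: (nat \<Rightarrow> 'a::finite) set)"
  unfolding vectors_def by (intro finite_PiE) auto

lemma finite_dual_vectors: "finite (dual_vectors n :: (nat \<Rightarrow> 'a::{ab_group_add,finite} \<Rightarrow> complex) set)"
  by (intro finite_PiE) (auto simp: finite_dual)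

lemma norm_pairing:
  "\<xi> \<in> dual_vectors n \<Longrightarrow> norm (pairing n \<xi> (x :: nat \<Rightarrow> 'a::{ab_group_add,finite})) = 1"
  unfolding pairing_def prod_norm[symmetric] by (intro prod.neutral) (auto intro: norm_dual)

lemma pairing_orthogonality:
  fixes x y :: "nat \<Rightarrow> 'a::{ab_group_add,finite}"
  assumes "x \<in> vectors n" "y \<in> vectors n"
  shows "(\<Sum>\<xi>\<in>dual_vectors n. pairing n \<xi> x * cnj (pairing n \<xi> y)) =
    (if x = y then of_nat CARD('a) ^ n else 0)"
proof -
  have "(\<Sum>\<xi>\<in>dual_vectors n. pairing n \<xi> x * cnj (pairing n \<xi> y)) =
      (\<Sum>\<xi>\<in>dual_vectors n. \<Prod>i\<in>{1..n}. \<xi> i (x i - y i))"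
    by (intro sum.cong refl) (auto simp: pairing_def prod.distrib[symmetric] dual_diff dual_vectorsD intro!: prod.cong)
  also have "\<dots> = (\<Prod>i\<in>{1..n}. \<Sum>\<psi>\<in>dual. \<psi> (x i - y i))"
    by (rule prod_sum_PiE[symmetric]) (auto simp: finite_dual)
  also have "\<dots> = (\<Prod>i\<in>{1..n}. if x i = y i then of_nat CARD('a) else 0)"
    by (simp add: sum_dual)
  also have "\<dots> = (if x = y then of_nat CARD('a) ^ n else 0)"
  proof (cases "x = y")
    case False
    then obtain i where "i \<in> {1..n}" "x i \<noteq> y i"
      using assms unfolding vectors_def by (metis PiE_ext)
    then show ?thesis using False by (auto intro!: prod_zero)
  qed simp
  finally show ?thesis .
qed

lemma char_fun_sum:
  fixes X :: "(nat \<Rightarrow> 'a::finite) pmf"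
  assumes "set_pmf X \<subseteq> vectors n"
  shows "char_fun n X \<xi> = (\<Sum>x\<in>vectors n. of_real (pmf X x) * pairing n \<xi> x)"
  unfolding char_fun_def using assms
  by (subst integral_measure_pmf[OF finite_vectors[of n]]) (auto simp: scaleR_conv_of_real)

lemma pmf_fourier_inversion:
  fixes X :: "(nat \<Rightarrow> 'a::{ab_group_add,finite}) pmf"
  assumes X: "set_pmf X \<subseteq> vectors n" and r: "r \<in> vectors n"
  shows "(\<Sum>\<xi>\<in>dual_vectors n. char_fun n X \<xi> * cnj (pairing n \<xi> r)) =
    of_nat CARD('a) ^ n * of_real (pmf X r)"
proof -
  have "(\<Sum>\<xi>\<in>dual_vectors n. char_fun n X \<xi> * cnj (pairing n \<xi> r)) =
      (\<Sum>\<xi>\<in>dual_vectors n. \<Sum>x\<in>vectors n. of_real (pmf X x) * (pairing n \<xi> x * cnj (pairing n \<xi> r)))"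
    by (simp add: char_fun_sum[OF X] sum_distrib_right mult.assoc)
  also have "\<dots> = (\<Sum>x\<in>vectors n. of_real (pmf X x) *
      (\<Sum>\<xi>\<in>dual_vectors n. pairing n \<xi> x * cnj (pairing n \<xi> r)))"
    by (subst sum.swap) (simp add: sum_distrib_left)
  also have "\<dots> = (\<Sum>x\<in>vectors n. if x = r then of_nat CARD('a) ^ n * of_real (pmf X r) else 0)"
    by (intro sum.cong refl) (simp add: pairing_orthogonality r)
  also have "\<dots> = of_nat CARD('a) ^ n * of_real (pmf X r)"
    using r by (simp add: finite_vectors)
  finally show ?thesis .
qed

lemma parseval:
  fixes X :: "(nat \<Rightarrow> 'a::{ab_group_add,finite}) pmf"
  assumes X: "set_pmf X \<subseteq> vectors n"
  shows "(\<Sum>\<xi>\<in>dual_vectors n. (norm (char_fun n X \<xi>))\<^sup>2) =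
    real CARD('a) ^ n * (\<Sum>x\<in>vectors n. (pmf X x)\<^sup>2)"
proof -
  have "complex_of_real (\<Sum>\<xi>\<in>dual_vectors n. (norm (char_fun n X \<xi>))\<^sup>2) =
      (\<Sum>\<xi>\<in>dual_vectors n. char_fun n X \<xi> * cnj (char_fun n X \<xi>))"
    by (simp only: of_real_sum complex_norm_square)
  also have "\<dots> = (\<Sum>\<xi>\<in>dual_vectors n. \<Sum>x\<in>vectors n.
      of_real (pmf X x) * (char_fun n X \<xi> * cnj (pairing n \<xi> x)))"
    by (subst (2) char_fun_sum[OF X]) (simp add: sum_distrib_left mult_ac)
  also have "\<dots> = (\<Sum>x\<in>vectors n. of_real (pmf X x) * (of_nat CARD('a) ^ n * of_real (pmf X x)))"
    by (subst sum.swap) (simp add: sum_distrib_left[symmetric] pmf_fourier_inversion[OF X])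
  also have "\<dots> = complex_of_real (real CARD('a) ^ n * (\<Sum>x\<in>vectors n. (pmf X x)\<^sup>2))"
    by (simp add: sum_distrib_left power2_eq_square mult_ac)
  finally show ?thesis by (simp only: of_real_eq_iff)
qed

lemma d_inf_le_fourier:
  fixes X Y :: "(nat \<Rightarrow> 'a::{ab_group_add,finite}) pmf"
  assumes X: "set_pmf X \<subseteq> vectors n" and Y: "set_pmf Y \<subseteq> vectors n"
  shows "d_inf (vectors n) X Y \<le>
    (\<Sum>\<xi>\<in>dual_vectors n. norm (char_fun n X \<xi> - char_fun n Y \<xi>)) / real CARD('a) ^ n"
proof -
  let ?M = "real CARD('a) ^ n"
  have M0: "?M > 0" by simp
  have "\<bar>pmf X r - pmf Y r\<bar> \<le> (\<Sum>\<xi>\<in>dual_vectors n. norm (char_fun n X \<xi> - char_fun n Y \<xi>)) / ?M"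
    if r: "r \<in> vectors n" for r
  proof -
    have "complex_of_real ?M * of_real (pmf X r - pmf Y r) =
        (\<Sum>\<xi>\<in>dual_vectors n. (char_fun n X \<xi> - char_fun n Y \<xi>) * cnj (pairing n \<xi> r))"
      using pmf_fourier_inversion[OF X r] pmf_fourier_inversion[OF Y r]
      by (simp add: sum_subtractf left_diff_distrib right_diff_distrib)
    then have "norm (complex_of_real ?M * of_real (pmf X r - pmf Y r)) \<le>
        (\<Sum>\<xi>\<in>dual_vectors n. norm (char_fun n X \<xi> - char_fun n Y \<xi>))"
      by (simp only:) (intro sum_norm_le, simp add: norm_mult norm_pairing)
    then have "?M * \<bar>pmf X r - pmf Y r\<bar> \<le> (\<Sum>\<xi>\<in>dual_vectors n. norm (char_fun n X \<xi> - char_fun n Y \<xi>))"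
      unfolding norm_mult norm_of_real by simp
    then show ?thesis using M0 by (simp add: le_divide_eq mult.commute)
  qed
  moreover have "(vectors n :: (nat \<Rightarrow> 'a) set) \<noteq> {}"
    unfolding vectors_def by (simp add: PiE_eq_empty_iff)
  ultimately show ?thesis unfolding d_inf_def by (subst Max_le_iff) (auto simp: finite_vectors)
qed

definition rearrange :: "nat \<Rightarrow> (nat \<Rightarrow> 'a) \<Rightarrow> (nat \<Rightarrow> nat) \<Rightarrow> nat \<Rightarrow> 'a" where
  "rearrange n q \<sigma> = (\<lambda>i\<in>{1..n}. q (\<sigma> i))"

definition shuffle_pmf :: "nat \<Rightarrow> (nat \<Rightarrow> 'a) \<Rightarrow> (nat \<Rightarrow> 'a) pmf" where
  "shuffle_pmf n q = map_pmf (rearrange n q) (pmf_of_set {\<sigma>. \<sigma> permutes {1..n}})"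

lemma finite_perms: "finite {\<sigma>. \<sigma> permutes {1..n::nat}}" and perms_nonempty: "{\<sigma>. \<sigma> permutes {1..n::nat}} \<noteq> {}"
  using permutes_id[of "{1..n}"] by (auto simp: finite_permutations simp del: permutes_id)

lemma card_perms: "card {\<sigma>. \<sigma> permutes {1..n::nat}} = fact n"
  by (rule card_permutations) auto

lemma rearrange_in_vectors: "rearrange n q \<sigma> \<in> vectors n"
  by (auto simp: rearrange_def vectors_def)

lemma set_shuffle_pmf: "set_pmf (shuffle_pmf n q) \<subseteq> vectors n"
  unfolding shuffle_pmf_def by (auto simp: rearrange_in_vectors)

lemma expectation_pmf_of_set:
  fixes f :: "'b \<Rightarrow> complex"
  assumes "finite S" "S \<noteq> {}"
  shows "measure_pmf.expectation (pmf_of_set S) f = (\<Sum>x\<in>S. f x) / of_nat (card S)"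
  using assms by (subst integral_measure_pmf[of S]) (auto simp: sum_divide_distrib scaleR_conv_of_real)

lemma expectation_perms:
  "measure_pmf.expectation (pmf_of_set {\<sigma>. \<sigma> permutes {1..n::nat}}) f =
    (\<Sum>\<sigma> | \<sigma> permutes {1..n}. f \<sigma>) / (fact n :: complex)"
  by (simp add: expectation_pmf_of_set[OF finite_perms perms_nonempty] card_perms)

lemma char_fun_shuffle_sum:
  "char_fun n (shuffle_pmf n q) \<xi> = (\<Sum>\<sigma> | \<sigma> permutes {1..n}. pairing n \<xi> (rearrange n q \<sigma>)) / fact n"
  unfolding char_fun_def shuffle_pmf_def by (simp add: expectation_perms)

lemma char_fun_shuffle:
  "char_fun n (shuffle_pmf n q) \<xi> = permanent_avg (\<lambda>i j. \<xi> i (q j)) {1..n} {1..n}"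
proof -
  have "(\<Sum>\<sigma> | \<sigma> permutes {1..n}. pairing n \<xi> (rearrange n q \<sigma>)) =
      (\<Sum>\<sigma>\<in>bijs {1..n} {1..n}. \<Prod>i\<in>{1..n}. \<xi> i (q (\<sigma> i)))"
  proof (rule sum.reindex_bij_witness[of _ "\<lambda>\<sigma> i. if i \<in> {1..n} then \<sigma> i else i" "\<lambda>\<sigma>. restrict \<sigma> {1..n}"])
    fix \<sigma> assume "\<sigma> \<in> {\<sigma>. \<sigma> permutes {1..n}}"
    then have s: "\<sigma> permutes {1..n}" by simp
    show "(\<lambda>i. if i \<in> {1..n} then restrict \<sigma> {1..n} i else i) = \<sigma>"
      using s by (auto simp: fun_eq_iff permutes_def)
    have "bij_betw (restrict \<sigma> {1..n}) {1..n} {1..n}"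
      using permutes_imp_bij[OF s] by (subst bij_betw_cong[of _ _ \<sigma>]) auto
    then show "restrict \<sigma> {1..n} \<in> bijs {1..n} {1..n}"
      by (auto simp: bijs_def dest: bij_betwE)
    show "(\<Prod>i\<in>{1..n}. \<xi> i (q (restrict \<sigma> {1..n} i))) = pairing n \<xi> (rearrange n q \<sigma>)"
      by (simp add: pairing_def rearrange_def)
  next
    fix \<sigma> assume s: "\<sigma> \<in> bijs {1..n} {1..n}"
    then show "restrict (\<lambda>i. if i \<in> {1..n} then \<sigma> i else i) {1..n} = \<sigma>"
      by (auto simp: bijs_def fun_eq_iff PiE_def extensional_def)
    have "bij_betw (\<lambda>i. if i \<in> {1..n} then \<sigma> i else i) {1..n} {1..n}"
      using s by (subst bij_betw_cong[of _ _ \<sigma>]) (auto simp: bijs_def)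
    then show "(\<lambda>i. if i \<in> {1..n} then \<sigma> i else i) \<in> {\<sigma>. \<sigma> permutes {1..n}}"
      by (auto intro: bij_imp_permutes)
  qed
  then show ?thesis by (simp add: char_fun_shuffle_sum permanent_avg_def)
qed

lemma norm_char_fun_le_1:
  fixes X :: "(nat \<Rightarrow> 'a::{ab_group_add,finite}) pmf"
  assumes "\<xi> \<in> dual_vectors n"
  shows "norm (char_fun n X \<xi>) \<le> 1"
proof -
  have "norm (char_fun n X \<xi>) \<le> measure_pmf.expectation X (\<lambda>x. norm (pairing n \<xi> x))"
    unfolding char_fun_def by (rule integral_norm_bound)
  then show ?thesis using assms by (simp add: norm_pairing)
qed

lemma perm_matrix_action:
  assumes "\<sigma> permutes {1..n}" "i \<in> {1..n}"
  shows "(\<Sum>j=1..n. nat_scale (perm_matrix n \<sigma> i j) (q j)) = q (\<sigma> i)"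
proof -
  have "\<sigma> i \<in> {1..n}" using assms(2) permutes_in_image[OF assms(1)] by simp
  have "(\<Sum>j=1..n. nat_scale (perm_matrix n \<sigma> i j) (q j)) = (\<Sum>j=1..n. if j = \<sigma> i then q j else 0)"
    using assms(2) by (intro sum.cong refl) (auto simp: perm_matrix_def)
  also have "\<dots> = q (\<sigma> i)" using \<open>\<sigma> i \<in> {1..n}\<close> by simp
  finally show ?thesis .
qed

text \<open>Hence a uniform permutation matrix is the matrix of a uniform permutation.\<close>

lemma inj_on_perm_matrix: "inj_on (perm_matrix n) {\<sigma>. \<sigma> permutes {1..n}}"
proof (rule inj_onI)
  fix \<sigma> \<tau> assume "\<sigma> \<in> {\<sigma>. \<sigma> permutes {1..n}}" "\<tau> \<in> {\<sigma>. \<sigma> permutes {1..n}}"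
    and eq: "perm_matrix n \<sigma> = perm_matrix n \<tau>"
  then have s: "\<sigma> permutes {1..n}" and t: "\<tau> permutes {1..n}" by auto
  show "\<sigma> = \<tau>"
  proof
    fix i
    show "\<sigma> i = \<tau> i"
    proof (cases "i \<in> {1..n}")
      case True
      then have "\<sigma> i \<in> {1..n}" using permutes_in_image[OF s] by simp
      then have "perm_matrix n \<sigma> i (\<sigma> i) = 1" using True by (simp add: perm_matrix_def)
      then have "perm_matrix n \<tau> i (\<sigma> i) = 1" using eq by simp
      then show ?thesis by (auto simp: perm_matrix_def split: if_splits)
    next
      case False
      then show ?thesis using permutes_not_in[OF s] permutes_not_in[OF t] by simp
    qed
  qed
qed

lemma nat_scale_add: "nat_scale (k + l) v = nat_scale k v + nat_scale l (v :: 'a::comm_monoid_add)"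
  by (induction l) (auto simp: nat_scale_Suc add.assoc)

lemma nat_scale_sum: "nat_scale (\<Sum>k\<in>A. f k) v = (\<Sum>k\<in>A. nat_scale (f k) (v :: 'a::comm_monoid_add))"
  by (induction A rule: infinite_finite_induct) (auto simp: nat_scale_add)

lemma mat_act_sum:
  "i \<in> {1..n} \<Longrightarrow> mat_act n (\<lambda>i j. \<Sum>k\<in>A. P k i j) q i = (\<Sum>k\<in>A. mat_act n (P k) q i)"
  by (simp add: mat_act_def nat_scale_sum) (rule sum.swap)

lemma pairing_sum:
  assumes "finite A" "\<xi> \<in> dual_vectors n" "\<And>i. i \<in> {1..n} \<Longrightarrow> x i = (\<Sum>k\<in>A. y k i)"
  shows "pairing n \<xi> x = (\<Prod>k\<in>A. pairing n \<xi> (y k))"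
proof -
  have d: "\<psi> (\<Sum>k\<in>A. z k) = (\<Prod>k\<in>A. \<psi> (z k))" if "\<psi> \<in> dual" for \<psi> z
    using assms(1) that by (induction A rule: finite_induct) (auto simp: dual_0 dual_add)
  have "pairing n \<xi> x = (\<Prod>i\<in>{1..n}. \<Prod>k\<in>A. \<xi> i (y k i))"
    unfolding pairing_def using assms by (intro prod.cong refl) (auto simp: d dual_vectorsD)
  also have "\<dots> = (\<Prod>k\<in>A. pairing n \<xi> (y k))"
    unfolding pairing_def by (rule prod.swap)
  finally show ?thesis .
qed

lemma sum_prod_PiE_dflt:
  fixes f :: "'b \<Rightarrow> 'c :: comm_semiring_1"
  assumes "finite A" "finite S"
  shows "(\<Sum>P\<in>PiE_dflt A e (\<lambda>_. S). \<Prod>k\<in>A. f (P k)) = (\<Sum>y\<in>S. f y) ^ card A"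
proof -
  have "(\<Sum>P\<in>PiE_dflt A e (\<lambda>_. S). \<Prod>k\<in>A. f (P k)) = (\<Sum>P\<in>PiE A (\<lambda>_. S). \<Prod>k\<in>A. f (P k))"
    by (rule sum.reindex_bij_witness[of _ "\<lambda>h x. if x \<in> A then h x else e" "\<lambda>h. restrict h A"])
       (auto simp: PiE_dflt_def PiE_def extensional_def fun_eq_iff)
  also have "\<dots> = (\<Prod>k\<in>A. \<Sum>y\<in>S. f y)"
    using assms by (intro prod_sum_PiE[symmetric]) auto
  finally show ?thesis by simp
qed

text \<open>The summands \<open>P\<^sub>k q\<close> are independent random rearrangements of \<open>q\<close>, and the pairing turns sums into products.\<close>

lemma char_fun_A:
  fixes q :: "nat \<Rightarrow> 'a::{ab_group_add,finite}"
  assumes \<xi>: "\<xi> \<in> dual_vectors n"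
  shows "char_fun n (map_pmf (\<lambda>A. mat_act n A q) (A_pmf n d)) \<xi> =
    char_fun n (shuffle_pmf n q) \<xi> ^ d"
proof -
  let ?M = "perm_matrices n"
  have cM: "card ?M = fact n"
    unfolding perm_matrices_def by (simp add: card_image[OF inj_on_perm_matrix] card_perms)
  have ne: "PiE_dflt {1..d} (\<lambda>_ _. 0) (\<lambda>_. ?M) \<noteq> {}"
    using perm_matrices_nonempty by (simp add: PiE_dflt_empty_iff)
  have finP: "finite (PiE_dflt {1..d} (\<lambda>_ _. 0) (\<lambda>_. ?M))"
    by (intro finite_PiE_dflt finite_perm_matrices) auto
  have "char_fun n (map_pmf (\<lambda>A. mat_act n A q) (A_pmf n d)) \<xi> =
      measure_pmf.expectation (Pi_pmf {1..d} (\<lambda>_ _. 0) (\<lambda>_. pmf_of_set ?M))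
        (\<lambda>P. pairing n \<xi> (mat_act n (\<lambda>i j. \<Sum>k=1..d. P k i j) q))"
    by (simp add: char_fun_def A_pmf_def)
  also have "Pi_pmf {1..d} (\<lambda>_ _. 0) (\<lambda>_. pmf_of_set ?M) =
      pmf_of_set (PiE_dflt {1..d} (\<lambda>_ _. 0) (\<lambda>_. ?M))"
    by (intro Pi_pmf_of_set) (auto simp: finite_perm_matrices perm_matrices_nonempty)
  also have "measure_pmf.expectation \<dots> (\<lambda>P. pairing n \<xi> (mat_act n (\<lambda>i j. \<Sum>k=1..d. P k i j) q)) =
      (\<Sum>P\<in>PiE_dflt {1..d} (\<lambda>_ _. 0) (\<lambda>_. ?M). pairing n \<xi> (mat_act n (\<lambda>i j. \<Sum>k=1..d. P k i j) q)) /
        of_nat (card (PiE_dflt {1..d} (\<lambda>_ _. 0) (\<lambda>_. ?M) :: (nat \<Rightarrow> nat \<Rightarrow> nat \<Rightarrow> nat) set))"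
    by (simp add: expectation_pmf_of_set[OF finP ne])
  also have "card (PiE_dflt {1..d} (\<lambda>_ _. 0) (\<lambda>_. ?M) :: (nat \<Rightarrow> nat \<Rightarrow> nat \<Rightarrow> nat) set) = fact n ^ d"
    by (subst card_PiE_dflt) (auto simp: finite_perm_matrices cM)
  also have "(\<Sum>P\<in>PiE_dflt {1..d} (\<lambda>_ _. 0) (\<lambda>_. ?M). pairing n \<xi> (mat_act n (\<lambda>i j. \<Sum>k=1..d. P k i j) q)) =
      (\<Sum>P\<in>PiE_dflt {1..d} (\<lambda>_ _. 0) (\<lambda>_. ?M). \<Prod>k\<in>{1..d}. pairing n \<xi> (mat_act n (P k) q))"
    by (intro sum.cong refl pairing_sum[OF _ \<xi>] mat_act_sum) auto
  also have "\<dots> = (\<Sum>P\<in>?M. pairing n \<xi> (mat_act n P q)) ^ d"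
    by (subst sum_prod_PiE_dflt) (auto simp: finite_perm_matrices)
  also have "(\<Sum>P\<in>?M. pairing n \<xi> (mat_act n P q)) = (\<Sum>\<sigma> | \<sigma> permutes {1..n}. pairing n \<xi> (rearrange n q \<sigma>))"
    unfolding perm_matrices_def sum.reindex[OF inj_on_perm_matrix] o_def
    by (intro sum.cong refl) (auto simp: pairing_def rearrange_def mat_act_def perm_matrix_action intro!: prod.cong)
  finally show ?thesis
    by (simp add: char_fun_shuffle_sum power_divide)
qed

section \<open>The second moment\<close>

lemma pmf_shuffle:
  "pmf (shuffle_pmf n q) x = card {\<sigma>. \<sigma> permutes {1..n} \<and> rearrange n q \<sigma> = x} / fact n"
proof -
  have "{\<sigma>. \<sigma> permutes {1..n}} \<inter> rearrange n q -` {x} = {\<sigma>. \<sigma> permutes {1..n} \<and> rearrange n q \<sigma> = x}"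
    by auto
  then show ?thesis
    by (simp add: shuffle_pmf_def pmf_map measure_pmf_of_set[OF perms_nonempty finite_perms] card_perms)
qed

lemma pmf_shuffle_sym:
  assumes "q \<in> vectors n" "x \<in> vectors n"
  shows "pmf (shuffle_pmf n q) x = pmf (shuffle_pmf n x) q"
proof -
  let ?A = "\<lambda>y z. {\<sigma>. \<sigma> permutes {1..n} \<and> rearrange n y \<sigma> = z}"
  have inv: "rearrange n y (inv \<sigma>) = z"
    if "\<sigma> permutes {1..n}" "rearrange n z \<sigma> = y" "z \<in> vectors n" for \<sigma> and y z :: "nat \<Rightarrow> 'a"
  proof (rule PiE_ext[of _ "{1..n}" "\<lambda>_. UNIV"])
    fix i assume i: "i \<in> {1..n}"
    have "inv \<sigma> i \<in> {1..n}" using permutes_in_image[OF permutes_inv[OF that(1)]] i by simp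
    then show "rearrange n y (inv \<sigma>) i = z i"
      using that(1,2) i permutes_inverses(1)[OF that(1)] by (auto simp: rearrange_def)
  qed (use that(3) rearrange_in_vectors[of n y "inv \<sigma>"] in \<open>simp_all add: vectors_def\<close>)
  have "bij_betw inv (?A q x) (?A x q)"
    by (rule bij_betw_byWitness[where f' = inv])
       (use inv assms in \<open>auto simp: permutes_inv permutes_inv_inv\<close>)
  then show ?thesis by (simp add: pmf_shuffle bij_betw_same_card)
qed

text \<open>Vectors with the same multiset of entries are rearrangements of each other, and composing a uniform
  permutation with a fixed one does not change its law.\<close>

lemma pmf_shuffle_same_type:
  assumes "image_mset q (mset_set {1..n}) = image_mset q' (mset_set {1..n})"
  shows "pmf (shuffle_pmf n q) x = pmf (shuffle_pmf n q') x"
proof -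
  let ?A = "\<lambda>y z. {\<sigma>. \<sigma> permutes {1..n} \<and> rearrange n y \<sigma> = z}"
  have le: "card (?A q x) \<le> card (?A q' x)"
    if eq: "image_mset q (mset_set {1..n}) = image_mset q' (mset_set {1..n})" for q q' :: "nat \<Rightarrow> 'a"
  proof -
    obtain \<tau> where t: "\<tau> permutes {1..n}" "\<forall>i\<in>{1..n}. q i = q' (\<tau> i)"
      using image_mset_eq_implies_permutes[OF _ eq] by auto
    show ?thesis
    proof (rule card_inj_on_le[where f = "\<lambda>\<sigma>. \<tau> \<circ> \<sigma>"])
      show "inj_on (\<lambda>\<sigma>. \<tau> \<circ> \<sigma>) (?A q x)"
        using permutes_inj[OF t(1)] by (auto simp: inj_on_def fun_eq_iff dest: injD)
      show "(\<lambda>\<sigma>. \<tau> \<circ> \<sigma>) ` (?A q x)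
          \<subseteq> (?A q' x)"
      proof safe
        fix \<sigma> assume s: "\<sigma> permutes {1..n}"
        then show "(\<tau> \<circ> \<sigma>) permutes {1..n}" using t(1) by (rule permutes_compose)
        show "rearrange n q' (\<tau> \<circ> \<sigma>) = rearrange n q \<sigma>"
          using t(2) permutes_in_image[OF s] by (fastforce simp: rearrange_def restrict_def fun_eq_iff)
      qed
      show "finite (?A q' x)"
        using finite_perms by (rule finite_subset[rotated]) auto
    qed
  qed
  show ?thesis using le[OF assms] le[OF assms[symmetric]] by (simp add: pmf_shuffle)
qed

text \<open>The type of a vector, its multiset of entries, is determined by \<open>CARD('a)\<close> multiplicities
  between \<open>0\<close> and \<open>n\<close>.\<close>

lemma card_types:
  "card ((\<lambda>q :: nat \<Rightarrow> 'a::finite. image_mset q (mset_set {1..n})) ` vectors n) \<le> (n + 1) ^ CARD('a)"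
proof -
  let ?T = "(\<lambda>q :: nat \<Rightarrow> 'a. image_mset q (mset_set {1..n})) ` vectors n"
  have "card ?T \<le> card (UNIV \<rightarrow>\<^sub>E {0..n} :: ('a \<Rightarrow> nat) set)"
  proof (rule card_inj_on_le[where f = count])
    show "inj_on count ?T" by (simp add: inj_on_def multiset_eq_iff)
    show "count ` ?T \<subseteq> UNIV \<rightarrow>\<^sub>E {0..n}"
    proof safe
      fix q :: "nat \<Rightarrow> 'a" and a
      have "count (image_mset q (mset_set {1..n})) a \<le> size (image_mset q (mset_set {1..n}))"
        by (rule count_le_size)
      then show "count (image_mset q (mset_set {1..n})) a \<in> {0..n}" by simp
    qed auto
    show "finite (UNIV \<rightarrow>\<^sub>E {0..n} :: ('a \<Rightarrow> nat) set)" by (intro finite_PiE) auto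
  qed
  then show ?thesis by (simp add: card_PiE Suc_eq_plus1)
qed

text \<open>Within one type the law of the rearrangement does not depend on \<open>q\<close>, and the probability to move from \<open>q\<close> to \<open>x\<close>
  equals that to move from \<open>x\<close> to \<open>q\<close>. So each type contributes at most \<open>1\<close>.\<close>

lemma sum_collision_probability:
  "(\<Sum>q\<in>(vectors n :: (nat \<Rightarrow> 'a::finite) set). \<Sum>x\<in>vectors n. (pmf (shuffle_pmf n q) x)\<^sup>2)
    \<le> (real n + 1) ^ CARD('a)"
proof -
  let ?type = "\<lambda>q :: nat \<Rightarrow> 'a. image_mset q (mset_set {1..n})"
  let ?V = "vectors n :: (nat \<Rightarrow> 'a) set"
  let ?P = "\<lambda>q. pmf (shuffle_pmf n q)"
  have P1: "(\<Sum>x\<in>A. ?P q x) \<le> 1" if "A \<subseteq> ?V" for A q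
  proof -
    have "(\<Sum>x\<in>A. ?P q x) = measure_pmf.prob (shuffle_pmf n q) A"
      using that finite_vectors finite_subset by (subst measure_measure_pmf_finite) auto
    then show ?thesis by simp
  qed
  have "(\<Sum>q | q \<in> ?V \<and> ?type q = t. \<Sum>x\<in>?V. (?P q x)\<^sup>2) \<le> 1" if t: "t \<in> ?type ` ?V" for t
  proof -
    obtain q0 where q0: "q0 \<in> ?V" "?type q0 = t" using t by auto
    have "(\<Sum>q | q \<in> ?V \<and> ?type q = t. \<Sum>x\<in>?V. (?P q x)\<^sup>2) =
        (\<Sum>q | q \<in> ?V \<and> ?type q = t. \<Sum>x\<in>?V. ?P q0 x * ?P x q)"
    proof (intro sum.cong refl)
      fix q x assume "q \<in> {q \<in> ?V. ?type q = t}" "x \<in> ?V"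
      then show "(?P q x)\<^sup>2 = ?P q0 x * ?P x q"
        using pmf_shuffle_same_type[of q n q0 x] pmf_shuffle_sym[of q n x] q0
        by (simp add: power2_eq_square)
    qed
    also have "\<dots> = (\<Sum>x\<in>?V. ?P q0 x * (\<Sum>q | q \<in> ?V \<and> ?type q = t. ?P x q))"
      by (subst sum.swap) (simp add: sum_distrib_left)
    also have "\<dots> \<le> (\<Sum>x\<in>?V. ?P q0 x * 1)"
      by (intro sum_mono mult_left_mono P1) auto
    also have "\<dots> \<le> 1" using P1[of ?V q0] by simp
    finally show ?thesis .
  qed
  then have "(\<Sum>t\<in>?type ` ?V. \<Sum>q | q \<in> ?V \<and> ?type q = t. \<Sum>x\<in>?V. (?P q x)\<^sup>2) \<le> (\<Sum>t\<in>?type ` ?V. 1)"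
    by (rule sum_mono)
  also have "\<dots> \<le> real ((n + 1) ^ CARD('a))"
    using card_types[of n, where 'a='a] by (simp only: sum_constant mult_1_right of_nat_le_iff)
  finally show ?thesis
    by (subst sum.image_gen[OF finite_vectors, of _ _ ?type]) (simp add: add.commute)
qed

lemma second_moment:
  "(\<Sum>q\<in>(vectors n :: (nat \<Rightarrow> 'a::{ab_group_add,finite}) set).
      \<Sum>\<xi>\<in>dual_vectors n. (norm (char_fun n (shuffle_pmf n q) \<xi>))\<^sup>2)
    \<le> real CARD('a) ^ n * (real n + 1) ^ CARD('a)"
proof -
  have "(\<Sum>q\<in>(vectors n :: (nat \<Rightarrow> 'a) set). \<Sum>\<xi>\<in>dual_vectors n. (norm (char_fun n (shuffle_pmf n q) \<xi>))\<^sup>2) =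
      real CARD('a) ^ n * (\<Sum>q\<in>vectors n. \<Sum>x\<in>(vectors n :: (nat \<Rightarrow> 'a) set). (pmf (shuffle_pmf n q) x)\<^sup>2)"
    by (simp add: parseval[OF set_shuffle_pmf] sum_distrib_left)
  then show ?thesis using sum_collision_probability[of n, where 'a='a]
    by (simp add: mult_left_mono)
qed

section \<open>Comparison with the uniform law\<close>

definition trivial_pair :: "nat \<Rightarrow> (nat \<Rightarrow> 'a::ab_group_add) \<Rightarrow> (nat \<Rightarrow> 'a \<Rightarrow> complex) \<Rightarrow> bool" where
  "trivial_pair n q \<xi> \<longleftrightarrow> (\<forall>i\<in>{1..n}. \<forall>i'\<in>{1..n}. \<forall>j\<in>{1..n}. \<forall>j'\<in>{1..n}. \<xi> i (q j - q j') = \<xi> i' (q j - q j'))"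

definition diff_group :: "nat \<Rightarrow> (nat \<Rightarrow> 'a::ab_group_add) \<Rightarrow> 'a set" where
  "diff_group n q = group_closure ((\<lambda>i. q i - q n) ` {1..<n})"

lemma is_subgroup_closure: "is_subgroup (group_closure S)"
  by (auto simp: is_subgroup_def intro: group_closure.diff)

lemma subgroup_sum:
  assumes "is_subgroup H" "\<And>k. k \<in> A \<Longrightarrow> f k \<in> H"
  shows "(\<Sum>k\<in>A. f k) \<in> H"
  using assms(2)
  by (induction A rule: infinite_finite_induct)
     (use assms(1) in \<open>auto simp: is_subgroup_add is_subgroup_def[of H]\<close>)

lemma diff_in_diff_group:
  assumes "j \<in> {1..n}" "j' \<in> {1..n}"
  shows "q j - q j' \<in> diff_group n q"
proof -
  have 1: "q i - q n \<in> diff_group n q" if "i \<in> {1..n}" for i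
  proof (cases "i = n")
    case False
    then show ?thesis using that unfolding diff_group_def by (intro group_closure.base) auto
  qed (simp add: diff_group_def)
  have "q j - q j' = (q j - q n) - (q j' - q n)" by simp
  then show ?thesis using 1[OF assms(1)] 1[OF assms(2)] unfolding diff_group_def
    by (metis group_closure.diff)
qed

text \<open>Since \<open>MinC\<close> is the coset of \<open>q n\<close> modulo the group of differences, its \<open>d\<close>-fold multiple is again a
  coset; any deviation can be put into one of the \<open>d \<ge> 1\<close> summands.\<close>

lemma set_multiple_MinC:
  assumes "1 \<le> d"
  shows "x \<in> set_multiple d (MinC n q) \<longleftrightarrow> x - nat_scale d (q n) \<in> diff_group n q"
proof
  have scale: "nat_scale d v = (\<Sum>k=1..d. v)" for v :: 'a
    unfolding nat_scale_def
    by (rule sum.reindex_bij_witness[of _ "\<lambda>k. k - 1" Suc]) (auto simp: One_nat_def)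
  {
    assume "x \<in> set_multiple d (MinC n q)"
    then obtain g where g: "x = (\<Sum>k=1..d. g k)" "\<forall>k\<in>{1..d}. g k \<in> MinC n q"
      by (auto simp: set_multiple_def)
    have "x - nat_scale d (q n) = (\<Sum>k=1..d. g k - q n)"
      by (simp add: g(1) scale sum_subtractf)
    also have "\<dots> \<in> diff_group n q"
      unfolding diff_group_def
      by (rule subgroup_sum[OF is_subgroup_closure]) (use g(2) in \<open>force simp: MinC_def\<close>)
    finally show "x - nat_scale d (q n) \<in> diff_group n q" .
  next
    assume x: "x - nat_scale d (q n) \<in> diff_group n q"
    define g where "g k = (if k = 1 then q n + (x - nat_scale d (q n)) else q n)" for k :: nat
    have "(\<Sum>k=1..d. g k) = (\<Sum>k=1..d. q n + (if k = 1 then x - nat_scale d (q n) else 0))"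
      by (intro sum.cong) (auto simp: g_def)
    also have "\<dots> = x" using assms by (simp add: sum.distrib scale)
    finally have "x = (\<Sum>k=1..d. g k)" ..
    moreover have "\<forall>k\<in>{1..d}. g k \<in> MinC n q"
      using x by (auto simp: g_def MinC_def diff_group_def intro: image_eqI[of _ _ 0])
    ultimately show "x \<in> set_multiple d (MinC n q)" unfolding set_multiple_def by blast
  }
qed

lemma R_set_iff:
  assumes "1 \<le> d"
  shows "r \<in> R_set n q d \<longleftrightarrow> r \<in> vectors n \<and> (\<forall>i\<in>{1..n}. r i - nat_scale d (q n) \<in> diff_group n q) \<and>
    vec_sum n r = nat_scale d (vec_sum n q)"
  unfolding R_set_def vectors_def using set_multiple_MinC[OF assms, of _ n q] by (auto simp: PiE_def)

text \<open>On the group of differences all entries of \<open>\<xi>\<close> are the same character, so the pairing of \<open>\<xi>\<close> with \<open>x - y\<close>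
  only sees the sum of the entries of \<open>x - y\<close>, which is \<open>0\<close>.\<close>

lemma trivial_pairing_eq:
  fixes q :: "nat \<Rightarrow> 'a::{ab_group_add,finite}"
  assumes \<xi>: "\<xi> \<in> dual_vectors n" and triv: "trivial_pair n q \<xi>"
    and diff: "\<And>i. i \<in> {1..n} \<Longrightarrow> x i - y i \<in> diff_group n q" and sum: "vec_sum n x = vec_sum n y"
  shows "pairing n \<xi> x = pairing n \<xi> y"
proof (cases "n = 0")
  case False
  then have n: "1 \<in> {1..n}" "n \<in> {1..n}" by auto
  have d: "\<xi> i \<in> dual" if "i \<in> {1..n}" for i using \<xi> that by (auto simp: dual_vectorsD)
  have agree: "\<xi> i v = \<xi> 1 v" if "i \<in> {1..n}" "v \<in> diff_group n q" for i v
    using that(2) unfolding diff_group_def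
  proof (induction v rule: group_closure.induct)
    case (base v)
    show ?case
    proof (cases "v = 0")
      case True
      then show ?thesis using dual_0[OF d[OF that(1)]] dual_0[OF d[OF n(1)]] by simp
    next
      case False
      then obtain j where "v = q j - q n" "j \<in> {1..n}" using base by auto
      then show ?thesis using triv n(1) that(1) n(2) unfolding trivial_pair_def by blast
    qed
  next
    case (diff s t)
    then show ?case using d[OF that(1)] d[OF n(1)] by (simp add: dual_diff)
  qed
  have "pairing n \<xi> x = (\<Prod>i\<in>{1..n}. \<xi> i (y i) * \<xi> 1 (x i - y i))"
    unfolding pairing_def
  proof (intro prod.cong refl)
    fix i assume i: "i \<in> {1..n}"
    have "\<xi> i (x i) = \<xi> i (y i + (x i - y i))" by simp
    also have "\<dots> = \<xi> i (y i) * \<xi> i (x i - y i)" by (rule dual_add[OF d[OF i]])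
    finally show "\<xi> i (x i) = \<xi> i (y i) * \<xi> 1 (x i - y i)" using agree[OF i diff[OF i]] by simp
  qed
  also have "\<dots> = pairing n \<xi> y * (\<Prod>i\<in>{1..n}. \<xi> 1 (x i - y i))"
    by (simp add: pairing_def prod.distrib)
  also have "(\<Prod>i\<in>A. \<xi> 1 (x i - y i)) = \<xi> 1 (\<Sum>i\<in>A. x i - y i)" if "finite A" for A
    using that d[OF n(1)] by (induction A rule: finite_induct) (auto simp: dual_0 dual_add)
  then have "(\<Prod>i\<in>{1..n}. \<xi> 1 (x i - y i)) = \<xi> 1 (vec_sum n x - vec_sum n y)"
    by (simp add: vec_sum_def sum_subtractf)
  also have "\<dots> = 1" using sum dual_0[OF d[OF n(1)]] by simp
  finally show ?thesis by simp
qed (simp add: pairing_def)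

text \<open>Both sides are the value of the pairing at the single vector \<open>d q\<close>: it is constant on \<open>R(q, d)\<close>, and
  also on the rearrangements of \<open>q\<close>.\<close>

lemma char_fun_uniform_trivial:
  fixes q :: "nat \<Rightarrow> 'a::{ab_group_add,finite}"
  assumes \<xi>: "\<xi> \<in> dual_vectors n" and triv: "trivial_pair n q \<xi>" and d: "1 \<le> d"
  shows "char_fun n (U_pmf n q d) \<xi> = char_fun n (shuffle_pmf n q) \<xi> ^ d"
proof -
  define r0 where "r0 = (\<lambda>i\<in>{1..n}. nat_scale d (q i))"
  have scale: "nat_scale d v = (\<Sum>k<d. v)" for v :: 'a by (simp add: nat_scale_def)
  have r0: "r0 i - nat_scale d (q n) \<in> diff_group n q" if "i \<in> {1..n}" for i
  proof -
    have "r0 i - nat_scale d (q n) = (\<Sum>k<d. q i - q n)"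
      using that by (simp add: r0_def scale sum_subtractf)
    also have "\<dots> \<in> diff_group n q"
      using diff_in_diff_group[of i n n q] that unfolding diff_group_def
      by (intro subgroup_sum[OF is_subgroup_closure]) auto
    finally show ?thesis .
  qed
  have s0: "vec_sum n r0 = nat_scale d (vec_sum n q)"
    by (simp add: vec_sum_def r0_def scale sum.swap[of _ "{1..n}"])
  have "pairing n \<xi> r = pairing n \<xi> r0" if "r \<in> R_set n q d" for r
  proof (rule trivial_pairing_eq[OF \<xi> triv])
    show "vec_sum n r = vec_sum n r0" using that s0 by (simp add: R_set_iff[OF d])
    fix i assume i: "i \<in> {1..n}"
    then have "r i - nat_scale d (q n) \<in> diff_group n q" using that by (simp add: R_set_iff[OF d])
    then have "(r i - nat_scale d (q n)) - (r0 i - nat_scale d (q n)) \<in> diff_group n q"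
      using r0[OF i] unfolding diff_group_def by (rule group_closure.diff)
    then show "r i - r0 i \<in> diff_group n q" by simp
  qed
  then have U: "char_fun n (U_pmf n q d) \<xi> = pairing n \<xi> r0"
    using R_nonempty[of n q d] finite_R[of n q d]
    by (simp add: char_fun_def U_pmf_def expectation_pmf_of_set)
  have "pairing n \<xi> (rearrange n q \<sigma>) = pairing n \<xi> q" if s: "\<sigma> permutes {1..n}" for \<sigma>
  proof (rule trivial_pairing_eq[OF \<xi> triv])
    fix i assume "i \<in> {1..n}"
    then show "rearrange n q \<sigma> i - q i \<in> diff_group n q"
      using permutes_in_image[OF s, of i] by (simp add: rearrange_def diff_in_diff_group)
  next
    show "vec_sum n (rearrange n q \<sigma>) = vec_sum n q"
      unfolding vec_sum_def rearrange_def using sum.permute[OF s, of q] by (simp add: o_def)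
  qed
  then have "char_fun n (shuffle_pmf n q) \<xi> = pairing n \<xi> q"
    by (simp add: char_fun_shuffle_sum card_perms)
  moreover have "pairing n \<xi> r0 = (\<Prod>k<d. pairing n \<xi> q)"
    by (rule pairing_sum[OF _ \<xi>]) (auto simp: r0_def scale)
  ultimately show ?thesis using U by simp
qed

text \<open>Adding \<open>v = q j - q j'\<close> at position \<open>i\<close> and subtracting it at position \<open>i'\<close> permutes \<open>R(q, d)\<close> and multiplies the
  pairing by the constant \<open>\<xi> i v / \<xi> i' v\<close>, which differs from \<open>1\<close>.\<close>

lemma char_fun_uniform_nontrivial:
  fixes q :: "nat \<Rightarrow> 'a::{ab_group_add,finite}"
  assumes \<xi>: "\<xi> \<in> dual_vectors n" and triv: "\<not> trivial_pair n q \<xi>" and d: "1 \<le> d"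
  shows "char_fun n (U_pmf n q d) \<xi> = 0"
proof -
  obtain i i' j j' where I: "i \<in> {1..n}" "i' \<in> {1..n}" "j \<in> {1..n}" "j' \<in> {1..n}"
    and ne: "\<xi> i (q j - q j') \<noteq> \<xi> i' (q j - q j')"
    using triv unfolding trivial_pair_def by blast
  define v where "v = q j - q j'"
  have v: "v \<in> diff_group n q" using I by (simp add: v_def diff_in_diff_group)
  have ii: "i \<noteq> i'" using ne by auto
  have d1: "\<xi> i \<in> dual" "\<xi> i' \<in> dual" using \<xi> I by (auto simp: dual_vectorsD)
  have shift_R: "r(i := r i + w, i' := r i' - w) \<in> R_set n q d"
    if r: "r \<in> R_set n q d" and w: "w \<in> diff_group n q" for r w
  proof -
    have "r i + w - nat_scale d (q n) \<in> diff_group n q"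
      using group_closure_add[of "r i - nat_scale d (q n)" _ w] r w I(1)
      by (simp add: R_set_iff[OF d] diff_group_def diff_add_eq)
    moreover have "r i' - w - nat_scale d (q n) \<in> diff_group n q"
      using group_closure.diff[of "r i' - nat_scale d (q n)" _ w] r w I(2)
      by (simp add: R_set_iff[OF d] diff_group_def algebra_simps)
    moreover have "vec_sum n (r(i := r i + w, i' := r i' - w)) = vec_sum n r"
    proof -
      have "vec_sum n (r(i := r i + w, i' := r i' - w)) =
          (\<Sum>k=1..n. r k + ((if k = i then w else 0) - (if k = i' then w else 0)))"
        unfolding vec_sum_def using ii by (intro sum.cong) auto
      also have "\<dots> = vec_sum n r" using I by (simp add: vec_sum_def sum.distrib sum_subtractf)
      finally show ?thesis .
    qed
    moreover have "r(i := r i + w, i' := r i' - w) \<in> vectors n"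
      using r I by (auto simp: R_set_iff[OF d] vectors_def PiE_def extensional_def)
    ultimately show ?thesis using r ii by (simp add: R_set_iff[OF d])
  qed
  have pair_shift: "pairing n \<xi> (r(i := r i + v, i' := r i' - v)) = \<xi> i v * cnj (\<xi> i' v) * pairing n \<xi> r" for r
  proof -
    have "pairing n \<xi> (r(i := r i + v, i' := r i' - v)) =
        (\<Prod>k\<in>{1..n}. \<xi> k (r k) * ((if k = i then \<xi> i v else 1) * (if k = i' then cnj (\<xi> i' v) else 1)))"
      unfolding pairing_def using ii d1 by (intro prod.cong) (auto simp: dual_add dual_diff)
    then show ?thesis using I by (simp add: pairing_def prod.distrib)
  qed
  let ?R = "R_set n q d"
  have mv: "- v \<in> diff_group n q" using v by (simp add: diff_group_def)
  have "(\<Sum>r\<in>?R. pairing n \<xi> r) = (\<Sum>r\<in>?R. pairing n \<xi> (r(i := r i + v, i' := r i' - v)))"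
    by (rule sum.reindex_bij_witness[of _ "\<lambda>r. r(i := r i + v, i' := r i' - v)" "\<lambda>r. r(i := r i - v, i' := r i' + v)"])
       (use ii shift_R[OF _ v] shift_R[OF _ mv] in auto)
  also have "\<dots> = \<xi> i v * cnj (\<xi> i' v) * (\<Sum>r\<in>?R. pairing n \<xi> r)"
    by (simp add: pair_shift sum_distrib_left)
  finally have "(\<xi> i v * cnj (\<xi> i' v) - 1) * (\<Sum>r\<in>?R. pairing n \<xi> r) = 0"
    by (simp add: left_diff_distrib)
  moreover have "\<xi> i v * cnj (\<xi> i' v) \<noteq> 1"
  proof
    assume "\<xi> i v * cnj (\<xi> i' v) = 1"
    then have "\<xi> i v * (\<xi> i' v * cnj (\<xi> i' v)) = \<xi> i' v" by (simp add: mult.left_commute)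
    then show False using ne d1 by (simp add: dual_cnj_mult v_def)
  qed
  ultimately have "(\<Sum>r\<in>?R. pairing n \<xi> r) = 0" by simp
  then show ?thesis
    using R_nonempty[of n q d] finite_R[of n q d]
    by (simp add: char_fun_def U_pmf_def expectation_pmf_of_set)
qed

theorem d_inf_le_cubes:
  fixes q :: "nat \<Rightarrow> 'a::{ab_group_add,finite}"
  assumes d: "3 \<le> d"
  shows "d_inf (vectors n) (map_pmf (\<lambda>A. mat_act n A q) (A_pmf n d)) (U_pmf n q d) \<le>
    (\<Sum>\<xi> | \<xi> \<in> dual_vectors n \<and> \<not> trivial_pair n q \<xi>. (norm (char_fun n (shuffle_pmf n q) \<xi>)) ^ 3) / real CARD('a) ^ n"
proof -
  let ?X = "map_pmf (\<lambda>A. mat_act n A q) (A_pmf n d)" and ?Y = "U_pmf n q d"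
  let ?F = "\<lambda>\<xi>. char_fun n (shuffle_pmf n q) \<xi>"
  have d1: "1 \<le> d" using d by simp
  have X: "set_pmf ?X \<subseteq> vectors n" by (auto simp: mat_act_def vectors_def)
  have Y: "set_pmf ?Y \<subseteq> vectors n"
    using R_nonempty[of n q d] finite_R[of n q d] by (auto simp: U_pmf_def R_set_iff[OF d1])
  have "(\<Sum>\<xi>\<in>dual_vectors n. norm (char_fun n ?X \<xi> - char_fun n ?Y \<xi>)) \<le>
      (\<Sum>\<xi>\<in>dual_vectors n. if \<not> trivial_pair n q \<xi> then (norm (?F \<xi>)) ^ 3 else 0)"
  proof (rule sum_mono)
    fix \<xi> :: "nat \<Rightarrow> 'a \<Rightarrow> complex" assume \<xi>: "\<xi> \<in> dual_vectors n"
    have "norm (?F \<xi>) ^ d \<le> norm (?F \<xi>) ^ 3"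
      using d norm_char_fun_le_1[OF \<xi>] by (intro power_decreasing) auto
    then show "norm (char_fun n ?X \<xi> - char_fun n ?Y \<xi>) \<le> (if \<not> trivial_pair n q \<xi> then (norm (?F \<xi>)) ^ 3 else 0)"
      using char_fun_uniform_trivial[OF \<xi> _ d1] char_fun_uniform_nontrivial[OF \<xi> _ d1]
      by (auto simp: char_fun_A[OF \<xi>] norm_power)
  qed
  also have "\<dots> = (\<Sum>\<xi> | \<xi> \<in> dual_vectors n \<and> \<not> trivial_pair n q \<xi>. (norm (?F \<xi>)) ^ 3)"
    by (simp add: sum.inter_filter[OF finite_dual_vectors])
  finally show ?thesis
    by (intro order_trans[OF d_inf_le_fourier[OF X Y]] divide_right_mono) auto
qed

section \<open>Pairs with a large averaged permanent\<close>

lemma swap_bound_sets: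
  fixes b :: "nat \<Rightarrow> nat \<Rightarrow> complex"
  assumes \<delta>: "0 < \<delta>" "\<delta> \<le> 1"
    and fin: "finite I" "finite J" "card I = card J" "card I \<le> n"
    and b1: "\<And>i j. i \<in> I \<Longrightarrow> j \<in> J \<Longrightarrow> norm (b i j) = 1"
    and R: "R1 \<subseteq> I" "R2 \<subseteq> I" "R1 \<inter> R2 = {}" "s \<le> card R1" "s \<le> card R2"
    and r: "r \<le> n"
    and A: "\<And>i i'. i \<in> R1 \<Longrightarrow> i' \<in> R2 \<Longrightarrow> \<exists>A\<subseteq>J. \<exists>A'\<subseteq>J. r + 2 * s \<le> card A \<and>
              r + 2 * s \<le> card A' \<and> swap_gain \<delta> b (i, i') A A'"
  shows "norm (permanent_avg b I J) \<le> (1 - \<delta> * (r / n)\<^sup>2) ^ s"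
proof -
  have "\<exists>xs. set xs \<subseteq> R \<and> distinct xs \<and> length xs = s" if R: "R \<subseteq> I" "s \<le> card R" for R
  proof -
    obtain R' where R': "R' \<subseteq> R" "card R' = s" using obtain_subset_with_card_n[OF R(2)] by metis
    then have "finite R'" using R(1) fin(1) finite_subset by (meson subset_trans)
    then obtain xs where "set xs = R'" "distinct xs" using finite_distinct_list by blast
    then show ?thesis using R' distinct_card[of xs] by auto
  qed
  then obtain xs ys where xs: "set xs \<subseteq> R1" "distinct xs" "length xs = s"
    and ys: "set ys \<subseteq> R2" "distinct ys" "length ys = s"
    using R by metis
  have "norm (permanent_avg b I J) \<le> (1 - \<delta> * (r / n)\<^sup>2) ^ length (zip xs ys)"
  proof (rule swap_bound[OF \<delta> fin b1 _ _ r])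
    show "distinct (map fst (zip xs ys) @ map snd (zip xs ys))"
      using xs ys R by auto
    show "set (map fst (zip xs ys) @ map snd (zip xs ys)) \<subseteq> I"
      using xs ys R by auto
    fix p assume "p \<in> set (zip xs ys)"
    then have "fst p \<in> R1" "snd p \<in> R2" using xs ys set_zip_leftD set_zip_rightD
      by (metis prod.collapse subsetD)+
    then show "\<exists>A\<subseteq>J. \<exists>A'\<subseteq>J. r + 2 * length (zip xs ys) \<le> card A \<and>
              r + 2 * length (zip xs ys) \<le> card A' \<and> swap_gain \<delta> b p A A'"
      using A[of "fst p" "snd p"] xs ys by simp
  qed
  then show ?thesis using xs ys by simp
qed

text \<open>A uniform gain for all four-tuples that can gain at all. The type argument makes the group visible in
  the statement.\<close>

definition swap_gap :: "real \<Rightarrow> 'a::ab_group_add itself \<Rightarrow> bool" where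
  "swap_gap \<delta> _ \<longleftrightarrow> 0 < \<delta> \<and> \<delta> \<le> 1 \<and> (\<forall>\<xi>\<in>dual. \<forall>\<xi>'\<in>dual. \<forall>a a' :: 'a.
     \<xi> (a - a') \<noteq> \<xi>' (a - a') \<longrightarrow> norm (\<xi> a * \<xi>' a' + \<xi> a' * \<xi>' a) \<le> 2 * (1 - \<delta>))"

lemma norm_add_lt_2:
  fixes z w :: complex
  assumes "norm z = 1" "norm w = 1" "z \<noteq> w"
  shows "norm (z + w) < 2"
  using assms norm_triangle_eq[of z w] norm_triangle_ineq[of z w] by fastforce

text \<open>Two different numbers of modulus \<open>1\<close> have a sum of modulus less than \<open>2\<close>, and there are only finitely
  many four-tuples.\<close>

lemma ex_swap_gap: "\<exists>\<delta>. swap_gap \<delta> TYPE('a::{ab_group_add,finite})"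
proof -
  define Q where "Q = {(\<xi>,\<xi>',a,a') \<in> dual \<times> dual \<times> (UNIV :: 'a set) \<times> UNIV. \<xi> (a - a') \<noteq> \<xi>' (a - a')}"
  define g where "g = (\<lambda>(\<xi>,\<xi>',a,a' :: 'a). norm (\<xi> a * \<xi>' a' + \<xi> a' * \<xi>' a :: complex) / 2)"
  have fin: "finite Q" unfolding Q_def
    by (rule finite_subset[of _ "dual \<times> dual \<times> UNIV \<times> UNIV"]) (auto simp: finite_dual)
  have lt: "g x < 1" if "x \<in> Q" for x
  proof -
    obtain \<xi> \<xi>' a a' where x: "x = (\<xi>,\<xi>',a,a')" by (metis prod_cases4)
    have d: "\<xi> \<in> dual" "\<xi>' \<in> dual" "\<xi> (a - a') \<noteq> \<xi>' (a - a')" using that by (auto simp: Q_def x)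
    have "\<xi> a * \<xi>' a' \<noteq> \<xi> a' * \<xi>' a"
    proof
      assume "\<xi> a * \<xi>' a' = \<xi> a' * \<xi>' a"
      then have "(\<xi> a * cnj (\<xi> a')) * (\<xi>' a' * cnj (\<xi>' a')) = (\<xi>' a * cnj (\<xi>' a')) * (\<xi> a' * cnj (\<xi> a'))"
        by (simp add: mult_ac)
      then show False using d by (simp add: dual_cnj_mult dual_diff)
    qed
    then show ?thesis unfolding x g_def using d
      by (auto intro!: norm_add_lt_2 simp: norm_mult norm_dual)
  qed
  define \<delta> where "\<delta> = Min (insert 1 ((\<lambda>x. 1 - g x) ` Q))"
  have "0 < \<delta>" unfolding \<delta>_def using fin lt by (subst Min_gr_iff) auto
  moreover have "\<delta> \<le> 1" unfolding \<delta>_def using fin by (intro Min_le) auto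
  moreover have "\<delta> \<le> 1 - g x" if "x \<in> Q" for x unfolding \<delta>_def using fin that by (intro Min_le) auto
  then have "norm (\<xi> a * \<xi>' a' + \<xi> a' * \<xi>' a) \<le> 2 * (1 - \<delta>)"
    if "\<xi> \<in> dual" "\<xi>' \<in> dual" "\<xi> (a - a') \<noteq> \<xi>' (a - a')" for \<xi> \<xi>' and a a' :: 'a
  proof -
    have "(\<xi>,\<xi>',a,a') \<in> Q" using that by (simp add: Q_def)
    then have "\<delta> \<le> 1 - g (\<xi>,\<xi>',a,a')" by fact
    then show ?thesis by (simp add: g_def)
  qed
  ultimately show ?thesis unfolding swap_gap_def by blast
qed

definition coset_of :: "'a::ab_group_add set \<Rightarrow> 'a \<Rightarrow> 'a set" where
  "coset_of H a0 = {a. a - a0 \<in> H}"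

definition dual_coset :: "'a::ab_group_add set \<Rightarrow> ('a \<Rightarrow> complex) \<Rightarrow> ('a \<Rightarrow> complex) set" where
  "dual_coset H \<xi>0 = {\<psi>\<in>dual. \<forall>h\<in>H. \<psi> h = \<xi>0 h}"

lemma card_coset_of: "card (coset_of H (a0 :: 'a::{ab_group_add,finite})) = card H"
proof (rule bij_betw_same_card[of "\<lambda>a. a - a0"])
  show "bij_betw (\<lambda>a. a - a0) (coset_of H a0) H"
    by (rule bij_betw_byWitness[where f' = "\<lambda>a. a + a0"]) (auto simp: coset_of_def)
qed

lemma sum_coset_of: "(\<Sum>a\<in>coset_of H a0. f (a - a0)) = (\<Sum>h\<in>H. f (h :: 'a::ab_group_add))"
  by (rule sum.reindex_bij_witness[of _ "\<lambda>h. h + a0" "\<lambda>a. a - a0"]) (auto simp: coset_of_def)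

lemma dual_coset_shift:
  assumes "\<xi>0 \<in> dual" "\<psi> \<in> dual_coset H \<xi>0"
  shows "(\<lambda>a. \<psi> a * cnj (\<xi>0 (a :: 'a::{ab_group_add,finite}))) \<in> ann H"
  using assms by (auto simp: dual_coset_def ann_def dual_mult dual_cnj dual_cnj_mult)

lemma ann_shift:
  assumes "\<xi>0 \<in> dual" "\<psi> \<in> ann H"
  shows "(\<lambda>a. \<psi> a * \<xi>0 (a :: 'a::{ab_group_add,finite})) \<in> dual_coset H \<xi>0"
  using assms by (auto simp: dual_coset_def ann_def dual_mult)

lemma dual_cnj_mult': "\<xi> \<in> dual \<Longrightarrow> cnj (\<xi> (a :: 'a::{ab_group_add,finite})) * \<xi> a = 1"
  using dual_cnj_mult[of \<xi> a] by (simp add: mult.commute)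

lemma sum_dual_coset:
  assumes "\<xi>0 \<in> dual"
  shows "(\<Sum>\<psi>\<in>dual_coset H \<xi>0. f (\<lambda>a. \<psi> a * cnj (\<xi>0 a))) = (\<Sum>\<psi>\<in>ann (H :: 'a::{ab_group_add,finite} set). f \<psi>)"
  by (rule sum.reindex_bij_witness[of _ "\<lambda>\<psi> a. \<psi> a * \<xi>0 a" "\<lambda>\<psi> a. \<psi> a * cnj (\<xi>0 a)"])
     (use dual_coset_shift[OF assms] ann_shift[OF assms] in
       \<open>auto simp: mult.assoc dual_cnj_mult[OF assms] dual_cnj_mult'[OF assms]\<close>)

lemma card_dual_coset:
  assumes "\<xi>0 \<in> dual"
  shows "card (dual_coset H \<xi>0) = card (ann (H :: 'a::{ab_group_add,finite} set))"
  using sum_dual_coset[OF assms, of "\<lambda>_. 1 :: nat" H] by simp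

lemma finite_dual_coset: "finite (dual_coset H (\<xi>0 :: 'a::{ab_group_add,finite} \<Rightarrow> complex))"
  by (rule finite_subset[OF _ finite_dual]) (auto simp: dual_coset_def)

lemma card_coset_mult_card_dual_coset:
  fixes H :: "'a::{ab_group_add,finite} set"
  assumes "is_subgroup H" "\<xi>0 \<in> dual"
  shows "card (coset_of H a0) * card (dual_coset H \<xi>0) = CARD('a)"
  using card_ann[OF assms(1)] by (simp add: card_coset_of card_dual_coset[OF assms(2)])

definition popular :: "nat \<Rightarrow> nat \<Rightarrow> (nat \<Rightarrow> 'x) \<Rightarrow> 'x set" where
  "popular n T x = {a. T \<le> card {i\<in>{1..n}. x i = a}}"

lemma card_off_popular:
  assumes "finite X" "x \<in> {1..n} \<rightarrow>\<^sub>E X"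
  shows "card (off n (popular n T x) x) \<le> card X * T"
proof -
  have "off n (popular n T x) x \<subseteq> (\<Union>a\<in>X - popular n T x. {i\<in>{1..n}. x i = a})"
    using assms(2) by (auto simp: off_def PiE_def)
  then have "card (off n (popular n T x) x) \<le> card (\<Union>a\<in>X - popular n T x. {i\<in>{1..n}. x i = a})"
    using assms(1) by (intro card_mono) auto
  also have "\<dots> \<le> (\<Sum>a\<in>X - popular n T x. card {i\<in>{1..n}. x i = a})"
    using assms(1) by (intro card_UN_le) auto
  also have "\<dots> \<le> (\<Sum>a\<in>X - popular n T x. T)"
    by (intro sum_mono) (auto simp: popular_def)
  also have "\<dots> \<le> card X * T" using assms(1) by (simp add: card_mono)
  finally show ?thesis .
qed

lemma popular_nonempty:
  assumes "finite X" "x \<in> {1..n} \<rightarrow>\<^sub>E X" "card X * T < n"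
  shows "popular n T x \<noteq> {}"
proof
  assume "popular n T x = {}"
  then have "off n (popular n T x) x = {1..n}" by (auto simp: off_def)
  then show False using card_off_popular[OF assms(1,2), of T] assms(3) by simp
qed

lemma popular_subset:
  assumes "x \<in> {1..n} \<rightarrow>\<^sub>E X" "0 < T"
  shows "popular n T x \<subseteq> X"
proof
  fix a assume "a \<in> popular n T x"
  then have "0 < card {i\<in>{1..n}. x i = a}"
    using assms(2) unfolding popular_def mem_Collect_eq by (rule order.strict_trans2[rotated])
  then have "{i\<in>{1..n}. x i = a} \<noteq> {}" by (metis card.empty less_irrefl)
  then show "a \<in> X" using assms(1) by (auto simp: PiE_def)
qed

lemma le_if_CARD_mult_less:
  assumes "CARD('a::finite) * (r + 2 * s) < n"
  shows "r + 2 * s \<le> n" "r \<le> n"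
proof -
  have "1 * (r + 2 * s) \<le> CARD('a) * (r + 2 * s)"
    by (intro mult_le_mono1) (simp add: Suc_le_eq One_nat_def)
  then show "r + 2 * s \<le> n" using assms by (metis le_trans less_imp_le mult_1)
  then show "r \<le> n" by simp
qed

text \<open>Two popular characters that differ on a difference of two popular group elements would
  provide enough row pairs for the swap bound, so all popular characters agree on the group \<open>H\<close>
  generated by these differences. This puts the popular values into a coset of \<open>H\<close> and into a coset of its
  annihilator, whose cardinalities multiply to \<open>CARD('a)\<close>. Unless the numbers of popular values have a
  smaller product, they fill both cosets; then every exceptional row (or column) forms a gaining pair with a row (or column) carrying
  the popular value \<open>\<xi>0\<close> (or \<open>a0\<close>), so there are fewer than \<open>s\<close> of them.\<close>

theorem pair_structure:
  fixes q :: "nat \<Rightarrow> 'a::{ab_group_add,finite}" and \<xi> :: "nat \<Rightarrow> 'a \<Rightarrow> complex"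
  assumes gap: "swap_gap \<delta> TYPE('a)"
    and q: "q \<in> vectors n" and \<xi>: "\<xi> \<in> dual_vectors n"
    and T: "CARD('a) * (r + 2 * s) < n" "0 < r + 2 * s"
    and large: "\<not> norm (permanent_avg (\<lambda>i j. \<xi> i (q j)) {1..n} {1..n}) \<le> (1 - \<delta> * (r / n)\<^sup>2) ^ s"
  defines "S \<equiv> popular n (r + 2 * s) q" and "E \<equiv> popular n (r + 2 * s) \<xi>"
  obtains "card S * card E < CARD('a)"
    | H a0 \<xi>0 where "is_subgroup H" "\<xi>0 \<in> dual"
        "card (off n (coset_of H a0) q) \<le> s" "card (off n (dual_coset H \<xi>0) \<xi>) \<le> s"
proof -
  let ?T = "r + 2 * s"
  let ?b = "\<lambda>i j. \<xi> i (q j)"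
  have \<delta>: "0 < \<delta>" "\<delta> \<le> 1" using gap by (auto simp: swap_gap_def)
  have gapD: "norm (\<psi> a * \<psi>' a' + \<psi> a' * \<psi>' a) \<le> 2 * (1 - \<delta>)"
    if "\<psi> \<in> dual" "\<psi>' \<in> dual" "\<psi> (a - a') \<noteq> \<psi>' (a - a')" for \<psi> \<psi>' and a a' :: 'a
    using gap that unfolding swap_gap_def by blast
  note Tn = le_if_CARD_mult_less(1)[OF T(1)]
  have q': "q \<in> {1..n} \<rightarrow>\<^sub>E UNIV" using q by (simp add: vectors_def)
  have dual: "\<xi> i \<in> dual" if "i \<in> {1..n}" for i using \<xi> that by (simp add: dual_vectorsD)
  have b1: "norm (\<xi> i (q j)) = 1" if "i \<in> {1..n}" for i j using dual[OF that] by (rule norm_dual)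
  have SE: "S \<noteq> {}" "E \<noteq> {}" "E \<subseteq> dual"
    using popular_nonempty[OF _ q', of ?T] popular_nonempty[OF finite_dual \<xi>, of ?T]
      popular_subset[OF \<xi> T(2)] T(1) by (auto simp: S_def E_def card_dual)
  have finE: "finite E" using SE(3) finite_dual finite_subset by blast
  let ?J = "\<lambda>a. {j\<in>{1..n}. q j = a}" and ?I = "\<lambda>\<psi>. {i\<in>{1..n}. \<xi> i = \<psi>}"
  have JS: "?T \<le> card (?J a)" if "a \<in> S" for a using that by (simp add: S_def popular_def)
  have IE: "?T \<le> card (?I \<psi>)" if "\<psi> \<in> E" for \<psi> using that by (simp add: E_def popular_def)
  have no_rows: "card R1 < s"
    if R: "R1 \<subseteq> {1..n}" "\<psi>' \<in> E" "\<And>i. i \<in> R1 \<Longrightarrow> \<exists>a\<in>S. \<exists>a'\<in>S. \<xi> i (a - a') \<noteq> \<psi>' (a - a')" for R1 \<psi>'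
  proof (rule ccontr)
    assume "\<not> card R1 < s"
    then have "norm (permanent_avg ?b {1..n} {1..n}) \<le> (1 - \<delta> * (r / n)\<^sup>2) ^ s"
    proof (intro swap_bound_sets[OF \<delta>, where ?R1.0 = R1 and ?R2.0 = "?I \<psi>'"])
      show "R1 \<inter> ?I \<psi>' = {}" using R(3) by fastforce
      show "s \<le> card (?I \<psi>')" using IE[OF R(2)] by simp
      fix i i' assume i: "i \<in> R1" "i' \<in> ?I \<psi>'"
      obtain a a' where a: "a \<in> S" "a' \<in> S" "\<xi> i (a - a') \<noteq> \<psi>' (a - a')" using R(3)[OF i(1)] by blast
      have "swap_gain \<delta> ?b (i, i') (?J a) (?J a')"
        using gapD[of "\<xi> i" \<psi>' a a'] a(3) i R(1) dual[of i] dual[of i'] by (auto simp: swap_gain_def)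
      then show "\<exists>A\<subseteq>{1..n}. \<exists>A'\<subseteq>{1..n}. r + 2 * s \<le> card A \<and> r + 2 * s \<le> card A' \<and> swap_gain \<delta> ?b (i, i') A A'"
        using JS[OF a(1)] JS[OF a(2)] by (intro exI[of _ "?J a"] exI[of _ "?J a'"] conjI) auto
    qed (use R(1) b1 Tn in auto)
    then show False using large by simp
  qed
  have no_cols: "card R1 < s"
    if R: "R1 \<subseteq> {1..n}" "a' \<in> S" "\<And>j. j \<in> R1 \<Longrightarrow> \<exists>\<psi>\<in>E. \<exists>\<psi>'\<in>E. \<psi> (q j - a') \<noteq> \<psi>' (q j - a')" for R1 a'
  proof (rule ccontr)
    assume "\<not> card R1 < s"
    then have "norm (permanent_avg (\<lambda>j i. \<xi> i (q j)) {1..n} {1..n}) \<le> (1 - \<delta> * (r / n)\<^sup>2) ^ s"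
    proof (intro swap_bound_sets[OF \<delta>, where ?R1.0 = R1 and ?R2.0 = "?J a'"])
      show "R1 \<inter> ?J a' = {}"
      proof (rule ccontr)
        assume "R1 \<inter> ?J a' \<noteq> {}"
        then obtain j where "j \<in> R1" "q j = a'" by auto
        then show False using R(3)[of j] SE(3) by (auto simp: dual_0 subset_iff)
      qed
      show "s \<le> card (?J a')" using JS[OF R(2)] by simp
      fix j j' assume j: "j \<in> R1" "j' \<in> ?J a'"
      obtain \<psi> \<psi>' where p: "\<psi> \<in> E" "\<psi>' \<in> E" "\<psi> (q j - a') \<noteq> \<psi>' (q j - a')" using R(3)[OF j(1)] by blast
      have "swap_gain \<delta> (\<lambda>j i. \<xi> i (q j)) (j, j') (?I \<psi>) (?I \<psi>')"
        using gapD[of \<psi> \<psi>' "q j" a'] p SE(3) j by (auto simp: swap_gain_def mult.commute)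
      then show "\<exists>A\<subseteq>{1..n}. \<exists>A'\<subseteq>{1..n}. r + 2 * s \<le> card A \<and> r + 2 * s \<le> card A' \<and>
          swap_gain \<delta> (\<lambda>j i. \<xi> i (q j)) (j, j') A A'"
        using IE[OF p(1)] IE[OF p(2)] by (intro exI[of _ "?I \<psi>"] exI[of _ "?I \<psi>'"] conjI) auto
    qed (use R(1) b1 Tn in auto)
    then show False using large permanent_avg_transpose[of "{1..n}" "{1..n}" ?b] by simp
  qed
  have agree: "\<psi> (a - a') = \<psi>' (a - a')" if "\<psi> \<in> E" "\<psi>' \<in> E" "a \<in> S" "a' \<in> S" for \<psi> \<psi>' a a'
  proof (rule ccontr)
    assume "\<psi> (a - a') \<noteq> \<psi>' (a - a')"
    then have "card (?I \<psi>) < s" using that by (intro no_rows[of _ \<psi>']) auto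
    then show False using IE[OF that(1)] by simp
  qed
  define H where "H = group_closure {a - a' | a a'. a \<in> S \<and> a' \<in> S}"
  have H: "is_subgroup H" unfolding H_def by (rule is_subgroup_closure)
  obtain a0 \<xi>0 where a0: "a0 \<in> S" and \<xi>0: "\<xi>0 \<in> E" using SE by auto
  have \<xi>0d: "\<xi>0 \<in> dual" using \<xi>0 SE by auto
  have Ssub: "S \<subseteq> coset_of H a0"
    using a0 by (auto simp: coset_of_def H_def intro!: group_closure.base)
  have agreeH: "\<psi> h = \<xi>0 h" if "\<psi> \<in> E" "h \<in> H" for \<psi> h
    using that(2) unfolding H_def
  proof (induction h rule: group_closure.induct)
    case (base h)
    then show ?case using agree[OF that(1) \<xi>0] that(1) SE(3) \<xi>0d by (auto simp: dual_0 subset_iff)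
  next
    case (diff h h')
    then show ?case using that(1) SE(3) \<xi>0d by (auto simp: dual_diff subset_iff)
  qed
  then have Esub: "E \<subseteq> dual_coset H \<xi>0" using SE(3) by (auto simp: dual_coset_def)
  show ?thesis
  proof (cases "card S * card E < CARD('a)")
    case True
    then show ?thesis by (rule that(1))
  next
    case False
    have le: "card S \<le> card (coset_of H a0)" "card E \<le> card (dual_coset H \<xi>0)"
      using Ssub Esub finite_dual_coset by (auto intro!: card_mono)
    have prod: "card (coset_of H a0) * card (dual_coset H \<xi>0) \<le> card S * card E"
      using False by (simp add: card_coset_mult_card_dual_coset[OF H \<xi>0d])
    have pos: "0 < card S" "0 < card E" using SE finE by (auto simp: card_gt_0_iff)
    have "card S = card (coset_of H a0)"
    proof (rule ccontr)
      assume "card S \<noteq> card (coset_of H a0)"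
      then have "card S * card E < card (coset_of H a0) * card E" using le pos by simp
      also have "\<dots> \<le> card (coset_of H a0) * card (dual_coset H \<xi>0)" using le by simp
      finally show False using prod by simp
    qed
    then have Seq: "S = coset_of H a0" using Ssub by (intro card_subset_eq) auto
    have "card E = card (dual_coset H \<xi>0)"
    proof (rule ccontr)
      assume "card E \<noteq> card (dual_coset H \<xi>0)"
      then have "card S * card E < card S * card (dual_coset H \<xi>0)" using le pos by simp
      then show False using prod Seq by simp
    qed
    then have Eeq: "E = dual_coset H \<xi>0" using Esub finite_dual_coset by (intro card_subset_eq) auto
    have "card (off n (dual_coset H \<xi>0) \<xi>) < s"
    proof (rule no_rows[OF _ \<xi>0])
      fix i assume i: "i \<in> off n (dual_coset H \<xi>0) \<xi>"
      then obtain h where h: "h \<in> H" "\<xi> i h \<noteq> \<xi>0 h"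
        using dual[of i] by (auto simp: off_def dual_coset_def)
      have "a0 + h \<in> S" using h by (simp add: Seq coset_of_def)
      then show "\<exists>a\<in>S. \<exists>a'\<in>S. \<xi> i (a - a') \<noteq> \<xi>0 (a - a')"
        using a0 h by (intro bexI[of _ "a0 + h"] bexI[of _ a0]) auto
    qed (auto simp: off_def)
    moreover have "card (off n (coset_of H a0) q) < s"
    proof (rule no_cols[OF _ a0])
      fix j assume j: "j \<in> off n (coset_of H a0) q"
      then have "q j - a0 \<notin> H" by (simp add: off_def coset_of_def)
      then obtain \<psi> where \<psi>: "\<psi> \<in> ann H" "\<psi> (q j - a0) \<noteq> 1" using ann_separates[OF H] by blast
      have "(\<lambda>a. \<psi> a * \<xi>0 a) \<in> E" unfolding Eeq by (rule ann_shift[OF \<xi>0d \<psi>(1)])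
      moreover have "\<psi> (q j - a0) * \<xi>0 (q j - a0) \<noteq> \<xi>0 (q j - a0)"
        using \<psi>(2) dual_nz[OF \<xi>0d] by simp
      ultimately show "\<exists>\<psi>\<in>E. \<exists>\<psi>'\<in>E. \<psi> (q j - a0) \<noteq> \<psi>' (q j - a0)"
        using \<xi>0 by (intro bexI[of _ "\<lambda>a. \<psi> a * \<xi>0 a"] bexI[of _ \<xi>0])
    qed (auto simp: off_def)
    ultimately show ?thesis using that(2)[OF H \<xi>0d, of a0] by simp
  qed
qed

text \<open>Dividing row \<open>i\<close> by \<open>\<xi> i a0\<close> and column \<open>j\<close> by \<open>\<xi>0 (q j - a0)\<close> turns the matrix into one that equals
  \<open>1\<close> outside the exceptional rows and columns, without changing the modulus of the permanent.\<close>

theorem typical_bound: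
  fixes q :: "nat \<Rightarrow> 'a::{ab_group_add,finite}" and a0 :: 'a and \<xi> :: "nat \<Rightarrow> 'a \<Rightarrow> complex" and D B N0 :: real
  assumes q: "q \<in> vectors n" and \<xi>: "\<xi> \<in> dual_vectors n" and H: "is_subgroup H" "\<xi>0 \<in> dual"
  defines "K \<equiv> off n (coset_of H a0) q" and "L \<equiv> off n (dual_coset H \<xi>0) \<xi>"
  assumes s: "card K \<le> s" "card L \<le> s"
    and typ_q: "\<And>\<psi>. \<psi> \<in> dual - ann H \<Longrightarrow> norm (\<Sum>j\<in>{1..n} - K. \<psi> (q j - a0)) \<le> D"
    and typ_\<xi>: "\<And>g. g \<notin> H \<Longrightarrow> norm (\<Sum>i\<in>{1..n} - L. \<xi> i g * cnj (\<xi>0 g)) \<le> D"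
    and B: "0 < B" "0 < N0" "(D + 2 * real s) * B + 3 * (2 * real s) \<le> N0 * B\<^sup>2" "N0 + 2 * real s \<le> n"
  shows "norm (permanent_avg (\<lambda>i j. \<xi> i (q j)) {1..n} {1..n}) \<le> B ^ (card L + card K)"
proof -
  define b where "b i j = \<xi> i (q j - a0) * cnj (\<xi>0 (q j - a0))" for i j
  have d: "\<xi> i \<in> dual" if "i \<in> {1..n}" for i using \<xi> that by (simp add: dual_vectorsD)
  have "permanent_avg (\<lambda>i j. \<xi> i (q j)) {1..n} {1..n} =
      permanent_avg (\<lambda>i j. \<xi> i a0 * \<xi>0 (q j - a0) * b i j) {1..n} {1..n}"
  proof (rule permanent_avg_cong)
    fix i j assume "i \<in> {1..n}" "j \<in> {1..n}"
    then have "\<xi> i (q j) = \<xi> i a0 * \<xi> i (q j - a0)"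
      using dual_add[OF d, of i a0 "q j - a0"] by simp
    also have "\<dots> = \<xi> i a0 * \<xi> i (q j - a0) * (\<xi>0 (q j - a0) * cnj (\<xi>0 (q j - a0)))"
      using H(2) by (simp add: dual_cnj_mult)
    finally show "\<xi> i (q j) = \<xi> i a0 * \<xi>0 (q j - a0) * b i j" by (simp add: b_def mult_ac)
  qed
  also have "norm \<dots> = norm (permanent_avg b {1..n} {1..n})"
    using d H(2) by (intro norm_permanent_avg_scale) (auto simp: norm_dual)
  also have "norm (permanent_avg b {1..n} {1..n}) \<le> B ^ (card L + card K)"
  proof (rule sparse_bound[OF B(1,2) B(3)])
    show "L \<subseteq> {1..n}" "K \<subseteq> {1..n}" by (auto simp: L_def K_def off_def)
    show "norm (b i j) \<le> 1" if "i \<in> {1..n}" for i j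
      using d[OF that] H(2) by (simp add: b_def norm_mult norm_dual)
    show "b i j = 1" if "i \<in> {1..n} - L" "j \<in> {1..n} - K" for i j
    proof -
      have "\<xi> i \<in> dual_coset H \<xi>0" "q j - a0 \<in> H" using that by (auto simp: L_def K_def off_def coset_of_def)
      then show ?thesis using H(2) by (simp add: b_def dual_coset_def dual_cnj_mult)
    qed
    show "norm (\<Sum>j\<in>{1..n} - K. b i j) + card L + card K \<le> D + 2 * real s" if i: "i \<in> L" for i
    proof -
      have di: "\<xi> i \<in> dual" and "\<xi> i \<notin> dual_coset H \<xi>0" using i d by (auto simp: L_def off_def)
      then obtain h where h: "h \<in> H" "\<xi> i h \<noteq> \<xi>0 h" by (auto simp: dual_coset_def)
      have "\<xi> i h * cnj (\<xi>0 h) \<noteq> 1"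
      proof
        assume "\<xi> i h * cnj (\<xi>0 h) = 1"
        then have "\<xi> i h * (cnj (\<xi>0 h) * \<xi>0 h) = \<xi>0 h" by (simp add: mult.assoc[symmetric])
        then show False using h(2) H(2) by (simp add: dual_cnj_mult')
      qed
      then have "(\<lambda>a. \<xi> i a * cnj (\<xi>0 a)) \<in> dual - ann H"
        using di H(2) h(1) by (auto simp: dual_mult dual_cnj ann_def)
      from typ_q[OF this] show ?thesis using s by (simp add: b_def)
    qed
    show "norm (\<Sum>i\<in>{1..n} - L. b i j) + card L + card K \<le> D + 2 * real s" if j: "j \<in> K" for j
    proof -
      have "q j - a0 \<notin> H" using j by (simp add: K_def off_def coset_of_def)
      from typ_\<xi>[OF this] show ?thesis using s by (simp add: b_def)
    qed
  qed (use s B in auto)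
  finally show ?thesis .
qed

section \<open>The total error for fixed n\<close>

lemma rare_count:
  fixes u :: real
  assumes "finite X" "C \<subseteq> X" "0 < u" "u \<le> 1"
  shows "card {x \<in> {1..n} \<rightarrow>\<^sub>E X. card (off n C x) \<le> N} \<le> u powr (- real N) * (card C + card X * u) ^ n"
  using exp_moment_count[OF assms, of 0 n "real N" 0 "\<lambda>_. 0"] by simp

lemma few_off_count:
  assumes X: "finite X" "C \<subseteq> X" "C \<noteq> {}" and n: "0 < n"
  shows "card {x \<in> {1..n} \<rightarrow>\<^sub>E X. card (off n C x) \<le> s} \<le> real (card C) ^ n * real n ^ s * exp (card X)"
proof -
  have "finite C" using X finite_subset by blast
  then have cC: "1 \<le> real (card C)" using X(3) by (simp add: One_nat_def Suc_le_eq card_gt_0_iff)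
  have "card C + card X * (1 / real n) \<le> card C * (1 + card X / real n)"
    using mult_left_mono[OF cC, of "card X / real n"] by (simp add: distrib_left mult.commute)
  also have "\<dots> \<le> card C * exp (card X / real n)"
    by (intro mult_left_mono exp_ge_add_one_self) auto
  finally have "(card C + card X * (1 / real n)) ^ n \<le> (card C * exp (card X / real n)) ^ n"
    by (intro power_mono) auto
  also have "\<dots> = real (card C) ^ n * exp (card X)"
    using n by (simp add: power_mult_distrib exp_of_nat_mult[symmetric])
  finally have base: "(card C + card X * (1 / real n)) ^ n \<le> real (card C) ^ n * exp (card X)" .
  have pw: "(1 / real n) powr (- real s) = real n ^ s"
    using n by (simp add: powr_minus powr_realpow field_simps)
  have "card {x \<in> {1..n} \<rightarrow>\<^sub>E X. card (off n C x) \<le> s} \<le> real n ^ s * (card C + card X * (1 / real n)) ^ n"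
    using rare_count[OF X(1,2), of "1 / real n" n s] n unfolding pw by simp
  also have "\<dots> \<le> real n ^ s * (real (card C) ^ n * exp (card X))"
    by (intro mult_left_mono base) auto
  finally show ?thesis by (simp only: mult_ac)
qed

lemma sum_of_bool: "finite A \<Longrightarrow> (\<Sum>x\<in>A. of_bool (P x)) = real (card {x\<in>A. P x})"
  by (simp add: sum.If_cases of_bool_def Int_def)

lemma sum_swap3:
  fixes f :: "'p \<Rightarrow> 'x \<Rightarrow> 'y \<Rightarrow> 'z::comm_monoid_add"
  shows "(\<Sum>x\<in>A. \<Sum>y\<in>B. \<Sum>p\<in>C. f p x y) = (\<Sum>p\<in>C. \<Sum>x\<in>A. \<Sum>y\<in>B. f p x y)"
proof -
  have "(\<Sum>x\<in>A. \<Sum>y\<in>B. \<Sum>p\<in>C. f p x y) = (\<Sum>x\<in>A. \<Sum>p\<in>C. \<Sum>y\<in>B. f p x y)"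
    by (intro sum.cong refl sum.swap)
  also have "\<dots> = (\<Sum>p\<in>C. \<Sum>x\<in>A. \<Sum>y\<in>B. f p x y)" by (rule sum.swap)
  finally show ?thesis .
qed

lemma sum_sum_mult:
  fixes f :: "'x \<Rightarrow> real" and g :: "'y \<Rightarrow> real"
  shows "(\<Sum>x\<in>A. \<Sum>y\<in>B. f x * g y) = (\<Sum>x\<in>A. f x) * (\<Sum>y\<in>B. g y)"
  by (simp add: sum_product)

text \<open>With \<open>z = B ^ 3\<close>, an upper bound for \<open>\<bar>F\<bar>\<^sup>3\<close> at nontrivial pairs with at most \<open>s\<close> exceptions on both
  sides. The first two sums count the characters outside the annihilator whose sum over the ordinary entries
  of \<open>q\<close> exceeds \<open>D\<close>, and likewise the group elements outside \<open>H\<close>. In the last term \<open>0 ^ k\<close> is the indicator of \<open>k = 0\<close>,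
  so pairs without exceptions, all of them trivial, are subtracted.\<close>

definition subgroup_error :: "nat \<Rightarrow> nat \<Rightarrow> real \<Rightarrow> real \<Rightarrow> 'a set \<times> 'a \<times> ('a \<Rightarrow> complex) \<Rightarrow>
    (nat \<Rightarrow> 'a::ab_group_add) \<Rightarrow> (nat \<Rightarrow> 'a \<Rightarrow> complex) \<Rightarrow> real" where
  "subgroup_error n s D z = (\<lambda>(H, a0, \<xi>0) q \<xi>.
     let K = off n (coset_of H a0) q; L = off n (dual_coset H \<xi>0) \<xi> in
     (\<Sum>\<psi>\<in>dual - ann H. of_bool (card K \<le> s \<and> D < norm (\<Sum>j\<in>{1..n} - K. \<psi> (q j - a0))) * of_bool (card L \<le> s))
   + (\<Sum>g\<in>- H. of_bool (card K \<le> s) * of_bool (card L \<le> s \<and> D < norm (\<Sum>i\<in>{1..n} - L. \<xi> i g * cnj (\<xi>0 g))))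
   + (z ^ card K * z ^ card L - 0 ^ card K * 0 ^ card L))"

lemma subgroup_error_nonneg:
  assumes "0 \<le> z"
  shows "0 \<le> subgroup_error n s D z t q \<xi>"
proof -
  have p: "(0::real) ^ k \<le> z ^ k" for k using assms by (intro power_mono) auto
  have "(0::real) ^ k * 0 ^ l \<le> z ^ k * z ^ l" for k l
    using p assms by (intro mult_mono) auto
  then show ?thesis
    by (cases t) (auto simp: subgroup_error_def Let_def intro!: add_nonneg_nonneg sum_nonneg)
qed

text \<open>Every sum over pairs splits into a factor for \<open>q\<close> and a factor for \<open>\<xi>\<close>; the powers \<open>c ^ n\<close> and \<open>c' ^ n\<close> that
  they contain combine to \<open>m ^ n\<close> because the cardinalities \<open>c\<close> and \<open>c'\<close> of the two cosets multiply to \<open>m\<close>.\<close>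

lemma sum_subgroup_error:
  fixes H :: "'a::{ab_group_add,finite} set" and D z :: real
  assumes H: "is_subgroup H" "\<xi>0 \<in> dual" and n: "0 < n" and D: "0 < D" "D \<le> 4 * n" and z: "0 \<le> z"
  defines "m \<equiv> real CARD('a)"
  shows "(\<Sum>q\<in>vectors n. \<Sum>\<xi>\<in>dual_vectors n. subgroup_error n s D z (H, a0, \<xi>0) q \<xi>) \<le>
    m ^ n * (8 * m * real n ^ (2 * s) * exp (2 * m) * exp (- D\<^sup>2 / (16 * real n)) + ((1 + m * z) ^ (2 * n) - 1))"
proof -
  let ?C = "coset_of H a0" and ?C' = "dual_coset H \<xi>0"
  let ?K = "\<lambda>q. off n ?C q" and ?L = "\<lambda>\<xi>. off n ?C' \<xi>"
  let ?tK = "\<lambda>\<psi> q. of_bool (card (?K q) \<le> s \<and> D < norm (\<Sum>j\<in>{1..n} - ?K q. \<psi> (q j - a0))) :: real"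
  let ?tL = "\<lambda>g \<xi>. of_bool (card (?L \<xi>) \<le> s \<and> D < norm (\<Sum>i\<in>{1..n} - ?L \<xi>. \<xi> i g * cnj (\<xi>0 g))) :: real"
  let ?V = "vectors n :: (nat \<Rightarrow> 'a) set" and ?X = "dual_vectors n :: (nat \<Rightarrow> 'a \<Rightarrow> complex) set"
  have V: "?V = {1..n} \<rightarrow>\<^sub>E UNIV" by (simp add: vectors_def)
  have finV: "finite ({1..n} \<rightarrow>\<^sub>E (UNIV :: 'a set))" using finite_vectors[of n] by (simp add: vectors_def)
  note finX = finite_dual_vectors[of n, where 'a = 'a]
  have sub: "?C \<subseteq> UNIV" "?C' \<subseteq> dual" by (auto simp: dual_coset_def)
  have ne: "?C \<noteq> {}" "?C' \<noteq> {}"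
  proof -
    have "a0 \<in> ?C" using H(1) by (simp add: coset_of_def is_subgroup_def)
    moreover have "\<xi>0 \<in> ?C'" using H(2) by (simp add: dual_coset_def)
    ultimately show "?C \<noteq> {}" "?C' \<noteq> {}" by auto
  qed
  define c c' where "c = real (card ?C)" and "c' = real (card ?C')"
  have cc: "c * c' = m"
    using card_coset_mult_card_dual_coset[OF H, of a0] unfolding c_def c'_def m_def
    by (metis of_nat_mult)
  have c0: "1 \<le> c" "1 \<le> c'"
    using ne finite_dual_coset by (auto simp: c_def c'_def One_nat_def Suc_le_eq card_gt_0_iff)
  have m1: "1 \<le> m" unfolding m_def by (simp add: One_nat_def Suc_le_eq)
  have cn: "c ^ n * c' ^ n = m ^ n" by (simp add: power_mult_distrib[symmetric] cc)
  let ?e = "exp (- D\<^sup>2 / (16 * real n))"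
  define few where "few = real n ^ s * exp m"
  have few0: "0 \<le> few" by (simp add: few_def)
  have few2: "few * few = real n ^ (2 * s) * exp (2 * m)"
    unfolding few_def mult_2 power_add exp_add by (simp only: mult_ac)
  have K: "(\<Sum>q\<in>?V. of_bool (card (?K q) \<le> s)) \<le> c ^ n * few"
    unfolding V sum_of_bool[OF finV] few_def
    using few_off_count[OF _ sub(1) ne(1) n, of s] by (simp add: c_def m_def mult_ac)
  have L: "(\<Sum>\<xi>\<in>?X. of_bool (card (?L \<xi>) \<le> s)) \<le> c' ^ n * few"
    unfolding sum_of_bool[OF finX] few_def
    using few_off_count[OF finite_dual sub(2) ne(2) n, of s] by (simp add: c'_def m_def card_dual mult_ac)
  have tailK: "(\<Sum>q\<in>?V. ?tK \<psi> q) \<le>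
      4 * (c ^ n * few * ?e)" if \<psi>: "\<psi> \<in> dual - ann H" for \<psi>
  proof -
    have d: "\<psi> \<in> dual" and "\<exists>h\<in>H. \<psi> h \<noteq> 1" using \<psi> by (auto simp: ann_def)
    then have "(\<Sum>a\<in>?C. \<psi> (a - a0)) = 0"
      using sum_dual_subgroup[OF H(1) d] by (auto simp: sum_coset_of)
    then show ?thesis
      unfolding V sum_of_bool[OF finV]
      using tail_count[OF _ sub(1) ne(1) n D, of "\<lambda>a. \<psi> (a - a0)" s] d
      by (simp add: norm_dual c_def few_def m_def mult_ac)
  qed
  have tailL: "(\<Sum>\<xi>\<in>?X. ?tL g \<xi>) \<le>
      4 * (c' ^ n * few * ?e)" if g: "g \<in> - H" for g
  proof -
    have "(\<Sum>\<psi>\<in>?C'. \<psi> g * cnj (\<xi>0 g)) = (\<Sum>\<psi>\<in>ann H. \<psi> g)"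
      by (rule sum_dual_coset[OF H(2), of "\<lambda>\<psi>. \<psi> g"])
    also have "\<dots> = 0" using g by (simp add: sum_ann[OF H(1)])
    finally have "(\<Sum>\<psi>\<in>?C'. \<psi> g * cnj (\<xi>0 g)) = 0" .
    moreover have "norm (\<psi> g * cnj (\<xi>0 g)) \<le> 1" if "\<psi> \<in> ?C'" for \<psi>
      using that H(2) by (simp add: dual_coset_def norm_mult norm_dual)
    ultimately show ?thesis
      unfolding sum_of_bool[OF finX]
      using tail_count[OF finite_dual sub(2) ne(2) n D, of "\<lambda>\<psi>. \<psi> g * cnj (\<xi>0 g)" s]
      by (simp add: c'_def few_def m_def card_dual mult_ac)
  qed
  have cards: "card (dual - ann H) \<le> m" "card (- H) \<le> m"
  proof -
    have "card (dual - ann H) \<le> card (dual :: ('a \<Rightarrow> complex) set)" "card (- H) \<le> CARD('a)"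
      by (auto intro!: card_mono simp: finite_dual)
    then show "card (dual - ann H) \<le> m" "card (- H) \<le> m" by (simp_all add: m_def card_dual)
  qed
  let ?b = "4 * (m ^ n * (few * few) * ?e)"
  have b0: "0 \<le> ?b" using few0 m1 by simp
  have part1: "(\<Sum>q\<in>?V. \<Sum>\<xi>\<in>?X. \<Sum>\<psi>\<in>dual - ann H.
      ?tK \<psi> q * of_bool (card (?L \<xi>) \<le> s)) \<le> m * ?b" (is "?S1 \<le> _")
  proof -
    have "?S1 =
      (\<Sum>\<psi>\<in>dual - ann H. (\<Sum>q\<in>?V. ?tK \<psi> q) *
        (\<Sum>\<xi>\<in>?X. of_bool (card (?L \<xi>) \<le> s) :: real))"
      unfolding sum_sum_mult[symmetric] by (rule sum_swap3)
    also have "\<dots> \<le> (\<Sum>\<psi>\<in>dual - ann H. 4 * (c ^ n * few * ?e) * (c' ^ n * few))"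
      using c0 few0 by (intro sum_mono mult_mono tailK L) (auto intro!: sum_nonneg)
    also have "\<dots> = card (dual - ann H) * ?b" by (simp add: cn[symmetric] mult_ac)
    also have "\<dots> \<le> m * ?b" using cards b0 by (intro mult_right_mono)
    finally show ?thesis .
  qed
  have part2: "(\<Sum>q\<in>?V. \<Sum>\<xi>\<in>?X. \<Sum>g\<in>- H. of_bool (card (?K q) \<le> s) *
      ?tL g \<xi>) \<le> m * ?b" (is "?S2 \<le> _")
  proof -
    have "?S2 =
      (\<Sum>g\<in>- H. (\<Sum>q\<in>?V. of_bool (card (?K q) \<le> s)) *
        (\<Sum>\<xi>\<in>?X. ?tL g \<xi> :: real))"
      unfolding sum_sum_mult[symmetric] by (rule sum_swap3)
    also have "\<dots> \<le> (\<Sum>g\<in>- H. (c ^ n * few) * (4 * (c' ^ n * few * ?e)))"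
      using c0 few0 by (intro sum_mono mult_mono tailL K) (auto intro!: sum_nonneg)
    also have "\<dots> = card (- H) * ?b" by (simp add: cn[symmetric] mult_ac)
    also have "\<dots> \<le> m * ?b" using cards b0 by (intro mult_right_mono)
    finally show ?thesis .
  qed
  have weightK: "(\<Sum>q\<in>?V. w ^ card (?K q)) = (c + (m - c) * w) ^ n" for w :: real
    unfolding V using sum_weight_off[OF finite sub(1), where g = "\<lambda>_. 1" and n = n and u = w] card_mono[OF finite sub(1)]
    by (simp add: c_def m_def of_nat_diff)
  have weightL: "(\<Sum>\<xi>\<in>?X. w ^ card (?L \<xi>)) = (c' + (m - c') * w) ^ n" for w :: real
    using sum_weight_off[OF finite_dual sub(2), where g = "\<lambda>_. 1" and n = n and u = w] card_mono[OF finite_dual sub(2)]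
    by (simp add: c'_def m_def of_nat_diff card_dual)
  have part3: "(\<Sum>q\<in>?V. \<Sum>\<xi>\<in>?X. z ^ card (?K q) * z ^ card (?L \<xi>) - 0 ^ card (?K q) * 0 ^ card (?L \<xi>)) \<le>
      m ^ n * ((1 + m * z) ^ (2 * n) - 1)" (is "?S3 \<le> _")
  proof -
    have "?S3 =
        (c + (m - c) * z) ^ n * (c' + (m - c') * z) ^ n - c ^ n * c' ^ n"
      by (simp add: sum_subtractf sum_sum_mult weightK weightL)
    also have "(c + (m - c) * z) ^ n * (c' + (m - c') * z) ^ n \<le> (c * (1 + m * z)) ^ n * (c' * (1 + m * z)) ^ n"
    proof -
      have cm: "c \<le> m" "c' \<le> m"
        using cc c0 by (metis mult.right_neutral mult_left_mono order_trans zero_le_one,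
            metis mult.left_neutral mult_right_mono order_trans zero_le_one)
      have "x + (m - x) * z \<le> x * (1 + m * z)" if "1 \<le> x" "x \<le> m" for x
      proof -
        have "(m - x) * z \<le> m * z" using that z by (intro mult_right_mono) auto
        also have "\<dots> \<le> x * (m * z)" using that z m1 mult_right_mono[OF that(1), of "m * z"] by simp
        finally show ?thesis by (simp add: distrib_left)
      qed
      then show ?thesis using c0 cm z m1 by (intro mult_mono power_mono) auto
    qed
    also have "(c * (1 + m * z)) ^ n * (c' * (1 + m * z)) ^ n - c ^ n * c' ^ n =
        c ^ n * c' ^ n * ((1 + m * z) ^ (2 * n) - 1)"
      unfolding power_mult_distrib mult_2 power_add right_diff_distrib by (simp only: mult_ac mult_1_right)
    finally show ?thesis by (simp only: cn)
  qed
  have "(\<Sum>q\<in>?V. \<Sum>\<xi>\<in>?X. subgroup_error n s D z (H, a0, \<xi>0) q \<xi>) \<le> (m * ?b + m * ?b) + m ^ n * ((1 + m * z) ^ (2 * n) - 1)"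
    unfolding subgroup_error_def Let_def case_prod_conv sum.distrib by (intro add_mono part1 part2 part3)
  also have "\<dots> = m ^ n * (8 * m * real n ^ (2 * s) * exp (2 * m) * ?e + ((1 + m * z) ^ (2 * n) - 1))"
    unfolding few2 by (simp add: algebra_simps)
  finally show ?thesis .
qed

definition small_pairs :: "('a::ab_group_add set \<times> ('a \<Rightarrow> complex) set) set" where
  "small_pairs = {(S, E). E \<subseteq> dual \<and> card S * card E < CARD('a)}"

definition subgroup_triples :: "('a::ab_group_add set \<times> 'a \<times> ('a \<Rightarrow> complex)) set" where
  "subgroup_triples = {(H, a0, \<xi>0). is_subgroup H \<and> \<xi>0 \<in> dual}"

lemma finite_small_pairs: "finite (small_pairs :: ('a::{ab_group_add,finite} set \<times> _) set)"
  by (rule finite_subset[of _ "UNIV \<times> Pow dual"]) (auto simp: small_pairs_def finite_dual)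

lemma finite_subgroup_triples: "finite (subgroup_triples :: ('a::{ab_group_add,finite} set \<times> _) set)"
  by (rule finite_subset[of _ "UNIV \<times> UNIV \<times> dual"]) (auto simp: subgroup_triples_def finite_dual)

definition rare_indicator :: "nat \<Rightarrow> nat \<Rightarrow> 'a set \<times> ('a \<Rightarrow> complex) set \<Rightarrow> (nat \<Rightarrow> 'a) \<Rightarrow> (nat \<Rightarrow> 'a \<Rightarrow> complex) \<Rightarrow> real" where
  "rare_indicator n N = (\<lambda>(S, E) q \<xi>. of_bool (card (off n S q) \<le> N) * of_bool (card (off n E \<xi>) \<le> N))"

lemma sum_rare_indicator:
  fixes u m :: real
  assumes p: "(S, E) \<in> (small_pairs :: ('a::{ab_group_add,finite} set \<times> _) set)" and u: "0 < u" "u \<le> 1"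
  defines "m \<equiv> real CARD('a)"
  shows "(\<Sum>q\<in>vectors n. \<Sum>\<xi>\<in>dual_vectors n. rare_indicator n N (S, E) q \<xi>) \<le>
    u powr (- (2 * real N)) * ((card S + m * u) * (card E + m * u)) ^ n"
proof -
  let ?V = "{1..n} \<rightarrow>\<^sub>E (UNIV :: 'a set)" and ?X = "dual_vectors n :: (nat \<Rightarrow> 'a \<Rightarrow> complex) set"
  have finV: "finite ?V" using finite_vectors[of n] by (simp add: vectors_def)
  note finX = finite_dual_vectors[of n, where 'a = 'a]
  have E: "E \<subseteq> dual" using p by (simp add: small_pairs_def)
  have "(\<Sum>q\<in>?V. \<Sum>\<xi>\<in>?X. rare_indicator n N (S, E) q \<xi>) =
      real (card {q\<in>?V. card (off n S q) \<le> N}) * real (card {\<xi>\<in>?X. card (off n E \<xi>) \<le> N})"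
    unfolding rare_indicator_def case_prod_conv sum_sum_mult sum_of_bool[OF finV] sum_of_bool[OF finX] ..
  also have "\<dots> \<le> (u powr (- real N) * (card S + m * u) ^ n) * (u powr (- real N) * (card E + m * u) ^ n)"
  proof (intro mult_mono)
    show "real (card {q\<in>?V. card (off n S q) \<le> N}) \<le> u powr (- real N) * (card S + m * u) ^ n"
      using rare_count[of UNIV S u n N] u by (simp add: m_def)
    show "real (card {\<xi>\<in>?X. card (off n E \<xi>) \<le> N}) \<le> u powr (- real N) * (card E + m * u) ^ n"
      using rare_count[OF finite_dual E u, of n N] by (simp add: m_def card_dual)
  qed (use u in \<open>auto simp: m_def\<close>)
  also have "\<dots> = (u powr (- real N) * u powr (- real N)) * ((card S + m * u) * (card E + m * u)) ^ n"
    by (simp add: power_mult_distrib mult_ac)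
  also have "u powr (- real N) * u powr (- real N) = u powr (- (2 * real N))"
    by (simp add: powr_add[symmetric])
  finally show ?thesis by (simp add: vectors_def)
qed

lemma trivial_pair_if_no_exceptions:
  fixes q :: "nat \<Rightarrow> 'a::{ab_group_add,finite}"
  assumes H: "is_subgroup H" and K: "off n (coset_of H a0) q = {}" and L: "off n (dual_coset H \<xi>0) \<xi> = {}"
  shows "trivial_pair n q \<xi>"
  unfolding trivial_pair_def
proof (intro ballI)
  fix i i' j j' assume I: "i \<in> {1..n}" "i' \<in> {1..n}" "j \<in> {1..n}" "j' \<in> {1..n}"
  have "q j - a0 \<in> H" "q j' - a0 \<in> H" using K I by (auto simp: off_def coset_of_def)
  then have "(q j - a0) - (q j' - a0) \<in> H" using H unfolding is_subgroup_def by blast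
  then have "q j - q j' \<in> H" by simp
  moreover have "\<xi> i \<in> dual_coset H \<xi>0" "\<xi> i' \<in> dual_coset H \<xi>0" using L I by (auto simp: off_def)
  ultimately show "\<xi> i (q j - q j') = \<xi> i' (q j - q j')" by (simp add: dual_coset_def)
qed

text \<open>The three terms on the right correspond to small \<open>F\<close>, to few popular values, and to few exceptions.\<close>

theorem pointwise_bound:
  fixes q :: "nat \<Rightarrow> 'a::{ab_group_add,finite}" and D B N0 :: real
  assumes gap: "swap_gap \<delta> TYPE('a)"
    and q: "q \<in> vectors n" and \<xi>: "\<xi> \<in> dual_vectors n" and nontriv: "\<not> trivial_pair n q \<xi>"
    and T: "CARD('a) * (r + 2 * s) < n" "0 < r + 2 * s"
    and B: "0 < B" "0 < N0" "(D + 2 * real s) * B + 3 * (2 * real s) \<le> N0 * B\<^sup>2" "N0 + 2 * real s \<le> n"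
  defines "F \<equiv> norm (char_fun n (shuffle_pmf n q) \<xi>)"
  shows "F ^ 3 \<le> (1 - \<delta> * (r / n)\<^sup>2) ^ s * F\<^sup>2
    + (\<Sum>p\<in>small_pairs. rare_indicator n (CARD('a) * (r + 2 * s)) p q \<xi>)
    + (\<Sum>t\<in>subgroup_triples. subgroup_error n s D (B ^ 3) t q \<xi>)"
proof -
  let ?\<kappa> = "(1 - \<delta> * (r / n)\<^sup>2) ^ s"
  let ?N = "CARD('a) * (r + 2 * s)"
  let ?R = "\<Sum>p\<in>small_pairs. rare_indicator n ?N p q \<xi>"
  let ?S = "\<Sum>t\<in>subgroup_triples. subgroup_error n s D (B ^ 3) t q \<xi>"
  have F: "0 \<le> F" "F \<le> 1" using norm_char_fun_le_1[OF \<xi>] by (auto simp: F_def)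
  note rn = le_if_CARD_mult_less(2)[OF T(1)]
  have \<kappa>: "0 \<le> ?\<kappa>"
    using contraction_factor_nonneg[OF _ _ rn, of \<delta>] gap by (simp add: swap_gap_def)
  have R0: "0 \<le> rare_indicator n ?N p q \<xi>" for p by (cases p) (simp add: rare_indicator_def)
  have S0: "0 \<le> subgroup_error n s D (B ^ 3) t q \<xi>" for t using B by (intro subgroup_error_nonneg) auto
  have nn: "0 \<le> ?R" "0 \<le> ?S" "0 \<le> ?\<kappa> * F\<^sup>2" using R0 S0 \<kappa> F by (auto intro!: sum_nonneg)
  have F1: "F ^ 3 \<le> 1" using F by (simp add: power_le_one)
  show ?thesis
  proof (cases "F \<le> ?\<kappa>")
    case True
    have "F ^ 3 = F * F\<^sup>2" by (simp add: power2_eq_square power3_eq_cube)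
    also have "\<dots> \<le> ?\<kappa> * F\<^sup>2" using True by (intro mult_right_mono) auto
    finally show ?thesis using nn by linarith
  next
    case False
    then have large: "\<not> norm (permanent_avg (\<lambda>i j. \<xi> i (q j)) {1..n} {1..n}) \<le> ?\<kappa>"
      by (simp add: F_def char_fun_shuffle)
    from pair_structure[OF gap q \<xi> T large] show ?thesis
    proof cases
      case 1
      let ?p = "(popular n (r + 2 * s) q, popular n (r + 2 * s) \<xi>)"
      have p: "?p \<in> small_pairs" using 1 popular_subset[OF \<xi> T(2)] by (simp add: small_pairs_def)
      have "1 = rare_indicator n ?N ?p q \<xi>"
        using card_off_popular[of UNIV q n "r + 2 * s"] card_off_popular[OF finite_dual \<xi>, of "r + 2 * s"] q
        by (simp add: rare_indicator_def vectors_def card_dual)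
      also have "\<dots> \<le> ?R" using p R0 finite_small_pairs by (intro member_le_sum) auto
      finally show ?thesis using F1 nn by linarith
    next
      case (2 H a0 \<xi>0)
      let ?t = "(H, a0, \<xi>0)"
      let ?K = "off n (coset_of H a0) q" and ?L = "off n (dual_coset H \<xi>0) \<xi>"
      have t: "?t \<in> subgroup_triples" using 2 by (simp add: subgroup_triples_def)
      have "F ^ 3 \<le> subgroup_error n s D (B ^ 3) ?t q \<xi>"
      proof -
        let ?z = "B ^ 3"
        let ?nK = "\<lambda>\<psi>. norm (\<Sum>j\<in>{1..n} - ?K. \<psi> (q j - a0))"
        let ?nL = "\<lambda>g. norm (\<Sum>i\<in>{1..n} - ?L. \<xi> i g * cnj (\<xi>0 g))"
        let ?P1 = "\<Sum>\<psi>\<in>dual - ann H. of_bool (card ?K \<le> s \<and> D < ?nK \<psi>) * of_bool (card ?L \<le> s) :: real"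
        let ?P2 = "\<Sum>g\<in>- H. of_bool (card ?K \<le> s) * of_bool (card ?L \<le> s \<and> D < ?nL g) :: real"
        let ?P3 = "?z ^ card ?K * ?z ^ card ?L - 0 ^ card ?K * 0 ^ card ?L"
        have eq: "subgroup_error n s D (B ^ 3) ?t q \<xi> = ?P1 + ?P2 + ?P3"
          by (simp add: subgroup_error_def Let_def)
        have P0: "0 \<le> ?P1" "0 \<le> ?P2" by (auto intro!: sum_nonneg)
        have "?K \<noteq> {} \<or> ?L \<noteq> {}" using trivial_pair_if_no_exceptions[OF 2(1)] nontriv by blast
        moreover have "finite ?K" "finite ?L" by (auto simp: off_def)
        ultimately have "(0::real) ^ card ?K * 0 ^ card ?L = 0" by auto
        then have P3: "?P3 = ?z ^ card ?K * ?z ^ card ?L" by simp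
        have P30: "0 \<le> ?P3" unfolding P3 using B by simp
        consider \<psi> where "\<psi> \<in> dual - ann H" "D < ?nK \<psi>"
          | g where "g \<in> - H" "D < ?nL g"
          | "\<And>\<psi>. \<psi> \<in> dual - ann H \<Longrightarrow> ?nK \<psi> \<le> D"
            "\<And>g. g \<notin> H \<Longrightarrow> ?nL g \<le> D"
          by (metis ComplI not_le)
        then show ?thesis
        proof cases
          case (1 \<psi>)
          have "1 = of_bool (card ?K \<le> s \<and> D < ?nK \<psi>) * (of_bool (card ?L \<le> s) :: real)"
            using 1 2 by simp
          also have "\<dots> \<le> ?P1" using 1 finite_dual by (intro member_le_sum) auto
          finally show ?thesis using eq P0 P30 F1 by linarith
        next
          case (2 g)
          have "1 = of_bool (card ?K \<le> s) * (of_bool (card ?L \<le> s \<and> D < ?nL g) :: real)"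
            using 2 \<open>card ?K \<le> s\<close> \<open>card ?L \<le> s\<close> by simp
          also have "\<dots> \<le> ?P2" using 2 by (intro member_le_sum) auto
          finally show ?thesis using eq P0 P30 F1 by linarith
        next
          case 3
          have "F \<le> B ^ (card ?L + card ?K)"
            unfolding F_def char_fun_shuffle
            by (rule typical_bound[OF q \<xi> 2(1,2,3,4) 3 B])
          then have "F ^ 3 \<le> (B ^ (card ?L + card ?K)) ^ 3" using F by (intro power_mono)
          also have "\<dots> = ?P3" unfolding P3 by (simp add: power_mult[symmetric] power_add[symmetric] algebra_simps)
          finally show ?thesis using eq P0 by linarith
        qed
      qed
      also have "\<dots> \<le> ?S" using t S0 finite_subgroup_triples by (intro member_le_sum) auto
      finally show ?thesis using nn by linarith
    qed
  qed
qed

theorem sum_d_inf_bound: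
  fixes D B N0 u m :: real
  assumes d: "3 \<le> d" and gap: "swap_gap \<delta> TYPE('a::{ab_group_add,finite})"
    and T: "CARD('a) * (r + 2 * s) < n" "0 < r + 2 * s" and D: "0 < D" "D \<le> 4 * n" and u: "0 < u" "u \<le> 1"
    and B: "0 < B" "0 < N0" "(D + 2 * real s) * B + 3 * (2 * real s) \<le> N0 * B\<^sup>2" "N0 + 2 * real s \<le> n"
  defines "m \<equiv> real CARD('a)"
  shows "(\<Sum>q\<in>(vectors n :: (nat \<Rightarrow> 'a) set).
      d_inf (vectors n) (map_pmf (\<lambda>A. mat_act n A q) (A_pmf n d)) (U_pmf n q d)) \<le>
    (1 - \<delta> * (r / n)\<^sup>2) ^ s * (real n + 1) ^ CARD('a)
    + (\<Sum>(S,E)\<in>(small_pairs :: ('a set \<times> _) set). u powr (- (2 * m * real (r + 2 * s))) * ((card S + m * u) * (card E + m * u) / m) ^ n)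
    + card (subgroup_triples :: ('a set \<times> 'a \<times> ('a \<Rightarrow> complex)) set) *
      (8 * m * real n ^ (2 * s) * exp (2 * m) * exp (- D\<^sup>2 / (16 * real n)) + ((1 + m * B ^ 3) ^ (2 * n) - 1))" (is "?lhs \<le> ?rhs")
proof -
  let ?P = "small_pairs :: ('a set \<times> _) set"
  let ?Q = "subgroup_triples :: ('a set \<times> 'a \<times> ('a \<Rightarrow> complex)) set"
  let ?err = "8 * m * real n ^ (2 * s) * exp (2 * m) * exp (- D\<^sup>2 / (16 * real n)) + ((1 + m * B ^ 3) ^ (2 * n) - 1)"
  let ?V = "vectors n :: (nat \<Rightarrow> 'a) set" and ?X = "dual_vectors n :: (nat \<Rightarrow> 'a \<Rightarrow> complex) set"
  let ?F = "\<lambda>q \<xi>. norm (char_fun n (shuffle_pmf n q) \<xi>)"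
  let ?\<kappa> = "(1 - \<delta> * (r / n)\<^sup>2) ^ s"
  let ?N = "CARD('a) * (r + 2 * s)"
  let ?R = "\<lambda>q \<xi>. \<Sum>p\<in>small_pairs. rare_indicator n ?N p q \<xi>"
  let ?S = "\<lambda>q \<xi>. \<Sum>t\<in>subgroup_triples. subgroup_error n s D (B ^ 3) t q \<xi>"
  have n0: "0 < n" using T by (metis gr_zeroI not_less_zero)
  have m0: "0 < m" by (simp add: m_def)
  note rn = le_if_CARD_mult_less(2)[OF T(1)]
  have \<kappa>: "0 \<le> ?\<kappa>"
    using contraction_factor_nonneg[OF _ _ rn, of \<delta>] gap by (simp add: swap_gap_def)
  have all: "0 \<le> ?\<kappa> * (?F q \<xi>)\<^sup>2 + ?R q \<xi> + ?S q \<xi>" for q \<xi>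
  proof (intro add_nonneg_nonneg mult_nonneg_nonneg \<kappa> sum_nonneg)
    show "0 \<le> rare_indicator n ?N p q \<xi>" for p by (cases p) (simp add: rare_indicator_def)
    show "0 \<le> subgroup_error n s D (B ^ 3) t q \<xi>" for t using B by (intro subgroup_error_nonneg) auto
  qed auto
  have "?lhs \<le>
      (\<Sum>q\<in>?V. (\<Sum>\<xi> | \<xi> \<in> ?X \<and> \<not> trivial_pair n q \<xi>. ?F q \<xi> ^ 3) / m ^ n)"
    unfolding m_def by (intro sum_mono d_inf_le_cubes d)
  also have "\<dots> \<le> (\<Sum>q\<in>?V. (\<Sum>\<xi>\<in>?X. ?\<kappa> * (?F q \<xi>)\<^sup>2 + ?R q \<xi> + ?S q \<xi>) / m ^ n)"
  proof (intro sum_mono divide_right_mono)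
    fix q assume q: "q \<in> ?V"
    let ?C = "{\<xi>. \<xi> \<in> ?X \<and> \<not> trivial_pair n q \<xi>}"
    have "(\<Sum>\<xi>\<in>?C. ?F q \<xi> ^ 3) \<le>
        (\<Sum>\<xi>\<in>?C. ?\<kappa> * (?F q \<xi>)\<^sup>2 + ?R q \<xi> + ?S q \<xi>)"
      using q by (intro sum_mono pointwise_bound[OF gap _ _ _ T B]) auto
    also have "\<dots> \<le> (\<Sum>\<xi>\<in>?X. ?\<kappa> * (?F q \<xi>)\<^sup>2 + ?R q \<xi> + ?S q \<xi>)"
      using all by (intro sum_mono2 finite_dual_vectors) auto
    finally show "(\<Sum>\<xi>\<in>?C. ?F q \<xi> ^ 3) \<le>
        (\<Sum>\<xi>\<in>?X. ?\<kappa> * (?F q \<xi>)\<^sup>2 + ?R q \<xi> + ?S q \<xi>)" .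
  qed (use m0 in auto)
  also have "\<dots> = (?\<kappa> * (\<Sum>q\<in>?V. \<Sum>\<xi>\<in>?X. (?F q \<xi>)\<^sup>2) + (\<Sum>p\<in>small_pairs. \<Sum>q\<in>?V. \<Sum>\<xi>\<in>?X. rare_indicator n ?N p q \<xi>)
      + (\<Sum>t\<in>subgroup_triples. \<Sum>q\<in>?V. \<Sum>\<xi>\<in>?X. subgroup_error n s D (B ^ 3) t q \<xi>)) / m ^ n"
    unfolding sum_divide_distrib[symmetric] sum.distrib sum_distrib_left
      sum_swap3[where C = small_pairs] sum_swap3[where C = subgroup_triples] ..
  also have "\<dots> \<le> (?\<kappa> * (m ^ n * (real n + 1) ^ CARD('a))
      + (\<Sum>(S,E)\<in>?P. u powr (- (2 * real ?N)) * ((card S + m * u) * (card E + m * u)) ^ n)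
      + (\<Sum>t\<in>?Q. m ^ n * ?err)) / m ^ n"
  proof (intro divide_right_mono add_mono mult_left_mono \<kappa> sum_mono)
    show "(\<Sum>q\<in>?V. \<Sum>\<xi>\<in>?X. (?F q \<xi>)\<^sup>2) \<le> m ^ n * (real n + 1) ^ CARD('a)"
      unfolding m_def by (rule second_moment)
    fix p assume p: "p \<in> ?P"
    then show "(\<Sum>q\<in>?V. \<Sum>\<xi>\<in>?X. rare_indicator n ?N p q \<xi>) \<le>
        (case p of (S, E) \<Rightarrow> u powr (- (2 * real ?N)) * ((card S + m * u) * (card E + m * u)) ^ n)"
      unfolding m_def by (cases p) (simp only: case_prod_conv sum_rare_indicator[OF _ u])
  next
    fix t assume t: "t \<in> ?Q"
    obtain H a0 \<xi>0 where t': "t = (H, a0, \<xi>0)" by (metis prod_cases3)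
    show "(\<Sum>q\<in>?V. \<Sum>\<xi>\<in>?X. subgroup_error n s D (B ^ 3) t q \<xi>) \<le>
        m ^ n * ?err"
      unfolding t' m_def using t B by (intro sum_subgroup_error n0 D) (auto simp: t' subgroup_triples_def)
  qed (use m0 in auto)
  also have "\<dots> = ?rhs"
  proof -
    have e: "2 * real ?N = 2 * m * real (r + 2 * s)" by (simp add: m_def)
    have "(\<Sum>(S,E)\<in>?P. u powr (- (2 * real ?N)) * ((card S + m * u) * (card E + m * u)) ^ n) / m ^ n =
       (\<Sum>(S,E)\<in>?P. u powr (- (2 * m * real (r + 2 * s))) * ((card S + m * u) * (card E + m * u) / m) ^ n)"
      unfolding sum_divide_distrib e by (intro sum.cong refl) (auto simp: power_divide)
    then show ?thesis using m0 by (simp add: add_divide_distrib)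
  qed
  finally show ?thesis .
qed

section \<open>Passage to the limit\<close>

lemma d_inf_nonneg: "0 \<le> d_inf (vectors n :: (nat \<Rightarrow> 'a::finite) set) X Y"
proof -
  have "(\<lambda>_\<in>{1..n}. undefined) \<in> (vectors n :: (nat \<Rightarrow> 'a) set)" by (simp add: vectors_def)
  then have "0 \<le> \<bar>pmf X (\<lambda>_\<in>{1..n}. undefined) - pmf Y (\<lambda>_\<in>{1..n}. undefined)\<bar> \<and>
      \<bar>pmf X (\<lambda>_\<in>{1..n}. undefined) - pmf Y (\<lambda>_\<in>{1..n}. undefined)\<bar> \<le> d_inf (vectors n :: (nat \<Rightarrow> 'a) set) X Y"
    unfolding d_inf_def using finite_vectors[of n, where 'a = 'a] by (intro conjI Max_ge) auto
  then show ?thesis by linarith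
qed

lemma stretched_exp_limit:
  assumes "(0::real) < c"
  shows "(\<lambda>n. exp (- c * (real n powr (1/10) - 1)) * (real n + 1) ^ k) \<longlonglongrightarrow> 0"
proof -
  have "(\<lambda>n. exp (- c * (real n powr (1/10) - 1)) * (real n + 1) powr real k) \<longlonglongrightarrow> 0"
    using assms by real_asymp
  then show ?thesis by (simp add: powr_realpow)
qed

lemma tail_limit:
  "(\<lambda>n. real n powr (2 * real n powr (1/10)) * exp (- (real n powr (3/5))\<^sup>2 / (16 * real n))) \<longlonglongrightarrow> 0"
  by real_asymp

lemma weight_limit: "(\<lambda>n. exp (2 * m * real n powr (-1/20)) - 1) \<longlonglongrightarrow> 0"
proof -
  have "(\<lambda>n. real n powr (-1/20)) \<longlonglongrightarrow> 0" by real_asymp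
  then have "(\<lambda>n. exp (2 * m * real n powr (-1/20)) - 1) \<longlonglongrightarrow> exp (2 * m * 0) - 1"
    by (intro tendsto_intros)
  then show ?thesis by simp
qed

text \<open>The weight \<open>u\<close> is small enough to keep the product of the two weighted alphabets below \<open>m\<close>, which holds
  with a margin of \<open>1\<close> for the alphabets \<open>S\<close> and \<open>E\<close> themselves.\<close>

lemma small_pair_base:
  fixes m u :: real
  assumes p: "(S, E) \<in> (small_pairs :: ('a::{ab_group_add,finite} set \<times> _) set)"
  defines "m \<equiv> real CARD('a)"
  defines "u \<equiv> 1 / (8 * m\<^sup>2)"
  shows "(card S + m * u) * (card E + m * u) \<le> m - 1 / 2"
proof -
  have m1: "1 \<le> m" by (simp add: m_def One_nat_def Suc_le_eq)
  have "card S * card E + 1 \<le> CARD('a)" using p by (simp add: small_pairs_def)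
  then have SE: "real (card S) * card E + 1 \<le> m" unfolding m_def by (metis of_nat_1 of_nat_add of_nat_le_iff of_nat_mult)
  have S: "card S \<le> m" unfolding m_def by (simp add: card_mono)
  have "card E \<le> CARD('a)" using p card_mono[OF finite_dual, of E] by (auto simp: small_pairs_def card_dual)
  then have E: "card E \<le> m" by (simp add: m_def)
  have mu: "m * u = 1 / (8 * m)" using m1 by (simp add: u_def power2_eq_square)
  have mu0: "0 \<le> m * u" "m * u \<le> 1 / 8" unfolding mu using m1 by (auto simp: field_simps)
  have mmu: "m * (m * u) = 1 / 8" unfolding mu using m1 by simp
  have "(m * u) * card S \<le> (m * u) * m" "(m * u) * card E \<le> (m * u) * m"
    using S E mu0 by (intro mult_left_mono; simp)+
  moreover have "(m * u) * (m * u) \<le> (1 / 8) * (1 / 8)" using mu0 by (intro mult_mono) auto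
  ultimately show ?thesis using SE mmu by (simp add: algebra_simps)
qed

theorem theorem1p5:
  fixes d :: nat
  assumes "d \<ge> 3"
  shows "(\<lambda>n. \<Sum>q\<in>(vectors n :: (nat \<Rightarrow> 'v::{ab_group_add, finite}) set).
            d_inf (vectors n) (map_pmf (\<lambda>A. mat_act n A q) (A_pmf n d)) (U_pmf n q d))
         \<longlonglongrightarrow> 0"
proof -
  define m where "m = real CARD('v)"
  have m1: "1 \<le> m" by (simp add: m_def One_nat_def Suc_le_eq)
  obtain \<delta> where gap: "swap_gap \<delta> TYPE('v)" using ex_swap_gap by blast
  then have \<delta>: "0 < \<delta>" "\<delta> \<le> 1" by (auto simp: swap_gap_def)
  define u where "u = 1 / (8 * m\<^sup>2)"
  have u: "0 < u" "u < 1"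
  proof -
    have "1 \<le> m\<^sup>2" using m1 by simp
    then show "0 < u" "u < 1" by (auto simp: u_def divide_less_eq)
  qed
  define \<rho> where "\<rho> = (m - 1 / 2) / m"
  have \<rho>: "0 < \<rho>" "\<rho> < 1" using m1 by (auto simp: \<rho>_def)
  define a where "a = - ln u"
  have a: "0 < a" using u by (simp add: a_def)
  \<comment> \<open>Popular means about \<open>\<epsilon> * n\<close> occurrences or more. The first bound on \<open>\<epsilon>\<close> makes popular values exist; the second
     keeps the cost \<open>u powr (- 2 * m * \<epsilon> * n)\<close> of unpopular entries below \<open>\<rho> powr (- n / 2)\<close>.\<close>
  define \<epsilon> where "\<epsilon> = min (1 / (2 * m)) (- ln \<rho> / (4 * m * a))"
  have \<epsilon>: "0 < \<epsilon>" "\<epsilon> * m \<le> 1 / 2" "4 * m * a * \<epsilon> \<le> - ln \<rho>"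
  proof -
    have "0 < - ln \<rho> / (4 * m * a)" using m1 \<rho> a by (intro divide_pos_pos) auto
    then show "0 < \<epsilon>" using m1 by (simp add: \<epsilon>_def)
    have "\<epsilon> \<le> 1 / (2 * m)" by (simp add: \<epsilon>_def)
    then show "\<epsilon> * m \<le> 1 / 2" using m1 by (simp add: field_simps)
    have "\<epsilon> \<le> - ln \<rho> / (4 * m * a)" by (simp add: \<epsilon>_def)
    then show "4 * m * a * \<epsilon> \<le> - ln \<rho>" using m1 a by (simp add: field_simps)
  qed
  have \<epsilon>1: "\<epsilon> \<le> 1" using mult_left_mono[OF m1, of \<epsilon>] \<epsilon>(1,2) by linarith
  define c where "c = - ln (1 - \<delta> * (\<epsilon> / 2)\<^sup>2)"
  have \<delta>\<epsilon>: "0 < \<delta> * (\<epsilon> / 2)\<^sup>2" "\<delta> * (\<epsilon> / 2)\<^sup>2 < 1"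
  proof -
    have "(\<epsilon> / 2)\<^sup>2 < 1" using \<epsilon>(1) \<epsilon>1 by (simp add: abs_square_less_1)
    then have "\<delta> * (\<epsilon> / 2)\<^sup>2 \<le> 1 * (\<epsilon> / 2)\<^sup>2" using \<delta> by (intro mult_right_mono) auto
    then show "\<delta> * (\<epsilon> / 2)\<^sup>2 < 1" using \<open>(\<epsilon> / 2)\<^sup>2 < 1\<close> by linarith
    show "0 < \<delta> * (\<epsilon> / 2)\<^sup>2" using \<delta> \<epsilon> by simp
  qed
  have c: "0 < c" using \<delta>\<epsilon> by (simp add: c_def)
  define s where "s n = nat \<lfloor>real n powr (1/10)\<rfloor>" for n
  define T where "T n = nat \<lfloor>\<epsilon> * real n\<rfloor>" for n
  have s: "real (s n) \<le> real n powr (1/10)" "real n powr (1/10) - 1 \<le> real (s n)" for n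
    unfolding s_def by (simp_all add: of_nat_nat)
  have T: "real (T n) \<le> \<epsilon> * real n" "\<epsilon> * real n - 1 \<le> real (T n)" for n
    using \<epsilon>(1) unfolding T_def by (simp_all add: of_nat_nat)
  define P :: "('v set \<times> ('v \<Rightarrow> complex) set) set" where "P = small_pairs"
  define Q :: "('v set \<times> 'v \<times> ('v \<Rightarrow> complex)) set" where "Q = subgroup_triples"
  \<comment> \<open>The bound of \<open>sum_d_inf_bound\<close> with \<open>D = n powr (3/5)\<close> and \<open>B = n powr (- 7/20)\<close>; note \<open>n * B ^ 3 = n powr (- 1/20)\<close>.\<close>
  define g where "g n = exp (- c * (real n powr (1/10) - 1)) * (real n + 1) ^ CARD('v) + card P * sqrt \<rho> ^ n
    + card Q * (8 * m * exp (2 * m) *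
        (real n powr (2 * real n powr (1/10)) * exp (- (real n powr (3/5))\<^sup>2 / (16 * real n)))
      + (exp (2 * m * real n powr (-1/20)) - 1))" for n
  have "(\<lambda>n. sqrt \<rho> ^ n) \<longlonglongrightarrow> 0" using \<rho> by (intro LIMSEQ_power_zero) auto
  then have "g \<longlonglongrightarrow> 0 + real (card P) * 0 + real (card Q) * (8 * m * exp (2 * m) * 0 + 0)"
    unfolding g_def by (intro tendsto_intros stretched_exp_limit[OF c] tail_limit weight_limit) (use \<rho> in auto)
  then have g: "g \<longlonglongrightarrow> 0" by simp
  let ?f = "\<lambda>n. \<Sum>q\<in>(vectors n :: (nat \<Rightarrow> 'v) set).
            d_inf (vectors n) (map_pmf (\<lambda>A. mat_act n A q) (A_pmf n d)) (U_pmf n q d)"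
  have ev1: "\<forall>\<^sub>F n in sequentially. 2 * real n powr (1/10) + 1 \<le> \<epsilon> / 2 * real n"
    using \<epsilon>(1) by real_asymp
  have ev2: "\<forall>\<^sub>F n in sequentially. (real n powr (3/5) + 2 * real n powr (1/10)) * real n powr (-7/20) +
      6 * real n powr (1/10) \<le> real n / 2 * (real n powr (-7/20))\<^sup>2"
    by real_asymp
  have ev3: "\<forall>\<^sub>F n in sequentially. 2 * real n powr (1/10) \<le> real n / 2" by real_asymp
  have "\<forall>\<^sub>F n in sequentially. ?f n \<le> g n"
    using eventually_gt_at_top[of 0] ev1 ev2 ev3
  proof eventually_elim
    case (elim n)
    define D where "D = real n powr (3/5)"
    define B where "B = real n powr (-7/20)"
    define r where "r = T n - 2 * s n"
    have n1: "1 \<le> real n" using elim(1) by simp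
    have sT: "2 * real (s n) + \<epsilon> / 2 * real n \<le> real (T n)" using s[of n] T[of n] elim(2) by linarith
    have le: "2 * s n \<le> T n"
    proof -
      have "0 \<le> \<epsilon> / 2 * real n" using \<epsilon>(1) by simp
      then have "real (2 * s n) \<le> real (T n)" using sT by simp
      then show ?thesis by (simp only: of_nat_le_iff)
    qed
    have rs: "r + 2 * s n = T n" using le by (simp add: r_def)
    have rr: "\<epsilon> / 2 * real n \<le> real r" using sT le by (simp add: r_def of_nat_diff)
    have rn: "\<epsilon> / 2 \<le> real r / n" using rr n1 by (simp add: le_divide_eq)
    have mT: "m * real (T n) \<le> real n / 2"
    proof -
      have "m * real (T n) \<le> m * (\<epsilon> * real n)" using T[of n] m1 by (intro mult_left_mono) auto
      also have "\<dots> = (\<epsilon> * m) * real n" by simp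
      also have "\<dots> \<le> (1 / 2) * real n" using \<epsilon>(2) n1 by (intro mult_right_mono) auto
      finally show ?thesis by simp
    qed
    have T1: "CARD('v) * (r + 2 * s n) < n"
    proof -
      have "real (CARD('v) * (r + 2 * s n)) < real n" using mT n1 unfolding rs by (simp add: m_def)
      then show ?thesis by (simp only: of_nat_less_iff)
    qed
    have T0: "0 < r + 2 * s n"
    proof -
      have "0 < \<epsilon> / 2 * real n" using \<epsilon>(1) n1 by simp
      then show ?thesis using rr by simp
    qed
    have D: "0 < D" "D \<le> 4 * real n"
    proof -
      show "0 < D" using n1 by (simp add: D_def)
      have "D \<le> real n powr 1" unfolding D_def using n1 by (intro powr_mono) auto
      then show "D \<le> 4 * real n" using n1 by simp
    qed
    have B: "0 < B" using n1 by (simp add: B_def)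
    have cond: "(D + 2 * real (s n)) * B + 3 * (2 * real (s n)) \<le> real n / 2 * B\<^sup>2"
    proof -
      have "(D + 2 * real (s n)) * B \<le> (D + 2 * real n powr (1/10)) * B"
        using s(1)[of n] B by (intro mult_right_mono) auto
      then show ?thesis using elim(3) s(1)[of n] unfolding D_def B_def by linarith
    qed
    have N0: "real n / 2 + 2 * real (s n) \<le> real n" using elim(4) s(1)[of n] by linarith
    let ?h = "\<lambda>(S, E). u powr (- (2 * m * real (r + 2 * s n))) * ((card S + m * u) * (card E + m * u) / m) ^ n"
    have "?f n \<le> (1 - \<delta> * (r / n)\<^sup>2) ^ s n * (real n + 1) ^ CARD('v)
      + (\<Sum>p\<in>P. ?h p)
      + card Q * (8 * m * real n ^ (2 * s n) * exp (2 * m) * exp (- D\<^sup>2 / (16 * real n)) + ((1 + m * B ^ 3) ^ (2 * n) - 1))"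
      unfolding P_def Q_def m_def
      by (rule sum_d_inf_bound[OF assms gap T1 T0 D u(1) less_imp_le[OF u(2)] B _ cond N0]) (use n1 in simp)
    also have "\<dots> \<le> g n"
      unfolding g_def D_def[symmetric]
    proof (intro add_mono mult_right_mono mult_left_mono)
      have "(1 - \<delta> * (r / n)\<^sup>2) ^ s n \<le> (1 - \<delta> * (\<epsilon> / 2)\<^sup>2) ^ s n"
      proof (intro power_mono diff_left_mono mult_left_mono)
        show "\<epsilon> / 2 \<le> real r / real n" by (rule rn)
        show "0 \<le> 1 - \<delta> * (r / n)\<^sup>2"
          by (rule contraction_factor_nonneg[OF \<delta> le_if_CARD_mult_less(2)[OF T1]])
      qed (use \<delta> \<epsilon> in auto)
      also have "\<dots> = exp (- c * s n)"
        using \<delta>\<epsilon> by (simp add: c_def exp_of_nat2_mult)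
      also have "\<dots> \<le> exp (- c * (real n powr (1/10) - 1))" using c s(2)[of n] by simp
      finally show "(1 - \<delta> * (r / n)\<^sup>2) ^ s n \<le> exp (- c * (real n powr (1/10) - 1))" .
    next
      have "(\<Sum>p\<in>P. ?h p) \<le>
          (\<Sum>p\<in>P. sqrt \<rho> ^ n)"
      proof (rule sum_mono)
        fix p assume p: "p \<in> P"
        obtain S E where SE: "p = (S, E)" by (cases p)
        have "(card S + m * u) * (card E + m * u) \<le> m - 1 / 2"
          using small_pair_base[of S E] p unfolding SE P_def m_def u_def by simp
        then have base: "(card S + m * u) * (card E + m * u) / m \<le> \<rho>"
          unfolding \<rho>_def using m1 by (intro divide_right_mono) auto
        have "u powr (- (2 * m * real (T n))) = exp (2 * m * a * real (T n))"
          using u by (simp add: powr_def a_def)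
        also have "\<dots> \<le> exp (2 * m * a * (\<epsilon> * n))"
          using T(1)[of n] m1 a by (simp add: mult_left_mono)
        also have "\<dots> \<le> exp (n * (- ln \<rho> / 2))"
          using mult_right_mono[OF \<epsilon>(3), of "n / 2"] by (simp add: mult_ac)
        also have "\<dots> = inverse (sqrt \<rho>) ^ n"
          using \<rho> by (simp add: exp_of_nat_mult exp_minus power_inverse ln_sqrt[symmetric] real_sqrt_gt_zero)
        finally have uT: "u powr (- (2 * m * real (r + 2 * s n))) \<le> inverse (sqrt \<rho>) ^ n" unfolding rs .
        have "u powr (- (2 * m * real (r + 2 * s n))) * ((card S + m * u) * (card E + m * u) / m) ^ n \<le>
            inverse (sqrt \<rho>) ^ n * \<rho> ^ n"
          using m1 u base \<rho> by (intro mult_mono uT power_mono) auto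
        also have "\<dots> = (inverse (sqrt \<rho>) * \<rho>) ^ n" by (simp add: power_mult_distrib)
        also have "inverse (sqrt \<rho>) * \<rho> = sqrt \<rho>"
          using \<rho> real_sqrt_mult_self[of \<rho>] by (simp add: field_simps)
        finally show "?h p \<le> sqrt \<rho> ^ n"
          by (simp add: SE)
      qed
      then show "(\<Sum>p\<in>P. ?h p) \<le>
          card P * sqrt \<rho> ^ n" by simp
    next
      have "real n ^ (2 * s n) = real n powr (2 * real (s n))" using n1 by (simp add: powr_realpow[symmetric])
      also have "\<dots> \<le> real n powr (2 * real n powr (1/10))" using n1 s(1)[of n] by (intro powr_mono) auto
      finally have "real n ^ (2 * s n) \<le> real n powr (2 * real n powr (1/10))" .
      then have "(8 * m * exp (2 * m)) * (real n ^ (2 * s n) * exp (- D\<^sup>2 / (16 * real n))) \<le>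
          (8 * m * exp (2 * m)) * (real n powr (2 * real n powr (1/10)) * exp (- D\<^sup>2 / (16 * real n)))"
        using m1 by (intro mult_left_mono mult_right_mono) auto
      then show "8 * m * real n ^ (2 * s n) * exp (2 * m) * exp (- D\<^sup>2 / (16 * real n)) \<le>
          8 * m * exp (2 * m) * (real n powr (2 * real n powr (1/10)) * exp (- D\<^sup>2 / (16 * real n)))"
        by (simp only: mult_ac)
    next
      have "(1 + m * B ^ 3) ^ (2 * n) \<le> exp (m * B ^ 3) ^ (2 * n)"
        using m1 B by (intro power_mono exp_ge_add_one_self) auto
      also have "\<dots> = exp (2 * m * (real n * B ^ 3))"
        by (simp add: exp_of_nat_mult[symmetric] mult_ac)
      also have "real n * B ^ 3 = real n powr (-1/20)"
      proof -
        have "B ^ 3 = real n powr (-21/20)" using n1 by (simp add: B_def powr_power)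
        then have "real n * B ^ 3 = real n powr 1 * real n powr (-21/20)" using n1 by simp
        also have "\<dots> = real n powr (-1/20)" by (subst powr_add[symmetric]) simp
        finally show ?thesis .
      qed
      finally show "(1 + m * B ^ 3) ^ (2 * n) - 1 \<le> exp (2 * m * real n powr (-1/20)) - 1" by simp
    qed auto
    finally show ?case .
  qed
  then show ?thesis
    by (rule tendsto_sandwich[OF _ _ tendsto_const g, rotated]) (simp add: d_inf_nonneg sum_nonneg)
qed

end
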